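(* For every $\boldsymbol x=(x_1,x_2)\in\mathcal Z^2$, $$\Big(\frac{\tau_\ell(\ell^2\boldsymbol x)}{\ell^2},\ \frac{T_\ell(\ell^2\boldsymbol x)}{\ell^3}\Big)\ \longrightarrow\ \Big(\frac{\varrho}{2},\ \frac14\int_0^{\varrho}(1+B_t)\,\mathrm dt\Big)$$ in distribution as $\ell\to\infty$ (through values $\ell>0$ with $\ell^2x_1\in\mathbb Z$).
   Context: Let $\mathcal Z^2=\{(x_1,x_2)\in\mathbb Z^2: x_1+x_2\in 2\mathbb Z\}$, and let $\{\xi_{\boldsymbol x}:\boldsymbol x\in\mathcal Z^2\}$ be i.i.d. Bernoulli$(1/2)$ random variables. From each node $\boldsymbol x=(x_1,x_2)\in\mathcal Z^2$ draw one directed edge: to $(x_1-1,x_2+1)$ if $\xi_{\boldsymbol x}=1$, and to $(x_1-1,x_2-1)$ if $\xi_{\boldsymbol x}=0$. Every node carries one unit of traffic, which flows along the directed edges to the left. For $\boldsymbol x=(x_1,x_2)$ and $\ell>0$ let $I_\ell(\boldsymbol x)=\{x_1\}\times[x_2-\ell/2,x_2+\ell/2]$. $T_\ell(\boldsymbol x)$ is the total amount of traffic flowing through $I_\ell(\boldsymbol x)$, i.e. the number of nodes $\boldsymbol y\in\mathcal Z^2$ whose directed path (started at and including $\boldsymbol y$) visits a node in $I_\ell(\boldsymbol x)$. $\tau_\ell(\boldsymbol x)$ is the number of points in the longest path carrying traffic through $I_\ell(\boldsymbol x)$, i.e. the maximum, over such $\boldsymbol y$, of the number of nodes on the directed path from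 $\boldsymbol y$ (included) to its node in $I_\ell(\boldsymbol x)$ (included), with value $0$ if there is no such $\boldsymbol y$. For non-lattice second coordinate of $\boldsymbol x$ the same definitions apply. $\{B_t:t\ge0\}$ is a standard Brownian motion started at $0$ and $\varrho=\inf\{t\ge0:1+B_t=0\}$. *)

theory Defs
  imports "HOL-Probability.Probability"
begin

definition even_lattice :: "(int \<times> int) set" where
  "even_lattice = {(x1, x2). even (x1 + x2)}"

text \<open>A configuration \<open>\<eta>\<close> prescribes the direction of the edge leaving each node:
  \<open>True\<close> stands for the value 1 (up-left), \<open>False\<close> for the value 0 (down-left).
  Only its values on \<^const>\<open>even_lattice\<close> matter, as this set is closed under \<open>step \<eta>\<close>.\<close>

definition step :: "(int \<times> int \<Rightarrow> bool) \<Rightarrow> int \<times> int \<Rightarrow> int \<times> int" where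
  "step \<eta> x = (fst x - 1, if \<eta> x then snd x + 1 else snd x - 1)"

definition path_at :: "(int \<times> int \<Rightarrow> bool) \<Rightarrow> int \<times> int \<Rightarrow> nat \<Rightarrow> int \<times> int" where
  "path_at \<eta> y n = (step \<eta> ^^ n) y"

definition segment :: "real \<Rightarrow> real \<times> real \<Rightarrow> (real \<times> real) set" where
  "segment l p = {fst p} \<times> {snd p - l / 2 .. snd p + l / 2}"

definition hits_at ::
  "(int \<times> int \<Rightarrow> bool) \<Rightarrow> real \<Rightarrow> real \<times> real \<Rightarrow> int \<times> int \<Rightarrow> nat \<Rightarrow> bool" where
  "hits_at \<eta> l p y n \<longleftrightarrow>
     (real_of_int (fst (path_at \<eta> y n)), real_of_int (snd (path_at \<eta> y n))) \<in> segment l p"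

text \<open>For i.i.d. fair directions only finitely many nodes send their traffic through a given
  segment, almost surely.  The conventions of \<^const>\<open>card\<close> and \<^const>\<open>Max\<close> for infinite
  sets are thus only relevant on a null event.\<close>

definition traffic :: "(int \<times> int \<Rightarrow> bool) \<Rightarrow> real \<Rightarrow> real \<times> real \<Rightarrow> nat" where
  "traffic \<eta> l p = card {y \<in> even_lattice. \<exists>n. hits_at \<eta> l p y n}"

definition path_lengths :: "(int \<times> int \<Rightarrow> bool) \<Rightarrow> real \<Rightarrow> real \<times> real \<Rightarrow> nat set" where
  "path_lengths \<eta> l p =
     {card (path_at \<eta> y ` {..n}) | y n. y \<in> even_lattice \<and> hits_at \<eta> l p y n}"

definition longest_path :: "(int \<times> int \<Rightarrow> bool) \<Rightarrow> real \<Rightarrow> real \<times> real \<Rightarrow> nat" where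
  "longest_path \<eta> l p =
     (if path_lengths \<eta> l p = {} then 0 else Max (path_lengths \<eta> l p))"

definition standard_brownian_motion :: "'b measure \<Rightarrow> (real \<Rightarrow> 'b \<Rightarrow> real) \<Rightarrow> bool" where
  "standard_brownian_motion N B \<longleftrightarrow>
     prob_space N \<and>
     (\<forall>t\<ge>0. B t \<in> borel_measurable N) \<and>
     (\<forall>\<omega>\<in>space N. B 0 \<omega> = 0) \<and>
     (\<forall>\<omega>\<in>space N. continuous_on {0..} (\<lambda>t. B t \<omega>)) \<and>
     (\<forall>s t. 0 \<le> s \<and> s < t \<longrightarrow>
        distributed N lborel (\<lambda>\<omega>. B t \<omega> - B s \<omega>) (normal_density 0 (sqrt (t - s)))) \<and>
     (\<forall>(n::nat) t. 0 \<le> t 0 \<and> (\<forall>i<n. t i \<le> t (Suc i)) \<longrightarrow>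
        prob_space.indep_vars N (\<lambda>_. borel) (\<lambda>i \<omega>. B (t (Suc i)) \<omega> - B (t i) \<omega>) {..<n})"

text \<open>The set below is almost surely nonempty when \<open>B\<close> is a Brownian motion, so the value of
  \<^const>\<open>Inf\<close> at the empty set is only relevant on a null event.\<close>

definition hitting_time :: "(real \<Rightarrow> 'b \<Rightarrow> real) \<Rightarrow> 'b \<Rightarrow> real" where
  "hitting_time B \<omega> = Inf {t. 0 \<le> t \<and> 1 + B t \<omega> = 0}"

text \<open>The library's \<^const>\<open>weak_conv_m\<close> covers only sequences of measures on the real line; the
  following is convergence in distribution of random elements of any topological space, along an
  arbitrary filter.  Measurability is part of the notion, so that the expectations are meaningful.\<close>

definition converges_in_distribution ::
  "'i filter \<Rightarrow> 'a measure \<Rightarrow> ('i \<Rightarrow> 'a \<Rightarrow> 'c::topological_space) \<Rightarrow>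
   'b measure \<Rightarrow> ('b \<Rightarrow> 'c) \<Rightarrow> bool" where
  "converges_in_distribution F M X N Y \<longleftrightarrow>
     (\<forall>\<^sub>F i in F. X i \<in> borel_measurable M) \<and> Y \<in> borel_measurable N \<and>
     (\<forall>f :: 'c \<Rightarrow> real. continuous_on UNIV f \<and> bounded (range f) \<longrightarrow>
        ((\<lambda>i. \<integral>\<omega>. f (X i \<omega>) \<partial>M) \<longlongrightarrow> (\<integral>\<omega>. f (Y \<omega>) \<partial>N)) F)"

end

theory Submission
  imports Defs
begin

text \<open>Paths do not cross, so the nodes of one column that send their traffic through the segment form a
block without gaps. Passing to the next column on the right, every node strictly inside the new block
flows into the old one, and only the two extreme candidates toss their coins. The number of nodes in the
block is therefore a random walk with steps \<open>-1, 0, 1\<close> of probabilities \<open>1/4, 1/2, 1/4\<close>, started near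
\<open>l/2\<close> and killed on reaching \<open>0\<close>. The longest path is the killing time, the traffic is the sum of the
widths up to that time. Measured in units of \<open>l/2\<close> the width starts near \<open>1\<close> and gains the variance
\<open>2/l\<^sup>2\<close> per column, so it behaves like \<open>1 + B\<close> with \<open>l\<^sup>2/2\<close> columns to a unit of time. This gives the
factor \<open>1/2\<close> of the passage time and, with the unit \<open>l/2\<close> of width, the factor \<open>1/4\<close> of the area.

The limit is identified through Laplace transforms. For \<open>a > 0\<close>
and \<open>b \<ge> 0\<close> let \<open>u\<close> be the solution of \<open>u'' = (a + b x / 2) u\<close> on the half line that decays and has
\<open>u 0 = 1\<close>. For a process \<open>X\<close> with small centred independent steps of variance \<open>\<delta>\<close>, the product of
\<open>u (X k)\<close> and the discount \<open>exp (- \<Sum>j<k. \<delta> (a + b X j / 2) / 2)\<close>, stopped when \<open>X\<close> becomes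
nonpositive, is a martingale up to an error of order \<open>\<delta> powr (3/2)\<close> per step. The discount makes these
errors summable, with a sum of order \<open>sqrt \<delta>\<close> (\<open>passage_value_expectation\<close>). Applied to the width
(\<open>walk_passage_bound\<close>) and to Brownian motion sampled on the grid of mesh \<open>(1/2) ^ n\<close>
(\<open>killed_weight_expectation\<close>), this shows that both transforms tend to \<open>u 1\<close>.

Three points remain. The solution \<open>u\<close> is obtained from a growing power series by reduction of order
(\<open>decaying_solution_exists\<close>). Sampling on dyadic grids detects a passage of the Brownian path only when
the path becomes nonpositive at a dyadic time; that this is almost surely the hitting time of \<open>0\<close>
follows by squeezing the hitting time between the dyadic passages from two starting points and letting
them merge (\<open>hitting_time_eq_dyadic_passage\<close>). Finally, Laplace transforms determine weak convergence
on the quadrant by the theorem of Stone and Weierstrass (\<open>converges_in_distribution_laplace\<close>).\<close>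

section \<open>Weak convergence from Laplace transforms on the quadrant\<close>

text \<open>Polynomials in two variables that are divisible by the first one. With \<open>s = exp (- x)\<close> and
\<open>t = exp (- y)\<close> their monomials are the functions \<open>exp (- (a x + b y))\<close> with integers \<open>a \<ge> 1\<close> and \<open>b \<ge> 0\<close>,
so their expectations are values of a Laplace transform whose first argument is positive.\<close>
inductive first_divisible_poly :: "(real \<times> real \<Rightarrow> real) \<Rightarrow> bool" where
  monomial: "first_divisible_poly (\<lambda>z. fst z ^ Suc i * snd z ^ j)"
| add: "first_divisible_poly g \<Longrightarrow> first_divisible_poly h \<Longrightarrow> first_divisible_poly (\<lambda>z. g z + h z)"
| scale: "first_divisible_poly h \<Longrightarrow> first_divisible_poly (\<lambda>z. c * h z)"

text \<open>Stone and Weierstrass approximate \<open>G\<close> by polynomials \<open>g\<close>, and \<open>fst\<close> is at most \<open>1\<close> on the square. To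
stay within the inductive class, the algebra used consists of the multipliers of that class; it contains
both coordinates.\<close>
lemma first_divisible_poly_approx:
  fixes G :: "real \<times> real \<Rightarrow> real"
  assumes "continuous_on ({0..1} \<times> {0..1}) G" and e: "0 < e"
  shows "\<exists>h. first_divisible_poly h \<and> (\<forall>z\<in>{0..1} \<times> {0..1}. \<bar>fst z * G z - h z\<bar> < e)"
proof -
  let ?P = "\<lambda>g. continuous_on UNIV g \<and>
    (\<forall>h. first_divisible_poly h \<longrightarrow> first_divisible_poly (\<lambda>z. g z * h z))"
  have fst: "?P fst"
  proof (intro conjI allI impI)
    show "continuous_on UNIV (fst :: real \<times> real \<Rightarrow> real)" by (intro continuous_intros)
    fix h assume "first_divisible_poly h"
    then show "first_divisible_poly (\<lambda>z. fst z * h z)"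
    proof induction
      case (monomial i j)
      then show ?case using first_divisible_poly.monomial[of "Suc i" j] by (simp add: mult.assoc)
    next
      case (add g h)
      then show ?case using first_divisible_poly.add by (fastforce simp: distrib_left)
    next
      case (scale h c)
      then show ?case using first_divisible_poly.scale[of "\<lambda>z. fst z * h z" c] by (simp add: mult.left_commute)
    qed
  qed
  have snd: "?P snd"
  proof (intro conjI allI impI)
    show "continuous_on UNIV (snd :: real \<times> real \<Rightarrow> real)" by (intro continuous_intros)
    fix h assume "first_divisible_poly h"
    then show "first_divisible_poly (\<lambda>z. snd z * h z)"
    proof induction
      case (monomial i j)
      then show ?case using first_divisible_poly.monomial[of i "Suc j"] by (simp add: mult_ac)
    next
      case (add g h)
      then show ?case using first_divisible_poly.add by (fastforce simp: distrib_left)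
    next
      case (scale h c)
      then show ?case using first_divisible_poly.scale[of "\<lambda>z. snd z * h z" c] by (simp add: mult.left_commute)
    qed
  qed
  have "\<exists>g. ?P g \<and> (\<forall>z\<in>{0..1} \<times> {0..1}. \<bar>G z - g z\<bar> < e)"
  proof (rule Stone_Weierstrass_HOL[where P = ?P])
    show "compact ({0..1::real} \<times> {0..1::real})" by (intro compact_Times) auto
    show "?P (\<lambda>x. c)" for c by (auto intro: first_divisible_poly.scale)
    show "?P f \<Longrightarrow> continuous_on ({0..1} \<times> {0..1}) f" for f
      by (auto intro: continuous_on_subset)
    show "?P f \<and> ?P g \<Longrightarrow> ?P (\<lambda>x. f x + g x)" for f g
      by (auto intro!: continuous_intros simp: distrib_right first_divisible_poly.add)
    show "?P f \<and> ?P g \<Longrightarrow> ?P (\<lambda>x. f x * g x)" for f g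
      by (auto intro!: continuous_intros simp: mult.assoc)
    show "\<exists>f. ?P f \<and> f x \<noteq> f y"
      if "x \<in> {0..1} \<times> {0..1} \<and> y \<in> {0..1} \<times> {0..1} \<and> x \<noteq> y" for x y :: "real \<times> real"
      using that fst snd by (metis prod_eq_iff)
  qed (use assms in auto)
  then obtain g where g: "?P g" "\<And>z. z \<in> {0..1} \<times> {0..1} \<Longrightarrow> \<bar>G z - g z\<bar> < e" by blast
  have 1: "first_divisible_poly (\<lambda>z. g z * fst z)"
    using g(1) first_divisible_poly.monomial[of 0 0] by auto
  have "\<bar>fst z * G z - g z * fst z\<bar> < e" if z: "z \<in> {0..1} \<times> {0..1}" for z
  proof -
    have "\<bar>fst z * G z - g z * fst z\<bar> = fst z * \<bar>G z - g z\<bar>"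
      unfolding mult.commute[of "g z"] right_diff_distrib[symmetric] abs_mult using z by auto
    also have "\<dots> \<le> 1 * \<bar>G z - g z\<bar>" using z by (intro mult_right_mono) auto
    finally show ?thesis using g(2)[OF z] by simp
  qed
  with 1 show ?thesis by blast
qed

lemma first_divisible_poly_continuous: "first_divisible_poly h \<Longrightarrow> continuous_on UNIV h"
  by (induction rule: first_divisible_poly.induct) (auto intro!: continuous_intros)

lemma integral_abs_diff_le:
  fixes f g h :: "'a \<Rightarrow> real"
  assumes "integrable M f" "integrable M g" "integrable M h" "AE \<omega> in M. \<bar>f \<omega> - g \<omega>\<bar> \<le> h \<omega>"
  shows "\<bar>(\<integral>\<omega>. f \<omega> \<partial>M) - (\<integral>\<omega>. g \<omega> \<partial>M)\<bar> \<le> (\<integral>\<omega>. h \<omega> \<partial>M)"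
proof -
  have "\<bar>(\<integral>\<omega>. f \<omega> \<partial>M) - (\<integral>\<omega>. g \<omega> \<partial>M)\<bar> = \<bar>\<integral>\<omega>. f \<omega> - g \<omega> \<partial>M\<bar>"
    using assms by simp
  also have "\<dots> \<le> (\<integral>\<omega>. \<bar>f \<omega> - g \<omega>\<bar> \<partial>M)" by (rule integral_abs_bound)
  also have "\<dots> \<le> (\<integral>\<omega>. h \<omega> \<partial>M)"
    using assms by (intro integral_mono_AE integrable_abs Bochner_Integration.integrable_diff)
  finally show ?thesis .
qed

text \<open>This map turns the quadrant into the half-open unit square and Laplace transforms into moments.\<close>
definition exp_neg :: "real \<times> real \<Rightarrow> real \<times> real" where
  "exp_neg z = (exp (- fst z), exp (- snd z))"

text \<open>A continuous function that vanishes near the two sides of the square which correspond to infinity.\<close>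
definition cutoff :: "nat \<Rightarrow> real \<times> real \<Rightarrow> real" where
  "cutoff m z = max 0 (min 1 (real (Suc m) * min (fst z) (snd z) - 1))"

lemma cutoff: "0 \<le> cutoff m z" "cutoff m z \<le> 1" "continuous_on UNIV (cutoff m)"
  unfolding cutoff_def by (auto intro!: continuous_intros)

lemma cutoff_eventually_one:
  assumes "0 < fst z" "0 < snd z"
  shows "(\<lambda>m. cutoff m z) \<longlonglongrightarrow> 1"
proof -
  define a where "a = min (fst z) (snd z)"
  have a: "0 < a" using assms by (simp add: a_def)
  obtain k :: nat where k: "2 / a < k" using reals_Archimedean2 by blast
  have "cutoff m z = 1" if "m \<ge> k" for m
  proof -
    have "2 / a < real (Suc m)" using k that by linarith
    then have "2 < real (Suc m) * a" using a by (simp add: field_simps)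
    then show ?thesis by (simp add: cutoff_def a_def)
  qed
  then show ?thesis by (intro tendsto_eventually) (auto simp: eventually_sequentially)
qed

text \<open>On the support of the cutoff both coordinates are at least \<open>1 / Suc m\<close>. Replacing them by their
maximum with this number makes the logarithms and the division by the first coordinate continuous
everywhere without changing the product.\<close>
lemma cutoff_factorization:
  fixes f :: "real \<times> real \<Rightarrow> real"
  assumes f: "continuous_on UNIV f"
  obtains G where "continuous_on UNIV G" "\<And>z. f z * cutoff m (exp_neg z) = fst (exp_neg z) * G (exp_neg z)"
proof
  define G where "G z = f (- ln (max (fst z) (1 / Suc m)), - ln (max (snd z) (1 / Suc m))) * cutoff m z
      / max (fst z) (1 / Suc m)" for z
  have pos: "0 < max a (1 / real (Suc m))" for a by (simp add: less_max_iff_disj)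
  have ne: "max a (1 / real (Suc m)) \<noteq> 0" for a using pos[of a] by linarith
  show "continuous_on UNIV G"
    unfolding G_def by (intro continuous_intros continuous_on_compose2[OF f] cutoff ballI ne) auto
  show "f z * cutoff m (exp_neg z) = fst (exp_neg z) * G (exp_neg z)" for z
  proof (cases "min (fst (exp_neg z)) (snd (exp_neg z)) \<le> 1 / Suc m")
    case True
    then have "real (Suc m) * min (fst (exp_neg z)) (snd (exp_neg z)) \<le> 1"
      by (simp add: field_simps)
    then have "cutoff m (exp_neg z) = 0" by (simp add: cutoff_def)
    then show ?thesis by (simp add: G_def)
  next
    case False
    then have "max (fst (exp_neg z)) (1 / Suc m) = fst (exp_neg z)" "max (snd (exp_neg z)) (1 / Suc m) = snd (exp_neg z)"
      by auto
    then show ?thesis by (simp add: G_def exp_neg_def)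
  qed
qed

text \<open>The estimates below are used for the approximating variables and for their limit alike.\<close>
locale quadrant_variable = prob_space M for M :: "'a measure" +
  fixes V :: "'a \<Rightarrow> real \<times> real"
  assumes V_measurable [measurable]: "V \<in> borel_measurable M"
    and V_nonneg: "AE \<omega> in M. 0 \<le> fst (V \<omega>) \<and> 0 \<le> snd (V \<omega>)"
begin

lemma exp_neg_measurable [measurable]: "exp_neg \<in> borel_measurable borel"
  unfolding exp_neg_def[abs_def] by (intro borel_measurable_continuous_onI continuous_intros)

lemma exp_neg_square: "AE \<omega> in M. exp_neg (V \<omega>) \<in> {0..1} \<times> {0..1}"
  using V_nonneg by (auto simp: exp_neg_def elim: eventually_mono)

lemma integrable_exp_neg:
  fixes h :: "real \<times> real \<Rightarrow> real"
  assumes h: "continuous_on UNIV h"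
  shows "integrable M (\<lambda>\<omega>. h (exp_neg (V \<omega>)))"
proof -
  have "compact (h ` ({0..1} \<times> {0..1}))"
    by (intro compact_continuous_image compact_Times continuous_on_subset[OF h]) auto
  then have "bounded (h ` ({0..1} \<times> {0..1}))" by (rule compact_imp_bounded)
  then obtain C where "\<forall>z\<in>{0..1} \<times> {0..1}. \<bar>h z\<bar> \<le> C"
    unfolding bounded_iff by (metis imageI real_norm_def)
  moreover have [measurable]: "h \<in> borel_measurable borel"
    using h by (rule borel_measurable_continuous_onI)
  ultimately show ?thesis using exp_neg_square
    by (intro integrable_const_bound[of _ C]) (auto elim: eventually_mono)
qed

lemma expectation_close:
  fixes g h :: "real \<times> real \<Rightarrow> real"
  assumes gh: "continuous_on UNIV g" "continuous_on UNIV h"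
    and close: "\<And>z. z \<in> {0..1} \<times> {0..1} \<Longrightarrow> \<bar>g z - h z\<bar> < e"
  shows "\<bar>expectation (\<lambda>\<omega>. g (exp_neg (V \<omega>))) - expectation (\<lambda>\<omega>. h (exp_neg (V \<omega>)))\<bar> \<le> e"
proof -
  have "\<bar>expectation (\<lambda>\<omega>. g (exp_neg (V \<omega>))) - expectation (\<lambda>\<omega>. h (exp_neg (V \<omega>)))\<bar> \<le> expectation (\<lambda>\<omega>. e)"
    using exp_neg_square close
    by (intro integral_abs_diff_le integrable_exp_neg gh) (auto elim!: eventually_mono intro: less_imp_le)
  then show ?thesis by (simp add: prob_space)
qed

text \<open>The mass lost by the cutoff is controlled by an expectation that itself converges. Tightness of the
family thus comes for free from the limit being a genuine random variable.\<close>
lemma expectation_cutoff_defect: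
  fixes f :: "real \<times> real \<Rightarrow> real"
  assumes f: "continuous_on UNIV f" "\<And>z. \<bar>f z\<bar> \<le> C"
  shows "\<bar>expectation (\<lambda>\<omega>. f (V \<omega>)) - expectation (\<lambda>\<omega>. f (V \<omega>) * cutoff m (exp_neg (V \<omega>)))\<bar>
    \<le> C * (1 - expectation (\<lambda>\<omega>. cutoff m (exp_neg (V \<omega>))))"
proof -
  have [measurable]: "f \<in> borel_measurable borel" "cutoff m \<in> borel_measurable borel"
    using f(1) cutoff(3) by (auto intro!: borel_measurable_continuous_onI)
  have C: "0 \<le> C" using order_trans[OF abs_ge_zero f(2)] .
  have int: "integrable M (\<lambda>\<omega>. cutoff m (exp_neg (V \<omega>)))" by (rule integrable_exp_neg[OF cutoff(3)])
  have bound: "\<bar>f z * cutoff m y\<bar> \<le> C" for z y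
    using mult_mono[OF f(2)[of z] cutoff(2)[of m y]] C cutoff(1)[of m y] by (simp add: abs_mult)
  have int_f: "integrable M (\<lambda>\<omega>. f (V \<omega>))" "integrable M (\<lambda>\<omega>. f (V \<omega>) * cutoff m (exp_neg (V \<omega>)))"
    by (rule integrable_const_bound[of _ C]; simp add: f(2) bound)+
  have "\<bar>expectation (\<lambda>\<omega>. f (V \<omega>)) - expectation (\<lambda>\<omega>. f (V \<omega>) * cutoff m (exp_neg (V \<omega>)))\<bar>
      \<le> expectation (\<lambda>\<omega>. C * (1 - cutoff m (exp_neg (V \<omega>))))"
  proof (intro integral_abs_diff_le AE_I2)
    fix \<omega>
    let ?k = "cutoff m (exp_neg (V \<omega>))"
    have "\<bar>f (V \<omega>) - f (V \<omega>) * ?k\<bar> = \<bar>f (V \<omega>)\<bar> * \<bar>1 - ?k\<bar>"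
      by (simp add: abs_mult[symmetric] algebra_simps)
    also have "\<dots> \<le> C * (1 - ?k)"
      using cutoff(2)[of m "exp_neg (V \<omega>)"] f(2)[of "V \<omega>"] by (simp add: mult_right_mono)
    finally show "\<bar>f (V \<omega>) - f (V \<omega>) * ?k\<bar> \<le> C * (1 - ?k)" .
  qed (use int int_f in auto)
  then show ?thesis using int by (simp add: prob_space)
qed

end

text \<open>Transforms with \<open>a > 0\<close> suffice: the moments they provide belong to polynomials divisible by the
first coordinate, and the cutoff absorbs that factor.\<close>
lemma converges_in_distribution_laplace:
  fixes X :: "'i \<Rightarrow> 'a \<Rightarrow> real \<times> real" and Y :: "'b \<Rightarrow> real \<times> real"
  assumes M: "prob_space M" and N: "prob_space N"
    and X: "\<forall>\<^sub>F i in F. X i \<in> borel_measurable M"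
    and X0: "\<forall>\<^sub>F i in F. \<forall>\<omega>. 0 \<le> fst (X i \<omega>) \<and> 0 \<le> snd (X i \<omega>)"
    and Y: "Y \<in> borel_measurable N"
    and Y0: "AE \<omega> in N. 0 \<le> fst (Y \<omega>) \<and> 0 \<le> snd (Y \<omega>)"
    and laplace: "\<And>a b. 0 < a \<Longrightarrow> 0 \<le> b \<Longrightarrow>
      ((\<lambda>i. \<integral>\<omega>. exp (- (a * fst (X i \<omega>) + b * snd (X i \<omega>))) \<partial>M) \<longlongrightarrow>
       (\<integral>\<omega>. exp (- (a * fst (Y \<omega>) + b * snd (Y \<omega>))) \<partial>N)) F"
  shows "converges_in_distribution F M X N Y"
proof -
  interpret Y: quadrant_variable N Y
    using N Y Y0 by (intro quadrant_variable.intro quadrant_variable_axioms.intro)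
  let ?X = "\<lambda>h i. \<integral>\<omega>. h (exp_neg (X i \<omega>)) \<partial>M" and ?Y = "\<lambda>h. \<integral>\<omega>. h (exp_neg (Y \<omega>)) \<partial>N"
  have good: "\<forall>\<^sub>F i in F. quadrant_variable M (X i)"
    using X X0 by eventually_elim
      (use M in \<open>auto intro!: quadrant_variable.intro quadrant_variable_axioms.intro\<close>)
  have poly: "(?X h \<longlongrightarrow> ?Y h) F" if "first_divisible_poly h" for h
    using that
  proof induction
    case (monomial i j)
    have "exp (- (real (Suc i) * fst z + real j * snd z)) = fst (exp_neg z) ^ Suc i * snd (exp_neg z) ^ j" for z
      unfolding exp_neg_def fst_conv snd_conv exp_of_nat_mult[symmetric] exp_add[symmetric]
      by (simp add: algebra_simps)
    with laplace[of "real (Suc i)" "real j"] show ?case by simp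
  next
    case (add g h)
    note cont = add.hyps[THEN first_divisible_poly_continuous]
    have "\<forall>\<^sub>F i in F. ?X g i + ?X h i = ?X (\<lambda>z. g z + h z) i"
      using good by eventually_elim
        (intro Bochner_Integration.integral_add[symmetric] quadrant_variable.integrable_exp_neg cont)
    moreover have "?Y g + ?Y h = ?Y (\<lambda>z. g z + h z)"
      by (intro Bochner_Integration.integral_add[symmetric] Y.integrable_exp_neg cont)
    ultimately show ?case using tendsto_add[OF add.IH] by (auto intro: Lim_transform_eventually)
  next
    case (scale h c)
    then show ?case by (auto intro!: tendsto_intros)
  qed
  have divisible: "(?X (\<lambda>z. fst z * G z) \<longlongrightarrow> ?Y (\<lambda>z. fst z * G z)) F" if G: "continuous_on UNIV G" for G
  proof (rule tendstoI)
    fix e :: real assume e: "0 < e"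
    obtain h where h: "first_divisible_poly h"
        "\<And>z. z \<in> {0..1} \<times> {0..1} \<Longrightarrow> \<bar>fst z * G z - h z\<bar> < e / 3"
      using first_divisible_poly_approx[OF continuous_on_subset[OF G], of "e/3"] e by force
    have cont: "continuous_on UNIV (\<lambda>z. fst z * G z)" "continuous_on UNIV h"
      by (intro continuous_intros G) (rule first_divisible_poly_continuous[OF h(1)])
    have "\<forall>\<^sub>F i in F. dist (?X h i) (?Y h) < e / 3"
      using tendstoD[OF poly[OF h(1)], of "e / 3"] e by simp
    then show "\<forall>\<^sub>F i in F. dist (?X (\<lambda>z. fst z * G z) i) (?Y (\<lambda>z. fst z * G z)) < e"
      using good
    proof eventually_elim
      case (elim i)
      then show ?case
        using quadrant_variable.expectation_close[OF elim(2) cont h(2)] Y.expectation_close[OF cont h(2)]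
        unfolding dist_real_def by linarith
    qed
  qed
  have cut: "((\<lambda>i. \<integral>\<omega>. f (X i \<omega>) * cutoff m (exp_neg (X i \<omega>)) \<partial>M) \<longlongrightarrow>
        (\<integral>\<omega>. f (Y \<omega>) * cutoff m (exp_neg (Y \<omega>)) \<partial>N)) F"
    if f: "continuous_on UNIV f" for f m
  proof -
    obtain G where "continuous_on UNIV G" "\<And>z. f z * cutoff m (exp_neg z) = fst (exp_neg z) * G (exp_neg z)"
      using cutoff_factorization[OF f, of m] by blast
    then show ?thesis using divisible by simp
  qed
  have one: "(?X (cutoff m) \<longlongrightarrow> ?Y (cutoff m)) F" for m
    using cut[of "\<lambda>_. 1"] by simp
  have cutoff_lim: "(\<lambda>m. ?Y (cutoff m)) \<longlonglongrightarrow> (\<integral>\<omega>. 1 \<partial>N)"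
  proof (rule integral_dominated_convergence[where w = "\<lambda>_. 1"])
    show "(\<lambda>\<omega>. cutoff m (exp_neg (Y \<omega>))) \<in> borel_measurable N" for m
      using Y.integrable_exp_neg[OF cutoff(3)[of m]] by simp
    show "AE \<omega> in N. (\<lambda>m. cutoff m (exp_neg (Y \<omega>))) \<longlonglongrightarrow> 1"
      by (intro AE_I2 cutoff_eventually_one) (auto simp: exp_neg_def)
  qed (use cutoff in auto)
  show ?thesis
    unfolding converges_in_distribution_def
  proof (intro conjI allI impI X Y)
    fix f :: "real \<times> real \<Rightarrow> real"
    assume "continuous_on UNIV f \<and> bounded (range f)"
    then obtain C where f: "continuous_on UNIV f" and C: "0 < C" "\<And>z. \<bar>f z\<bar> \<le> C"
      unfolding bounded_pos by auto
    show "((\<lambda>i. \<integral>\<omega>. f (X i \<omega>) \<partial>M) \<longlongrightarrow> (\<integral>\<omega>. f (Y \<omega>) \<partial>N)) F"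
    proof (rule tendstoI)
      fix e :: real assume e: "0 < e"
      \<comment> \<open>The two cutoff defects cost \<open>e/4\<close> each, the cut expectations another \<open>e/4\<close>.\<close>
      define d where "d = e / (4 * C)"
      have d: "0 < d" "C * d = e / 4" using e C by (auto simp: d_def)
      obtain m where "\<bar>?Y (cutoff m) - (\<integral>\<omega>. 1 \<partial>N)\<bar> < d"
        using tendstoD[OF cutoff_lim d(1)] unfolding eventually_sequentially dist_real_def by blast
      then have m: "1 - ?Y (cutoff m) < d" by (simp add: Y.prob_space)
      have "\<forall>\<^sub>F i in F. dist (?X (cutoff m) i) (?Y (cutoff m)) < d - (1 - ?Y (cutoff m))"
        using m by (intro tendstoD[OF one]) auto
      moreover have "\<forall>\<^sub>F i in F. dist (\<integral>\<omega>. f (X i \<omega>) * cutoff m (exp_neg (X i \<omega>)) \<partial>M)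
          (\<integral>\<omega>. f (Y \<omega>) * cutoff m (exp_neg (Y \<omega>)) \<partial>N) < e / 4"
        using e f by (intro tendstoD[OF cut]) auto
      ultimately show "\<forall>\<^sub>F i in F. dist (\<integral>\<omega>. f (X i \<omega>) \<partial>M) (\<integral>\<omega>. f (Y \<omega>) \<partial>N) < e"
        using good
      proof eventually_elim
        case (elim i)
        have "1 - ?X (cutoff m) i < d" using elim(1) unfolding dist_real_def by linarith
        then have "C * (1 - ?X (cutoff m) i) < e / 4" "C * (1 - ?Y (cutoff m)) < e / 4"
          using C(1) d m by (metis mult_less_cancel_left_pos)+
        then show ?case
          using quadrant_variable.expectation_cutoff_defect[OF elim(3) f C(2), of m]
            Y.expectation_cutoff_defect[OF f C(2), of m] elim(2) unfolding dist_real_def by linarith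
      qed
    qed
  qed
qed

section \<open>Decaying solutions of the linear differential equation\<close>

text \<open>The recursion is read off from \<open>h'' = (p + q x) h\<close>; both initial coefficients are \<open>1\<close> so that \<open>h\<close> and
\<open>h'\<close> are at least \<open>1\<close> on the half line.\<close>
fun entire_coeff :: "real \<Rightarrow> real \<Rightarrow> nat \<Rightarrow> real" where
  "entire_coeff p q 0 = 1"
| "entire_coeff p q (Suc 0) = 1"
| "entire_coeff p q (Suc (Suc n)) =
     (p * entire_coeff p q n + q * (if n = 0 then 0 else entire_coeff p q (n - 1))) / ((n + 1) * (n + 2))"

lemma entire_coeff_nonneg: "0 \<le> p \<Longrightarrow> 0 \<le> q \<Longrightarrow> 0 \<le> entire_coeff p q n"
  by (induction p q n rule: entire_coeff.induct) auto

text \<open>For fixed \<open>r\<close> the recursion multiplies by at most \<open>(p r\<^sup>2 + q r\<^sup>3) / ((n+1) (n+2))\<close>, which is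
eventually below \<open>1\<close>. Hence the radius of convergence is infinite.\<close>
lemma entire_coeff_bounded:
  assumes p: "0 \<le> p" and q: "0 \<le> q" and r: "1 \<le> r"
  shows "\<exists>C. \<forall>n. entire_coeff p q n * r ^ n \<le> C"
proof -
  \<comment> \<open>Beyond index \<open>Q\<close> the denominators exceed \<open>Q\<close>, so \<open>C\<close> only has to bound the initial terms.\<close>
  define Q where "Q = p * r\<^sup>2 + q * r ^ 3"
  define b where "b n = entire_coeff p q n * r ^ n" for n
  have b0: "0 \<le> b n" for n unfolding b_def using entire_coeff_nonneg[OF p q] r by simp
  obtain m0 :: nat where m0: "Q < m0" using reals_Archimedean2 by blast
  define C where "C = (\<Sum>k\<le>Suc (Suc m0). b k)"
  have C0: "0 \<le> C" unfolding C_def by (intro sum_nonneg b0)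
  have "b n \<le> C" for n
  proof (induction n rule: less_induct)
    case (less n)
    show ?case
    proof (cases "n \<le> Suc (Suc m0)")
      case True
      then show ?thesis unfolding C_def by (intro member_le_sum) (auto simp: b0)
    next
      case False
      define m where "m = n - 2"
      with False have m: "n = Suc (Suc m)" "m \<ge> m0" "m > 0" by auto
      have "b n = (p * r\<^sup>2 * b m + q * r ^ 3 * b (m - 1)) / ((real m + 1) * (real m + 2))"
        using m(3) unfolding b_def m(1) by (cases m) (simp_all add: field_simps power2_eq_square power3_eq_cube)
      also have "\<dots> \<le> (p * r\<^sup>2 * C + q * r ^ 3 * C) / ((real m + 1) * (real m + 2))"
        using p q r less.IH[of m] less.IH[of "m - 1"] m(1)
        by (intro divide_right_mono add_mono mult_left_mono) auto
      also have "\<dots> = C * (Q / ((real m + 1) * (real m + 2)))" by (simp add: Q_def field_simps)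
      also have "\<dots> \<le> C * 1"
      proof (intro mult_left_mono C0)
        have "Q \<le> real m + 1" using m0 m(2) by linarith
        also have "\<dots> \<le> (real m + 1) * (real m + 2)" by (simp add: field_simps)
        finally show "Q / ((real m + 1) * (real m + 2)) \<le> 1" by (simp add: divide_le_eq)
      qed
      finally show ?thesis by simp
    qed
  qed
  then show ?thesis unfolding b_def by blast
qed

lemma entire_coeff_summable:
  assumes p: "0 \<le> p" and q: "0 \<le> q"
  shows "summable (\<lambda>n. entire_coeff p q n * x ^ n)"
proof -
  define r where "r = \<bar>x\<bar> + 1"
  have r: "1 \<le> r" "\<bar>x\<bar> < r" by (auto simp: r_def)
  obtain C where C: "\<And>n. entire_coeff p q n * r ^ n \<le> C"
    using entire_coeff_bounded[OF p q r(1)] by blast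
  show ?thesis
  proof (rule summable_comparison_test'[where N = 0])
    show "summable (\<lambda>n. C * (\<bar>x\<bar> / r) ^ n)"
      using r by (intro summable_mult summable_geometric) auto
    fix n :: nat
    have "norm (entire_coeff p q n * x ^ n) = (entire_coeff p q n * r ^ n) * (\<bar>x\<bar> / r) ^ n"
      using entire_coeff_nonneg[OF p q, of n] r by (simp add: abs_mult power_abs power_divide)
    also have "\<dots> \<le> C * (\<bar>x\<bar> / r) ^ n" using C[of n] r by (intro mult_right_mono) auto
    finally show "norm (entire_coeff p q n * x ^ n) \<le> C * (\<bar>x\<bar> / r) ^ n" .
  qed
qed

lemma growing_solution:
  fixes p q :: real
  assumes p: "0 \<le> p" and q: "0 \<le> q"
  obtains h h1 where
    "\<And>x. (h has_real_derivative h1 x) (at x)"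
    "\<And>x. (h1 has_real_derivative (p + q * x) * h x) (at x)"
    "\<And>x. 0 \<le> x \<Longrightarrow> 1 \<le> h x" "\<And>x. 0 \<le> x \<Longrightarrow> 1 \<le> h1 x"
    "h 0 = 1" "h1 0 = 1"
proof -
  let ?a = "entire_coeff p q"
  note s = entire_coeff_summable[OF p q]
  define h h1 where "h x = (\<Sum>n. ?a n * x ^ n)" and "h1 x = (\<Sum>n. diffs ?a n * x ^ n)" for x
  have s1: "summable (\<lambda>n. diffs ?a n * x ^ n)" for x by (rule termdiff_converges_all[OF s])
  have d: "(h has_real_derivative h1 x) (at x)" for x
    unfolding h_def h1_def by (rule termdiffs_strong_converges_everywhere[OF s])
  have d1: "(h1 has_real_derivative (\<Sum>n. diffs (diffs ?a) n * x ^ n)) (at x)" for x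
    unfolding h1_def by (rule termdiffs_strong_converges_everywhere[OF s1])
  have "(\<Sum>n. diffs (diffs ?a) n * x ^ n) = (p + q * x) * h x" for x
  proof -
    define e where "e n = (if n = 0 then 0 else ?a (n - 1)) * x ^ n" for n
    have "(\<lambda>n. ?a n * x ^ n) sums h x" unfolding h_def by (rule summable_sums[OF s])
    then have 1: "(\<lambda>n. p * (?a n * x ^ n)) sums (p * h x)" and "(\<lambda>n. x * (?a n * x ^ n)) sums (x * h x)"
      by (intro sums_mult; assumption)+
    then have "(\<lambda>n. e (Suc n)) sums (x * h x)" by (simp add: e_def mult_ac)
    then have "e sums (x * h x)" using sums_Suc_iff[of e "x * h x"] by (simp add: e_def)
    then have "(\<lambda>n. p * (?a n * x ^ n) + q * e n) sums (p * h x + q * (x * h x))"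
      by (intro sums_add 1 sums_mult)
    moreover have "diffs (diffs ?a) n * x ^ n = p * (?a n * x ^ n) + q * e n" for n
    proof -
      define A where "A = p * ?a n + q * (if n = 0 then 0 else ?a (n - 1))"
      have "?a (Suc (Suc n)) = A / (real (Suc n) * real (Suc (Suc n)))" by (simp add: A_def algebra_simps)
      then have "diffs (diffs ?a) n = real (Suc n) * (real (Suc (Suc n)) * (A / (real (Suc n) * real (Suc (Suc n)))))"
        unfolding diffs_def by (simp only:)
      also have "\<dots> = A" by (simp del: of_nat_Suc)
      finally show ?thesis unfolding A_def e_def by (simp add: algebra_simps)
    qed
    ultimately have "(\<lambda>n. diffs (diffs ?a) n * x ^ n) sums (p * h x + q * (x * h x))" by simp
    then show ?thesis by (simp add: sums_unique[symmetric] algebra_simps)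
  qed
  with d1 have d2: "(h1 has_real_derivative (p + q * x) * h x) (at x)" for x by simp
  have a0: "0 \<le> ?a n" for n by (rule entire_coeff_nonneg[OF p q])
  have h: "1 \<le> h x" if "0 \<le> x" for x
  proof -
    have "(\<Sum>n<1. ?a n * x ^ n) \<le> h x"
      unfolding h_def using a0 that by (intro sum_le_suminf s) auto
    then show ?thesis by simp
  qed
  have h1: "1 \<le> h1 x" if "0 \<le> x" for x
  proof -
    have "(\<Sum>n<1. diffs ?a n * x ^ n) \<le> h1 x"
      unfolding h1_def using a0 that by (intro sum_le_suminf s1) (auto simp: diffs_def)
    then show ?thesis by (simp add: diffs_def)
  qed
  have "h 0 = 1" unfolding h_def by (simp add: powser_zero)
  moreover have "h1 0 = 1" unfolding h1_def by (simp add: powser_zero diffs_def)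
  ultimately show thesis using that[OF d d2 h h1] by blast
qed

text \<open>For \<open>p > 0\<close> this is an exponential (\<open>q = 0\<close>) or, after an affine change of variable and up to a constant
factor, the Airy function (\<open>q > 0\<close>).\<close>
definition decaying_solution :: "real \<Rightarrow> real \<Rightarrow> (real \<Rightarrow> real) \<Rightarrow> (real \<Rightarrow> real) \<Rightarrow> bool" where
  "decaying_solution p q u u1 \<longleftrightarrow> u 0 = 1 \<and>
     (\<forall>x\<ge>0. (u has_real_derivative u1 x) (at x within {0..}) \<and>
        (u1 has_real_derivative (p + q * x) * u x) (at x within {0..}) \<and> 0 \<le> u x \<and> u1 x \<le> 0)"

lemma decaying_solution_exp:
  assumes p: "0 \<le> p"
  shows "decaying_solution p 0 (\<lambda>x. exp (- sqrt p * x)) (\<lambda>x. - sqrt p * exp (- sqrt p * x))"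
proof -
  have "((\<lambda>x. exp (- sqrt p * x)) has_real_derivative exp (- sqrt p * x) * (- sqrt p * 1)) (at x within A)" for x A
    by (auto intro!: derivative_eq_intros)
  then have "((\<lambda>x. exp (- sqrt p * x)) has_real_derivative - sqrt p * exp (- sqrt p * x)) (at x within A)" for x A
    by (simp add: mult.commute)
  moreover from this have "((\<lambda>x. - sqrt p * exp (- sqrt p * x)) has_real_derivative
      - sqrt p * (- sqrt p * exp (- sqrt p * x))) (at x within A)" for x A
    by (rule DERIV_cmult)
  ultimately show ?thesis
    unfolding decaying_solution_def using p by (auto simp flip: mult.assoc)
qed

text \<open>Reduction of order. If \<open>h\<close> is the growing solution and \<open>J\<close> a primitive of \<open>1 / h\<^sup>2\<close>, then
\<open>h (J \<infinity> - J)\<close> is a second solution. It is nonincreasing because \<open>h'\<close> increases, which gives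
\<open>J \<infinity> - J x \<le> 1 / (h' x h x)\<close>.\<close>
lemma decaying_solution_exists:
  assumes p: "0 \<le> p" and q: "0 \<le> q"
  shows "\<exists>u u1. decaying_solution p q u u1"
proof -
  obtain h h1 where h: "\<And>x. (h has_real_derivative h1 x) (at x)"
    and h1: "\<And>x. (h1 has_real_derivative (p + q * x) * h x) (at x)"
    and h_ge: "\<And>x. 0 \<le> x \<Longrightarrow> 1 \<le> h x" and h1_ge: "\<And>x. 0 \<le> x \<Longrightarrow> 1 \<le> h1 x"
    and h0: "h 0 = 1" "h1 0 = 1"
    using growing_solution[OF p q] by blast
  have hpos: "0 < h x" "0 < h1 x" if "0 \<le> x" for x using h_ge[OF that] h1_ge[OF that] by auto
  have h1_mono: "h1 x \<le> h1 y" if "0 \<le> x" "x \<le> y" for x y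
    using that(2)
  proof (rule DERIV_nonneg_imp_nondecreasing)
    fix z assume "x \<le> z" "z \<le> y"
    then have "0 \<le> (p + q * z) * h z" using that p q hpos(1)[of z] by auto
    then show "\<exists>y. (h1 has_real_derivative y) (at z) \<and> 0 \<le> y" using h1 by blast
  qed
  \<comment> \<open>Constant to the left of \<open>0\<close>, so that the primitive has two-sided derivatives on the closed half line.\<close>
  define g where "g t = 1 / (h (max 0 t))\<^sup>2" for t
  have "continuous_on UNIV h" using h by (intro DERIV_continuous_on) (auto intro: has_field_derivative_at_within)
  then have "continuous_on UNIV (\<lambda>t. h (max 0 t))"
    by (rule continuous_on_compose2) (auto intro!: continuous_intros)
  moreover have "h (max 0 t) \<noteq> 0" for t using hpos(1)[of "max 0 t"] by simp
  ultimately have g_cont: "continuous_on UNIV g"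
    unfolding g_def by (intro continuous_intros) auto
  define J where "J x = integral {-1..x} g" for x
  have J: "(J has_real_derivative g x) (at x)" if "0 \<le> x" for x
  proof -
    have "(J has_real_derivative g x) (at x within {-1..x+1})"
      unfolding J_def using that by (intro integral_has_real_derivative continuous_on_subset[OF g_cont]) auto
    moreover have "at x within {-1..x+1} = at x" using that by (intro at_within_interior) auto
    ultimately show ?thesis by simp
  qed
  have J_le: "J y - J x \<le> 1 / (h1 x * h x)" if xy: "0 \<le> x" "x \<le> y" for x y
  proof -
    \<comment> \<open>The derivative of this function is \<open>(1 - h1 z / h1 x) / (h z)\<^sup>2 \<le> 0\<close>.\<close>
    let ?\<phi> = "\<lambda>z. J z + 1 / (h1 x * h z)"
    have "?\<phi> y \<le> ?\<phi> x"
    proof (rule DERIV_nonpos_imp_nonincreasing[OF xy(2)])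
      fix z assume z: "x \<le> z" "z \<le> y"
      with xy have z0: "0 \<le> z" by simp
      have "((\<lambda>z. J z + inverse (h z) / h1 x) has_real_derivative
          g z + (- (inverse (h z) * h1 z * inverse (h z))) / h1 x) (at z)"
        using hpos(1)[OF z0]
        by (intro DERIV_add J[OF z0] DERIV_cdivide DERIV_inverse' h) auto
      then have "(?\<phi> has_real_derivative g z - h1 z / (h1 x * (h z)\<^sup>2)) (at z)"
        by (simp add: divide_inverse power2_eq_square mult_ac)
      moreover have "g z - h1 z / (h1 x * (h z)\<^sup>2) \<le> 0"
      proof -
        have "1 \<le> h1 z / h1 x" using hpos(2)[OF xy(1)] h1_mono[OF xy(1) z(1)] by simp
        then have "1 / (h z)\<^sup>2 \<le> h1 z / h1 x / (h z)\<^sup>2" by (rule divide_right_mono) simp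
        then show ?thesis using z0 by (simp add: g_def)
      qed
      ultimately show "\<exists>y. (?\<phi> has_real_derivative y) (at z) \<and> y \<le> 0" by blast
    qed
    moreover have "0 \<le> 1 / (h1 x * h y)" using hpos[of x] hpos[of y] xy by simp
    ultimately show ?thesis by linarith
  qed
  define Jinf where "Jinf = (SUP x\<in>{0..}. J x)"
  have bdd: "bdd_above (J ` {0..})"
    using J_le[of 0] h0 by (intro bdd_aboveI2[of _ _ "J 0 + 1"]) force
  have Jinf_ge: "J x \<le> Jinf" if "0 \<le> x" for x
    unfolding Jinf_def using that by (intro cSUP_upper bdd) auto
  have J_mono: "J x \<le> J y" if "0 \<le> x" "x \<le> y" for x y
    using that(2)
  proof (rule DERIV_nonneg_imp_nondecreasing)
    fix z assume "x \<le> z" "z \<le> y"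
    then have "0 \<le> z" "0 \<le> g z" using that by (auto simp: g_def)
    then show "\<exists>y. (J has_real_derivative y) (at z) \<and> 0 \<le> y" using J by blast
  qed
  have Jinf_le: "Jinf - J x \<le> 1 / (h1 x * h x)" if x: "0 \<le> x" for x
  proof -
    have "J y \<le> J x + 1 / (h1 x * h x)" if "0 \<le> y" for y
    proof (cases "x \<le> y")
      case True then show ?thesis using J_le[OF x True] by simp
    next
      case False
      then show ?thesis using J_mono[of y x] that hpos[OF x] by (simp add: add_increasing2)
    qed
    then have "Jinf \<le> J x + 1 / (h1 x * h x)" unfolding Jinf_def by (intro cSUP_least) auto
    then show ?thesis by simp
  qed
  \<comment> \<open>The value at \<open>0\<close> of the unnormalised solution.\<close>
  define c where "c = Jinf - J 0"
  have c: "0 < c"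
  proof -
    have "\<exists>z>0. z < 1 \<and> J 1 - J 0 = (1 - 0) * g z" using J by (intro MVT2) auto
    then obtain z where z: "0 < z" "J 1 - J 0 = g z" by auto
    have "0 < g z" using hpos(1)[of z] z by (simp add: g_def)
    then show ?thesis using z Jinf_ge[of 1] by (simp add: c_def)
  qed
  define u u1 where "u x = h x * (Jinf - J x) / c" and "u1 x = (h1 x * (Jinf - J x) - 1 / h x) / c" for x
  have "decaying_solution p q u u1"
    unfolding decaying_solution_def
  proof (intro conjI allI impI)
    show "u 0 = 1" using c h0 by (simp add: u_def c_def)
    fix x :: real assume x: "0 \<le> x"
    have gx: "g x = 1 / (h x)\<^sup>2" using x by (simp add: g_def)
    have "(u has_real_derivative (h1 x * (Jinf - J x) + (0 - g x) * h x) / c) (at x)"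
      unfolding u_def by (intro DERIV_cdivide DERIV_mult DERIV_diff DERIV_const J[OF x] h)
    also have "(h1 x * (Jinf - J x) + (0 - g x) * h x) / c = u1 x"
      unfolding u1_def gx using hpos[OF x] by (simp add: power2_eq_square)
    finally have "(u has_real_derivative u1 x) (at x)" .
    then show "(u has_real_derivative u1 x) (at x within {0..})" by (rule has_field_derivative_at_within)
    have "((\<lambda>x. (h1 x * (Jinf - J x) - inverse (h x)) / c) has_real_derivative
        ((p + q * x) * h x * (Jinf - J x) + (0 - g x) * h1 x - - (inverse (h x) * h1 x * inverse (h x))) / c) (at x)"
      using hpos[OF x] by (intro DERIV_cdivide DERIV_mult DERIV_diff DERIV_const J[OF x] h h1 DERIV_inverse') auto
    also have "((p + q * x) * h x * (Jinf - J x) + (0 - g x) * h1 x - - (inverse (h x) * h1 x * inverse (h x))) / c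
        = (p + q * x) * u x"
      unfolding u_def gx by (simp add: power2_eq_square divide_inverse)
    also have "(\<lambda>x. (h1 x * (Jinf - J x) - inverse (h x)) / c) = u1"
      by (simp add: u1_def fun_eq_iff divide_inverse)
    finally have "(u1 has_real_derivative (p + q * x) * u x) (at x)" .
    then show "(u1 has_real_derivative (p + q * x) * u x) (at x within {0..})" by (rule has_field_derivative_at_within)
    show "0 \<le> u x" unfolding u_def using hpos[OF x] c Jinf_ge[OF x] by simp
    have "h1 x * (Jinf - J x) \<le> h1 x * (1 / (h1 x * h x))"
      using hpos[OF x] Jinf_le[OF x] by (intro mult_left_mono) auto
    also have "\<dots> = 1 / h x" using hpos[OF x] by simp
    finally show "u1 x \<le> 0" unfolding u1_def using c by (simp add: divide_le_0_iff)
  qed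
  then show ?thesis by blast
qed

text \<open>A nonnegative solution is convex, so the two mean value theorems for \<open>u\<close> and \<open>u'\<close> become one-sided
estimates at the endpoints.\<close>
lemma decaying_solution_mono:
  assumes "decaying_solution p q u u1" and p: "0 \<le> p" and q: "0 \<le> q" and xy: "0 \<le> x" "x \<le> y"
  shows "u y \<le> u x" "u1 x \<le> u1 y"
    and "(y - x) * (- u1 y) \<le> u x - u y" "(y - x) * ((p + q * x) * u y) \<le> u1 y - u1 x"
proof -
  have u: "(u has_real_derivative u1 x) (at x within {0..})"
    "(u1 has_real_derivative (p + q * x) * u x) (at x within {0..})" "0 \<le> u x" "u1 x \<le> 0" if "0 \<le> x" for x
    using assms(1) that unfolding decaying_solution_def by auto
  have mvt: "\<exists>z\<in>{a<..<b}. f b - f a = f' z * (b - a)"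
    if "0 \<le> a" "a < b" "\<And>x. 0 \<le> x \<Longrightarrow> (f has_real_derivative f' x) (at x within {0..})" for f f' :: "real \<Rightarrow> real" and a b
    using that(1,2) by (intro mvt_simple[where f' = "\<lambda>x. (*) (f' x)"])
      (auto intro!: has_derivative_subset[OF that(3)[unfolded has_field_derivative_def]])
  have m1: "u b \<le> u a" if ab: "0 \<le> a" "a \<le> b" for a b
  proof (cases "a < b")
    case True
    then obtain z where "z\<in>{a<..<b}" "u b - u a = u1 z * (b - a)" using mvt[OF ab(1) True, of u u1] u(1) by blast
    then show ?thesis using u(4)[of z] ab mult_nonpos_nonneg[of "u1 z" "b - a"] by auto
  qed (use ab in auto)
  have m2: "u1 a \<le> u1 b" if ab: "0 \<le> a" "a \<le> b" for a b
  proof (cases "a < b")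
    case True
    then obtain z where "z\<in>{a<..<b}" "u1 b - u1 a = (p + q * z) * u z * (b - a)"
      using mvt[OF ab(1) True, of u1 "\<lambda>z. (p + q * z) * u z"] u(2) by blast
    moreover have "0 \<le> (p + q * z) * u z * (b - a)" using calculation(1) p q u(3)[of z] ab by auto
    ultimately show ?thesis by linarith
  qed (use ab in auto)
  show "u y \<le> u x" "u1 x \<le> u1 y" using m1 m2 xy by auto
  show "(y - x) * (- u1 y) \<le> u x - u y"
  proof (cases "x < y")
    case True
    then obtain z where z: "z\<in>{x<..<y}" "u y - u x = u1 z * (y - x)" using mvt[OF xy(1) True, of u u1] u(1) by blast
    have "(y - x) * (- u1 y) \<le> (y - x) * (- u1 z)" using z xy by (intro mult_left_mono le_imp_neg_le m2) auto
    with z show ?thesis by (simp add: algebra_simps)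
  qed (use xy in auto)
  show "(y - x) * ((p + q * x) * u y) \<le> u1 y - u1 x"
  proof (cases "x < y")
    case True
    then obtain z where z: "z\<in>{x<..<y}" "u1 y - u1 x = (p + q * z) * u z * (y - x)"
      using mvt[OF xy(1) True, of u1 "\<lambda>z. (p + q * z) * u z"] u(2) by blast
    have "(p + q * x) * u y \<le> (p + q * z) * u z"
      using z xy p q by (intro mult_mono add_left_mono mult_left_mono m1 u) auto
    then have "(y - x) * ((p + q * x) * u y) \<le> (y - x) * ((p + q * z) * u z)" using xy by (intro mult_left_mono) auto
    with z show ?thesis by (simp add: algebra_simps)
  qed (use xy in auto)
qed

text \<open>Decay from convexity alone: \<open>x \<bar>u' x\<bar>\<close> is bounded because \<open>u\<close> is, then \<open>x u'' x\<close> is bounded because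
\<open>u'\<close> is, and both bounds together control \<open>(p + q x)\<^sup>2 u\<close> and the third derivative.\<close>
lemma decaying_solution_bounds:
  assumes sol: "decaying_solution p q u u1" and p: "0 < p" and q: "0 \<le> q"
  obtains L where "\<And>x. 0 \<le> x \<Longrightarrow> (p + q * x)\<^sup>2 * u x \<le> L" "\<And>x. 0 \<le> x \<Longrightarrow> (p + q * x) * - u1 x \<le> L"
proof -
  have u: "u 0 = 1" "\<And>x. 0 \<le> x \<Longrightarrow> 0 \<le> u x" "\<And>x. 0 \<le> x \<Longrightarrow> u1 x \<le> 0"
    using sol unfolding decaying_solution_def by auto
  note mono = decaying_solution_mono[OF sol less_imp_le[OF p] q]
  define D where "D = - u1 0"
  have D: "0 \<le> D" "- u1 x \<le> D" if "0 \<le> x" for x using mono(2)[of 0 x] u(3)[of 0] that by (auto simp: D_def)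
  \<comment> \<open>Both estimates compare \<open>x / 2\<close> with \<open>x\<close>.\<close>
  have 1: "x * - u1 x \<le> 2" if "0 \<le> x" for x
    using mono(3)[of "x/2" x] mono(1)[of 0 "x/2"] u(2)[of x] that u(1) by auto
  have 2: "x * ((p + q * x) * u x) \<le> 4 * D" if x: "0 \<le> x" for x
  proof -
    have "x / 2 * ((p + q * (x / 2)) * u x) \<le> - u1 (x / 2)"
      using mono(4)[of "x/2" x] u(3)[of x] x by auto
    also have "\<dots> \<le> D" using D(2)[of "x/2"] x by simp
    finally have "x * ((2 * p + q * x) * u x) \<le> 4 * D" by (simp add: field_simps)
    moreover have "x * ((p + q * x) * u x) \<le> x * ((2 * p + q * x) * u x)"
      using x u(2)[OF x] p by (intro mult_left_mono mult_right_mono) auto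
    ultimately show ?thesis by simp
  qed
  have 3: "u x \<le> 1" if "0 \<le> x" for x using mono(1)[of 0 x] u(1) that by simp
  have 4: "p * (x * u x) \<le> 4 * D" if x: "0 \<le> x" for x
  proof -
    have "p * (x * u x) = x * (p * u x)" by simp
    also have "\<dots> \<le> x * ((p + q * x) * u x)" using x q u(2)[OF x] by (intro mult_left_mono mult_right_mono) auto
    finally show ?thesis using 2[OF x] by simp
  qed
  have A: "(p + q * x)\<^sup>2 * u x \<le> p\<^sup>2 + 8 * q * D" if x: "0 \<le> x" for x
  proof -
    have "(p + q * x)\<^sup>2 * u x = p\<^sup>2 * u x + q * (p * (x * u x)) + q * (x * ((p + q * x) * u x))"
      by (simp add: power2_eq_square algebra_simps)
    also have "\<dots> \<le> p\<^sup>2 * 1 + q * (4 * D) + q * (4 * D)"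
      using 2[OF x] 3[OF x] 4[OF x] q by (intro add_mono mult_left_mono) auto
    finally show ?thesis by (simp add: algebra_simps)
  qed
  have B: "(p + q * x) * - u1 x \<le> p * D + 2 * q" if x: "0 \<le> x" for x
  proof -
    have "(p + q * x) * - u1 x = p * - u1 x + q * (x * - u1 x)" by (simp add: algebra_simps)
    also have "\<dots> \<le> p * D + q * 2" using 1[OF x] D(2)[OF x] p q by (intro add_mono mult_left_mono) auto
    finally show ?thesis by simp
  qed
  show thesis
    by (rule that[of "max (p\<^sup>2 + 8 * q * D) (p * D + 2 * q)"]) (use A B in \<open>auto intro: max.coboundedI1 max.coboundedI2\<close>)
qed

lemma has_real_derivative_glue:
  fixes f g :: "real \<Rightarrow> real"
  assumes f: "\<And>x. 0 \<le> x \<Longrightarrow> (f has_real_derivative f' x) (at x within {0..})"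
    and g: "\<And>x. (g has_real_derivative g' x) (at x)"
    and "f 0 = g 0" "f' 0 = g' 0"
  shows "((\<lambda>x. if 0 \<le> x then f x else g x) has_real_derivative (if 0 \<le> x then f' x else g' x)) (at x)"
proof -
  let ?h = "\<lambda>x. if 0 \<le> x then f x else g x"
  let ?D = "if 0 \<le> x then f' x else g' x"
  have pos: "(?h has_real_derivative ?D) (at x within {0..})" if "0 \<le> x"
    using f[OF that] that by (rule_tac has_field_derivative_transform_within[of f _ _ _ 1]) auto
  have neg: "(?h has_real_derivative ?D) (at x within {..0})" if "x \<le> 0"
  proof (rule has_field_derivative_transform_within[of g _ _ _ 1])
    show "(g has_real_derivative ?D) (at x within {..0})"
      using g[of x] that assms(4) by (cases "x = 0") (auto intro: has_field_derivative_at_within)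
  qed (use assms(3) that in \<open>auto simp: not_le[symmetric] dest: antisym\<close>)
  consider "x < 0" | "x = 0" | "0 < x" by linarith
  then show ?thesis
  proof cases
    case 1 then show ?thesis using neg at_within_interior[of x "{..0}"] by auto
  next
    case 3 then show ?thesis using pos at_within_interior[of x "{0..}"] by auto
  next
    case 2
    have "(?h has_real_derivative ?D) (at x within {0..} \<union> {..0})"
      using pos neg 2 unfolding has_field_derivative_iff by (intro Lim_Un) auto
    moreover have "{0..} \<union> {..0} = (UNIV :: real set)" by auto
    ultimately show ?thesis by simp
  qed
qed

text \<open>A Lipschitz bound on the second derivative survives gluing two pieces, where a third derivative would
not exist at the junction.\<close>
lemma second_order_taylor:
  fixes f :: "real \<Rightarrow> real"
  assumes f: "\<And>x. (f has_real_derivative f1 x) (at x)" and f1: "\<And>x. (f1 has_real_derivative f2 x) (at x)"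
    and L: "\<And>x y. \<bar>f2 x - f2 y\<bar> \<le> L * \<bar>x - y\<bar>"
  shows "\<bar>f (x + s) - f x - f1 x * s - f2 x * s\<^sup>2 / 2\<bar> \<le> L * \<bar>s\<bar> ^ 3"
proof (cases "s = 0")
  case False
  define diff where "diff m = (if m = 0 then f else if m = Suc 0 then f1 else f2)" for m :: nat
  have "\<exists>t. (if x + s < x then x + s < t \<and> t < x else x < t \<and> t < x + s) \<and>
    f (x + s) = (\<Sum>m<2. (diff m x / fact m) * ((x + s) - x)^m) + (diff 2 t / fact 2) * ((x + s) - x)^2"
    by (rule Taylor[where a = "min x (x + s)" and b = "max x (x + s)"])
      (use False f f1 in \<open>auto simp: diff_def less_2_cases_iff\<close>)
  then obtain t where "if x + s < x then x + s < t \<and> t < x else x < t \<and> t < x + s"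
    "f (x + s) = f x + f1 x * s + f2 t * s\<^sup>2 / 2"
    by (auto simp: diff_def eval_nat_numeral)
  then have t: "\<bar>t - x\<bar> \<le> \<bar>s\<bar>" "f (x + s) = f x + f1 x * s + f2 t * s\<^sup>2 / 2"
    by (auto split: if_splits)
  have L0: "0 \<le> L" using L[of 1 0] by simp
  have "\<bar>f (x + s) - f x - f1 x * s - f2 x * s\<^sup>2 / 2\<bar> = \<bar>f2 t - f2 x\<bar> * s\<^sup>2 / 2"
    unfolding t(2) by (simp add: abs_mult flip: diff_divide_distrib left_diff_distrib)
  also have "\<dots> \<le> (L * \<bar>s\<bar>) * s\<^sup>2 / 2"
    using order_trans[OF L[of t x] mult_left_mono[OF t(1) L0]] by (intro divide_right_mono mult_right_mono) auto
  also have "\<dots> \<le> L * \<bar>s\<bar> ^ 3"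
    using L0 by (simp add: power3_eq_cube power2_eq_square mult.assoc flip: abs_mult)
      (simp add: power2_eq_square[symmetric] mult.assoc[symmetric])
  finally show ?thesis .
qed simp

text \<open>The Taylor bound has to hold for steps of any size, and a step may lead below \<open>0\<close>. The solution is
therefore continued to a bounded function on the line, whose values below \<open>0\<close> enter only
through that bound.\<close>
definition smooth_extension :: "real \<Rightarrow> real \<Rightarrow> (real \<Rightarrow> real) \<Rightarrow> real \<Rightarrow> bool" where
  "smooth_extension p q u L \<longleftrightarrow> continuous_on UNIV u \<and> u 0 = 1 \<and> (\<forall>x. \<bar>u x\<bar> \<le> L) \<and>
     (\<forall>x>0. 0 \<le> u x \<and> (p + q * x)\<^sup>2 * u x \<le> L) \<and>
     (\<forall>x>0. \<exists>D. \<forall>s. \<bar>u (x + s) - u x - D * s - (p + q * x) * u x * s\<^sup>2 / 2\<bar> \<le> L * \<bar>s\<bar> ^ 3)"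

text \<open>On the negative half line the function \<open>1 + p + Q sin x - p cos x\<close> with \<open>Q = u' 0\<close> has the same value,
the same first and the same second derivative at \<open>0\<close>, and all its derivatives are bounded.\<close>
lemma smooth_extension_exists:
  assumes sol: "decaying_solution p q u u1" and p: "0 < p" and q: "0 \<le> q"
  shows "\<exists>v L. smooth_extension p q v L \<and> (\<forall>x\<ge>0. v x = u x)"
proof -
  have u: "(u has_real_derivative u1 x) (at x within {0..})"
    "(u1 has_real_derivative (p + q * x) * u x) (at x within {0..})" "0 \<le> u x" "u1 x \<le> 0" if "0 \<le> x" for x
    using sol that unfolding decaying_solution_def by auto
  have u0: "u 0 = 1" using sol unfolding decaying_solution_def by auto
  define Q where "Q = u1 0"
  define v v1 v2 where
    "v x = (if 0 \<le> x then u x else 1 + p + Q * sin x - p * cos x)"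
    and "v1 x = (if 0 \<le> x then u1 x else Q * cos x + p * sin x)"
    and "v2 x = (if 0 \<le> x then (p + q * x) * u x else - Q * sin x + p * cos x)" for x
  have v: "(v has_real_derivative v1 x) (at x)" for x
    unfolding v_def v1_def
    by (rule has_real_derivative_glue) (auto intro!: u derivative_eq_intros simp: u0 Q_def)
  have v1: "(v1 has_real_derivative v2 x) (at x)" for x
    unfolding v2_def v1_def
    by (rule has_real_derivative_glue) (auto intro!: u derivative_eq_intros simp: u0 Q_def)
  obtain L where L: "\<And>x. 0 \<le> x \<Longrightarrow> (p + q * x)\<^sup>2 * u x \<le> L" "\<And>x. 0 \<le> x \<Longrightarrow> (p + q * x) * - u1 x \<le> L"
    using decaying_solution_bounds[OF sol p q] by blast
  have u_le: "u x \<le> 1" if "0 \<le> x" for x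
    using decaying_solution_mono(1)[OF sol less_imp_le[OF p] q, of 0 x] that u0 by simp
  \<comment> \<open>Dominates the values of \<open>v\<close> and the Lipschitz constants of \<open>v2\<close> on both half lines.\<close>
  define K where "K = 1 + 2 * p + 2 * \<bar>Q\<bar> + q + \<bar>L\<bar>"
  have K0: "0 \<le> K" using p q by (simp add: K_def)
  have LipR: "\<bar>v2 x - v2 y\<bar> \<le> K * \<bar>x - y\<bar>" if "0 \<le> x" "0 \<le> y" for x y
  proof -
    have "norm ((p + q * x) * u x - (p + q * y) * u y) \<le> K * norm (x - y)"
    proof (rule field_differentiable_bound[of "{0..}" _ "\<lambda>x. q * u x + (p + q * x) * u1 x"])
      fix z :: real assume z: "z \<in> {0..}"
      show "((\<lambda>x. (p + q * x) * u x) has_real_derivative q * u z + (p + q * z) * u1 z) (at z within {0..})"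
        using z by (auto intro!: derivative_eq_intros u simp: algebra_simps)
      have "\<bar>q * u z + (p + q * z) * u1 z\<bar> \<le> \<bar>q * u z\<bar> + \<bar>(p + q * z) * u1 z\<bar>" by linarith
      also have "\<dots> = q * u z + (p + q * z) * - u1 z"
        using z q p u(3,4)[of z] by (auto simp: abs_mult)
      also have "\<dots> \<le> q * 1 + L" using z q u_le[of z] L(2)[of z] by (intro add_mono mult_left_mono) auto
      finally show "norm (q * u z + (p + q * z) * u1 z) \<le> K" using p by (simp add: K_def)
    qed (use that in auto)
    then show ?thesis using that by (simp add: v2_def)
  qed
  have LipL: "\<bar>v2 x - v2 y\<bar> \<le> K * \<bar>x - y\<bar>" if "x \<le> 0" "y \<le> 0" for x y
  proof -
    have "norm ((- Q * sin x + p * cos x) - (- Q * sin y + p * cos y)) \<le> K * norm (x - y)"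
    proof (rule field_differentiable_bound[of UNIV _ "\<lambda>x. - Q * cos x - p * sin x"])
      fix z :: real
      show "((\<lambda>x. - Q * sin x + p * cos x) has_real_derivative - Q * cos z - p * sin z) (at z within UNIV)"
        by (auto intro!: derivative_eq_intros)
      have "\<bar>- Q * cos z - p * sin z\<bar> \<le> \<bar>Q\<bar> * \<bar>cos z\<bar> + \<bar>p\<bar> * \<bar>sin z\<bar>"
        unfolding abs_mult[symmetric] by linarith
      also have "\<dots> \<le> \<bar>Q\<bar> * 1 + \<bar>p\<bar> * 1" by (intro add_mono mult_left_mono) auto
      finally show "norm (- Q * cos z - p * sin z) \<le> K" using p q by (simp add: K_def)
    qed auto
    moreover have "v2 z = - Q * sin z + p * cos z" if "z \<le> 0" for z
      using that u0 by (cases "z = 0") (auto simp: v2_def)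
    ultimately show ?thesis using that by simp
  qed
  have Lip: "\<bar>v2 x - v2 y\<bar> \<le> K * \<bar>x - y\<bar>" for x y
  proof -
    \<comment> \<open>A segment across \<open>0\<close> is split there; the lengths of the two parts add up.\<close>
    have cross: "\<bar>v2 x - v2 y\<bar> \<le> K * \<bar>x - y\<bar>" if "x \<le> 0" "0 \<le> y" for x y
    proof -
      have "\<bar>v2 x - v2 y\<bar> \<le> \<bar>v2 x - v2 0\<bar> + \<bar>v2 0 - v2 y\<bar>" by linarith
      also have "\<dots> \<le> K * \<bar>x - 0\<bar> + K * \<bar>0 - y\<bar>" using that by (intro add_mono LipR LipL) auto
      also have "\<dots> = K * \<bar>x - y\<bar>" using that by (simp add: algebra_simps)
      finally show ?thesis .
    qed
    show ?thesis
      using LipR[of x y] LipL[of x y] cross[of x y] cross[of y x]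
      by (cases "0 \<le> x"; cases "0 \<le> y") (auto simp: abs_minus_commute)
  qed
  have "smooth_extension p q v K"
    unfolding smooth_extension_def
  proof (intro conjI allI impI)
    show "continuous_on UNIV v" using v by (intro DERIV_continuous_on) (auto intro: has_field_derivative_at_within)
    show "v 0 = 1" by (simp add: v_def u0)
    fix x
    show "\<bar>v x\<bar> \<le> K"
    proof (cases "0 \<le> x")
      case True then show ?thesis using u_le[of x] u(3)[of x] p q by (simp add: v_def K_def)
    next
      case False
      have "\<bar>1 + p + Q * sin x - p * cos x\<bar> \<le> 1 + p + \<bar>Q\<bar> * \<bar>sin x\<bar> + \<bar>p\<bar> * \<bar>cos x\<bar>"
        unfolding abs_mult[symmetric] using p by linarith
      also have "\<dots> \<le> 1 + p + \<bar>Q\<bar> * 1 + \<bar>p\<bar> * 1" by (intro add_mono mult_left_mono) auto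
      finally show ?thesis using False p q by (simp add: v_def K_def)
    qed
  next
    fix x :: real assume x: "0 < x"
    show "0 \<le> v x" using x u(3)[of x] by (simp add: v_def)
    show "(p + q * x)\<^sup>2 * v x \<le> K" using x L(1)[of x] p q by (simp add: v_def K_def)
    have "v2 x = (p + q * x) * v x" using x by (simp add: v2_def v_def)
    then show "\<exists>D. \<forall>s. \<bar>v (x + s) - v x - D * s - (p + q * x) * v x * s\<^sup>2 / 2\<bar> \<le> K * \<bar>s\<bar> ^ 3"
      using second_order_taylor[OF v v1 Lip, of x] by (intro exI[of _ "v1 x"]) simp
  qed
  then show ?thesis by (intro exI[of _ v] exI[of _ K]) (auto simp: v_def)
qed

section \<open>Discounted passage to zero of a discrete process\<close>

text \<open>The discount accumulated strictly before time \<open>k\<close>, set to \<open>0\<close> once the sequence has been nonpositive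
before \<open>k\<close>.\<close>
definition survival_weight :: "(real \<Rightarrow> real) \<Rightarrow> (nat \<Rightarrow> real) \<Rightarrow> nat \<Rightarrow> real" where
  "survival_weight c s k = (if \<forall>j<k. 0 < s j then exp (- (\<Sum>j<k. c (s j))) else 0)"

definition first_passage :: "(nat \<Rightarrow> real) \<Rightarrow> nat" where
  "first_passage s = (LEAST k. s k \<le> 0)"

text \<open>The discounted reward \<open>v\<close> collected at the first nonpositive value. For \<open>v = 1\<close> it is the integrand of
a Laplace transform, with the value \<open>0\<close> for sequences that stay positive forever.\<close>
definition passage_value :: "(real \<Rightarrow> real) \<Rightarrow> (real \<Rightarrow> real) \<Rightarrow> (nat \<Rightarrow> real) \<Rightarrow> real" where
  "passage_value c v s =
     (if \<exists>k. s k \<le> 0 then exp (- (\<Sum>j<first_passage s. c (s j))) * v (s (first_passage s)) else 0)"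

lemma first_passage_eqI: "s k \<le> 0 \<Longrightarrow> \<forall>j<k. 0 < s j \<Longrightarrow> first_passage s = k"
  unfolding first_passage_def by (rule Least_equality) (auto simp: not_le[symmetric])

lemma first_passageE:
  assumes "s k \<le> 0"
  shows "s (first_passage s) \<le> 0" "first_passage s \<le> k" "j < first_passage s \<Longrightarrow> 0 < s j"
  unfolding first_passage_def
  by (rule LeastI, rule assms) (rule Least_le, rule assms, metis not_less_Least not_le)

lemma survival_weight_0 [simp]: "survival_weight c s 0 = 1"
  by (simp add: survival_weight_def)

lemma survival_weight_Suc:
  "survival_weight c s (Suc k) = (if 0 < s k then survival_weight c s k * exp (- c (s k)) else 0)"
  by (auto simp: survival_weight_def less_Suc_eq exp_add[symmetric])

lemma survival_weight_bound:
  assumes "\<And>x. 0 < x \<Longrightarrow> a \<le> c x"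
  shows "0 \<le> survival_weight c s k" "survival_weight c s k \<le> exp (- (a * k))"
proof -
  show "0 \<le> survival_weight c s k" by (simp add: survival_weight_def)
  have "real k * a \<le> (\<Sum>j<k. c (s j))" if "\<forall>j<k. 0 < s j"
    using sum_mono[of "{..<k}" "\<lambda>_. a" "\<lambda>j. c (s j)"] that assms by auto
  then show "survival_weight c s k \<le> exp (- (a * k))" by (simp add: survival_weight_def mult.commute)
qed

lemma measurable_survival_weight [measurable]:
  assumes [measurable]: "c \<in> borel_measurable borel" "\<And>k. X k \<in> borel_measurable M"
  shows "(\<lambda>\<omega>. survival_weight c (\<lambda>k. X k \<omega>) k) \<in> borel_measurable M"
  unfolding survival_weight_def by measurable

text \<open>The candidate for the martingale: the discounted value before the passage and the reward after it.
Written as a sum it is visibly measurable and its increments are local.\<close>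
definition stopped_value :: "(real \<Rightarrow> real) \<Rightarrow> (real \<Rightarrow> real) \<Rightarrow> (nat \<Rightarrow> real) \<Rightarrow> nat \<Rightarrow> real" where
  "stopped_value c v s k = survival_weight c s k * v (s k) +
     (\<Sum>j<k. if s j \<le> 0 then survival_weight c s j * v (s j) else 0)"

lemma stopped_value_Suc:
  "stopped_value c v s (Suc k) - stopped_value c v s k =
   survival_weight c s (Suc k) * v (s (Suc k)) - (if 0 < s k then survival_weight c s k * v (s k) else 0)"
  by (simp add: stopped_value_def)

lemma stopped_value_eq:
  "stopped_value c v s k = (if \<exists>j<k. s j \<le> 0 then passage_value c v s else survival_weight c s k * v (s k))"
proof (induction k)
  case (Suc k)
  have eq: "stopped_value c v s (Suc k) = stopped_value c v s k +
      (survival_weight c s (Suc k) * v (s (Suc k)) - (if 0 < s k then survival_weight c s k * v (s k) else 0))"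
    using stopped_value_Suc[of c v s k] by simp
  consider "\<exists>j<k. s j \<le> 0" | "\<forall>j<k. 0 < s j" "s k \<le> 0" | "\<forall>j<k. 0 < s j" "0 < s k"
    by (meson not_le)
  then show ?case
  proof cases
    case 1
    then have "survival_weight c s k = 0" by (auto simp: survival_weight_def not_less)
    with 1 Suc.IH show ?thesis unfolding eq survival_weight_Suc by (auto simp: less_Suc_eq)
  next
    case 2
    then have "first_passage s = k" by (intro first_passage_eqI)
    with 2 have "passage_value c v s = survival_weight c s k * v (s k)"
      by (auto simp: passage_value_def survival_weight_def)
    with 2 Suc.IH show ?thesis unfolding eq survival_weight_Suc by (auto simp: less_Suc_eq not_less[symmetric])
  next
    case 3
    then show ?thesis using Suc.IH unfolding eq by (auto simp: less_Suc_eq not_less[symmetric])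
  qed
qed (simp add: stopped_value_def)

lemma passage_value_bound:
  assumes "\<And>x. 0 < x \<Longrightarrow> 0 \<le> c x" "\<And>x. \<bar>v x\<bar> \<le> L"
  shows "\<bar>passage_value c v s\<bar> \<le> L"
proof (cases "\<exists>k. s k \<le> 0")
  case True
  then obtain k where k: "s k \<le> 0" by blast
  have "0 \<le> (\<Sum>j<first_passage s. c (s j))"
    using assms(1) first_passageE(3)[of s k, OF k] by (intro sum_nonneg) auto
  then have "exp (- (\<Sum>j<first_passage s. c (s j))) * \<bar>v (s (first_passage s))\<bar> \<le> 1 * L"
    using assms(2) by (intro mult_mono) auto
  with True show ?thesis by (simp add: passage_value_def abs_mult)
next
  case False
  then show ?thesis using assms(2)[of 0] by (auto simp: passage_value_def)
qed

lemma stopped_value_bound: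
  assumes c: "\<And>x. 0 < x \<Longrightarrow> 0 \<le> c x" and v: "\<And>x. \<bar>v x\<bar> \<le> L"
  shows "\<bar>stopped_value c v s k\<bar> \<le> L"
proof -
  have "\<bar>survival_weight c s k * v (s k)\<bar> \<le> 1 * L"
    unfolding abs_mult using v survival_weight_bound[of 0 c s k] c by (intro mult_mono) auto
  then show ?thesis using passage_value_bound[of c v L s, OF c v] by (auto simp: stopped_value_eq)
qed

lemma stopped_value_tendsto:
  assumes c: "\<And>x. 0 < x \<Longrightarrow> a \<le> c x" and a: "0 < a" and v: "\<And>x. \<bar>v x\<bar> \<le> L"
  shows "stopped_value c v s \<longlonglongrightarrow> passage_value c v s"
proof (cases "\<exists>k. s k \<le> 0")
  case True
  then obtain k where k: "s k \<le> 0" by blast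
  have "\<forall>\<^sub>F n in sequentially. stopped_value c v s n = passage_value c v s"
    using eventually_gt_at_top[of k] by eventually_elim (use k in \<open>auto simp: stopped_value_eq\<close>)
  then show ?thesis by (rule tendsto_eventually)
next
  case False
  have "(\<lambda>k. L * exp (- a) ^ k) \<longlonglongrightarrow> L * 0"
    using a by (intro tendsto_mult tendsto_const LIMSEQ_realpow_zero) auto
  then have "stopped_value c v s \<longlonglongrightarrow> 0"
  proof (rule Lim_null_comparison[rotated, OF tendsto_eq_rhs])
    show "\<forall>\<^sub>F k in sequentially. norm (stopped_value c v s k) \<le> L * exp (- a) ^ k"
    proof (rule always_eventually, rule allI)
      fix k
      have "\<bar>survival_weight c s k * v (s k)\<bar> \<le> exp (- (a * k)) * L"
        unfolding abs_mult using v survival_weight_bound[of a c s k] c by (intro mult_mono) auto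
      then show "norm (stopped_value c v s k) \<le> L * exp (- a) ^ k"
        using False by (simp add: stopped_value_eq exp_of_nat_mult[symmetric] mult_ac)
    qed
  qed simp
  with False show ?thesis by (simp add: passage_value_def)
qed

lemma measurable_stopped_value [measurable]:
  assumes [measurable]: "c \<in> borel_measurable borel" "v \<in> borel_measurable borel" "\<And>k. X k \<in> borel_measurable M"
  shows "(\<lambda>\<omega>. stopped_value c v (\<lambda>k. X k \<omega>) k) \<in> borel_measurable M"
  unfolding stopped_value_def by measurable

lemma measurable_passage_value:
  assumes [measurable]: "c \<in> borel_measurable borel" "v \<in> borel_measurable borel" "\<And>k. X k \<in> borel_measurable M"
    and "\<And>x. 0 < x \<Longrightarrow> a \<le> c x" "0 < a" "\<And>x. \<bar>v x\<bar> \<le> L"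
  shows "(\<lambda>\<omega>. passage_value c v (\<lambda>k. X k \<omega>)) \<in> borel_measurable M"
  by (rule borel_measurable_LIMSEQ_real[OF stopped_value_tendsto[OF assms(4-)]]) auto

text \<open>If each increment has an expectation of at most \<open>\<epsilon>\<close> times the least possible discount, the total drift
is bounded by a geometric series.\<close>
lemma (in prob_space) passage_value_telescoping:
  fixes X :: "nat \<Rightarrow> 'a \<Rightarrow> real"
  assumes [measurable]: "c \<in> borel_measurable borel" "v \<in> borel_measurable borel" "\<And>k. X k \<in> borel_measurable M"
    and c: "\<And>x. 0 < x \<Longrightarrow> a \<le> c x" and a: "0 < a" and v: "\<And>x. \<bar>v x\<bar> \<le> L"
    and X0: "\<And>\<omega>. \<omega> \<in> space M \<Longrightarrow> X 0 \<omega> = z"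
    and step: "\<And>k. \<bar>expectation (\<lambda>\<omega>. survival_weight c (\<lambda>k. X k \<omega>) (Suc k) * v (X (Suc k) \<omega>) -
        (if 0 < X k \<omega> then survival_weight c (\<lambda>k. X k \<omega>) k * v (X k \<omega>) else 0))\<bar> \<le> \<epsilon> * exp (- (a * k))"
  shows "\<bar>expectation (\<lambda>\<omega>. passage_value c v (\<lambda>k. X k \<omega>)) - v z\<bar> \<le> \<epsilon> / (1 - exp (- a))"
proof -
  let ?Y = "\<lambda>k \<omega>. stopped_value c v (\<lambda>k. X k \<omega>) k"
  have c0: "0 \<le> c x" if "0 < x" for x using c[OF that] a by simp
  have Y_int: "integrable M (?Y k)" for k
    using stopped_value_bound[of c v L, OF c0 v] by (intro integrable_const_bound[of _ L]) auto
  have \<epsilon>: "0 \<le> \<epsilon>" using order_trans[OF abs_ge_zero step[of 0]] by simp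
  have "(\<lambda>k. expectation (?Y k)) \<longlonglongrightarrow> expectation (\<lambda>\<omega>. passage_value c v (\<lambda>k. X k \<omega>))"
  proof (rule integral_dominated_convergence[where w = "\<lambda>_. L"])
    show "(\<lambda>\<omega>. passage_value c v (\<lambda>k. X k \<omega>)) \<in> borel_measurable M"
      by (rule measurable_passage_value[OF _ _ _ c a v]) auto
    show "AE \<omega> in M. norm (?Y k \<omega>) \<le> L" for k
      using stopped_value_bound[of c v L, OF c0 v] by auto
    show "AE \<omega> in M. (\<lambda>k. ?Y k \<omega>) \<longlonglongrightarrow> passage_value c v (\<lambda>k. X k \<omega>)"
      using stopped_value_tendsto[of a c v L, OF c a v] by auto
  qed auto
  then have lim: "(\<lambda>k. \<bar>expectation (?Y k) - v z\<bar>) \<longlonglongrightarrow>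
      \<bar>expectation (\<lambda>\<omega>. passage_value c v (\<lambda>k. X k \<omega>)) - v z\<bar>"
    by (intro tendsto_intros)
  have "\<bar>expectation (?Y k) - v z\<bar> \<le> (\<Sum>j<k. \<epsilon> * exp (- (a * real j)))" for k
  proof (induction k)
    case 0
    have "expectation (?Y 0) = expectation (\<lambda>_. v z)"
      by (rule Bochner_Integration.integral_cong) (auto simp: stopped_value_def X0)
    then show ?case by (simp add: prob_space)
  next
    case (Suc k)
    have "expectation (?Y (Suc k)) - expectation (?Y k) = expectation (\<lambda>\<omega>. ?Y (Suc k) \<omega> - ?Y k \<omega>)"
      using Y_int by simp
    then have "\<bar>expectation (?Y (Suc k)) - expectation (?Y k)\<bar> \<le> \<epsilon> * exp (- (a * k))"
      unfolding stopped_value_Suc using step[of k] by simp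
    with Suc.IH show ?case by simp
  qed
  also have "(\<Sum>j<k. \<epsilon> * exp (- (a * real j))) \<le> \<epsilon> / (1 - exp (- a))" for k :: nat
  proof -
    have "(\<Sum>j<k. \<epsilon> * exp (- (a * real j))) = \<epsilon> * (\<Sum>j<k. exp (- a) ^ j)"
      by (simp add: sum_distrib_left exp_of_nat_mult[symmetric] mult_ac)
    also have "(\<Sum>j<k. exp (- a) ^ j) \<le> (\<Sum>j. exp (- a) ^ j)"
      using a by (intro sum_le_suminf summable_geometric) auto
    also have "\<dots> = 1 / (1 - exp (- a))" using a by (intro suminf_geometric) auto
    finally show ?thesis using \<epsilon> by (auto intro: mult_left_mono simp: divide_inverse)
  qed
  finally have bound: "\<bar>expectation (?Y k) - v z\<bar> \<le> \<epsilon> / (1 - exp (- a))" for k .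
  show ?thesis by (rule LIMSEQ_le_const2[OF lim]) (use bound in blast)
qed

text \<open>Squeezed between \<open>1 - y\<close> and \<open>1 / (1 + y)\<close>, the exponential agrees with \<open>1 / (1 + y)\<close> up to \<open>y\<^sup>2\<close>.\<close>
lemma exp_minus_compensated: "0 \<le> y \<Longrightarrow> \<bar>exp (- y) * (1 + y) - 1\<bar> \<le> y\<^sup>2" for y :: real
proof -
  assume y: "0 \<le> y"
  have "(1 - y) * (1 + y) \<le> exp (- y) * (1 + y)"
    using exp_ge_add_one_self[of "- y"] y by (intro mult_right_mono) auto
  moreover have "exp (- y) * (1 + y) \<le> exp (- y) * exp y"
    using exp_ge_add_one_self[of y] by (intro mult_left_mono) auto
  ultimately show ?thesis by (simp add: algebra_simps power2_eq_square exp_minus_inverse)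
qed

text \<open>The one-step operator \<open>P\<close> reproduces \<open>(1 + c) u\<close> up to order \<open>\<delta> powr (3/2)\<close>, where \<open>c\<close> is the cost of
the step. The discount \<open>exp (- c)\<close> compensates \<open>1 + c\<close> up to \<open>c\<^sup>2\<close>, and \<open>c\<^sup>2 u\<close> is of order \<open>\<delta>\<^sup>2\<close> uniformly
in the position by the decay of \<open>u\<close>. The rate \<open>p > 0\<close> in the cost makes the geometric series of order
\<open>1 / \<delta>\<close>.\<close>
lemma (in prob_space) passage_value_expectation:
  fixes X :: "nat \<Rightarrow> 'a \<Rightarrow> real"
  assumes sol: "smooth_extension p q u L" and p: "0 < p" and q: "0 \<le> q"
    and [measurable]: "\<And>k. X k \<in> borel_measurable M" "P \<in> borel_measurable borel"
    and P_bound: "\<And>x. \<bar>P x\<bar> \<le> L"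
    and X0: "\<And>\<omega>. \<omega> \<in> space M \<Longrightarrow> X 0 \<omega> = z"
    and \<delta>: "0 < \<delta>" "\<delta> \<le> 1"
    and step: "\<And>k. expectation (\<lambda>\<omega>. survival_weight (\<lambda>x. \<delta> * (p + q * x) / 2) (\<lambda>k. X k \<omega>) (Suc k) * u (X (Suc k) \<omega>))
       = expectation (\<lambda>\<omega>. survival_weight (\<lambda>x. \<delta> * (p + q * x) / 2) (\<lambda>k. X k \<omega>) (Suc k) * P (X k \<omega>))"
    and P: "\<And>x. 0 < x \<Longrightarrow> \<bar>P x - (1 + \<delta> * (p + q * x) / 2) * u x\<bar> \<le> m * (\<delta> * sqrt \<delta>)"
  shows "\<bar>expectation (\<lambda>\<omega>. passage_value (\<lambda>x. \<delta> * (p + q * x) / 2) u (\<lambda>k. X k \<omega>)) - u z\<bar>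
       \<le> 2 * (m + L) * (1 + p) / p * sqrt \<delta>"
proof -
  define c where "c x = \<delta> * (p + q * x) / 2" for x
  define a where "a = \<delta> * p / 2"
  have [measurable]: "c \<in> borel_measurable borel" unfolding c_def by measurable
  have [measurable]: "u \<in> borel_measurable borel"
    using sol unfolding smooth_extension_def by (intro borel_measurable_continuous_onI) auto
  have u: "\<bar>u x\<bar> \<le> L" for x using sol unfolding smooth_extension_def by auto
  have L: "0 \<le> L" using u[of 0] by simp
  have a: "0 < a" using p \<delta> by (simp add: a_def)
  have c: "a \<le> c x" if "0 < x" for x using that p q \<delta> by (simp add: a_def c_def)
  have c0: "0 \<le> c x" if "0 < x" for x using c[OF that] a by simp
  have \<delta>2: "\<delta>\<^sup>2 \<le> \<delta> * sqrt \<delta>"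
  proof -
    have "sqrt \<delta> * sqrt \<delta> \<le> 1 * sqrt \<delta>" using \<delta> by (intro mult_right_mono) auto
    then have "\<delta> \<le> sqrt \<delta>" using \<delta> by simp
    then show ?thesis using \<delta> by (simp add: power2_eq_square)
  qed
  have m: "0 \<le> m"
    using order_trans[OF abs_ge_zero P[of 1]] mult_neg_pos[of m "\<delta> * sqrt \<delta>"] \<delta> by (meson less_le_trans mult_pos_pos not_le real_sqrt_gt_zero zero_less_one)
  define w where "w k \<omega> = survival_weight c (\<lambda>k. X k \<omega>) k" for k \<omega>
  have [measurable]: "w k \<in> borel_measurable M" for k unfolding w_def by measurable
  have w: "0 \<le> w k \<omega>" "w k \<omega> \<le> exp (- (a * k))" for k \<omega>
    unfolding w_def using survival_weight_bound[of a c, OF c] by auto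
  have w1: "w k \<omega> \<le> 1" for k \<omega> using w(2)[of k \<omega>] a by (auto elim: order_trans)
  have int: "integrable M (\<lambda>\<omega>. w k \<omega> * f (X j \<omega>))"
    if "f \<in> borel_measurable borel" "\<And>x. \<bar>f x\<bar> \<le> L" for f k j
  proof (rule integrable_const_bound[of _ L])
    show "AE \<omega> in M. norm (w k \<omega> * f (X j \<omega>)) \<le> L"
    proof (rule AE_I2)
      fix \<omega>
      have "w k \<omega> * \<bar>f (X j \<omega>)\<bar> \<le> 1 * L" using w w1 that by (intro mult_mono) auto
      then show "norm (w k \<omega> * f (X j \<omega>)) \<le> L" using w by (simp add: abs_mult)
    qed
  qed (use that(1) in measurable)
  have one: "\<bar>exp (- c x) * P x - u x\<bar> \<le> (m + L) * (\<delta> * sqrt \<delta>)" if x: "0 < x" for x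
  proof -
    have ux: "0 \<le> u x" "(p + q * x)\<^sup>2 * u x \<le> L" using sol x unfolding smooth_extension_def by auto
    have "exp (- c x) * P x - u x =
        exp (- c x) * (P x - (1 + c x) * u x) + (exp (- c x) * (1 + c x) - 1) * u x"
      by (simp add: algebra_simps)
    also have "\<bar>\<dots>\<bar> \<le> exp (- c x) * \<bar>P x - (1 + c x) * u x\<bar> + \<bar>exp (- c x) * (1 + c x) - 1\<bar> * u x"
      using ux(1) by (intro order_trans[OF abs_triangle_ineq]) (simp add: abs_mult)
    also have "\<dots> \<le> 1 * (m * (\<delta> * sqrt \<delta>)) + (c x)\<^sup>2 * u x"
      using c0[OF x] P[OF x] ux(1) m \<delta> exp_minus_compensated[OF c0[OF x]]
      by (intro add_mono mult_mono mult_right_mono) (auto simp: c_def)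
    also have "(c x)\<^sup>2 * u x = \<delta>\<^sup>2 / 4 * ((p + q * x)\<^sup>2 * u x)" by (simp add: c_def power2_eq_square)
    also have "\<dots> \<le> \<delta>\<^sup>2 * L"
    proof -
      have "\<delta>\<^sup>2 / 4 * ((p + q * x)\<^sup>2 * u x) \<le> \<delta>\<^sup>2 / 4 * L" using ux(2) by (intro mult_left_mono) auto
      also have "\<dots> \<le> \<delta>\<^sup>2 * L" using L by (intro mult_right_mono) auto
      finally show ?thesis .
    qed
    also have "\<dots> \<le> \<delta> * sqrt \<delta> * L" using \<delta>2 L by (intro mult_right_mono) auto
    finally show ?thesis by (simp add: algebra_simps)
  qed
  have main: "\<bar>expectation (\<lambda>\<omega>. passage_value c u (\<lambda>k. X k \<omega>)) - u z\<bar>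
      \<le> (m + L) * (\<delta> * sqrt \<delta>) / (1 - exp (- a))"
  proof (rule passage_value_telescoping[where c = c and v = u and X = X and z = z and L = L, OF _ _ _ c a u X0])
    fix k
    let ?f = "\<lambda>\<omega>. if 0 < X k \<omega> then w k \<omega> * u (X k \<omega>) else 0"
    have f_int: "integrable M ?f"
    proof (rule Bochner_Integration.integrable_bound[OF int[of u k k]])
      show "AE \<omega> in M. norm (?f \<omega>) \<le> norm (w k \<omega> * u (X k \<omega>))" by auto
    qed (use u in auto)
    have "expectation (\<lambda>\<omega>. w (Suc k) \<omega> * u (X (Suc k) \<omega>) - ?f \<omega>)
        = expectation (\<lambda>\<omega>. w (Suc k) \<omega> * P (X k \<omega>) - ?f \<omega>)"
      using step[of k] int[of u "Suc k" "Suc k"] int[of P "Suc k" k] f_int u P_bound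
      by (simp add: c_def[abs_def] w_def[abs_def])
    also have "\<bar>\<dots>\<bar> \<le> expectation (\<lambda>\<omega>. \<bar>w (Suc k) \<omega> * P (X k \<omega>) - ?f \<omega>\<bar>)" by (rule integral_abs_bound)
    also have "\<dots> \<le> expectation (\<lambda>\<omega>. (m + L) * (\<delta> * sqrt \<delta>) * exp (- (a * k)))"
    proof (rule integral_mono)
      show "integrable M (\<lambda>\<omega>. \<bar>w (Suc k) \<omega> * P (X k \<omega>) - ?f \<omega>\<bar>)"
        using int[of P "Suc k" k] f_int P_bound by auto
      fix \<omega>
      show "\<bar>w (Suc k) \<omega> * P (X k \<omega>) - ?f \<omega>\<bar> \<le> (m + L) * (\<delta> * sqrt \<delta>) * exp (- (a * k))"
      proof (cases "0 < X k \<omega>")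
        case True
        then have "w (Suc k) \<omega> * P (X k \<omega>) - ?f \<omega> = w k \<omega> * (exp (- c (X k \<omega>)) * P (X k \<omega>) - u (X k \<omega>))"
          by (simp add: w_def survival_weight_Suc algebra_simps)
        then have "\<bar>w (Suc k) \<omega> * P (X k \<omega>) - ?f \<omega>\<bar> = w k \<omega> * \<bar>exp (- c (X k \<omega>)) * P (X k \<omega>) - u (X k \<omega>)\<bar>"
          using w(1)[of k \<omega>] by (simp add: abs_mult)
        also have "\<dots> \<le> exp (- (a * k)) * ((m + L) * (\<delta> * sqrt \<delta>))"
          using w one[OF True] by (intro mult_mono) auto
        finally show ?thesis by (simp add: mult.commute)
      next
        case False
        then show ?thesis using m L \<delta> by (simp add: w_def survival_weight_Suc)
      qed
    qed simp
    finally show "\<bar>expectation (\<lambda>\<omega>. survival_weight c (\<lambda>k. X k \<omega>) (Suc k) * u (X (Suc k) \<omega>) -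
        (if 0 < X k \<omega> then survival_weight c (\<lambda>k. X k \<omega>) k * u (X k \<omega>) else 0))\<bar>
        \<le> (m + L) * (\<delta> * sqrt \<delta>) * exp (- (a * k))"
      by (simp add: prob_space) (simp only: w_def)
  qed auto
  also have "\<dots> \<le> (m + L) * (\<delta> * sqrt \<delta>) / (a / (1 + p))"
  proof (rule divide_left_mono)
    \<comment> \<open>\<open>1 - exp (- a) \<ge> a / (1 + a)\<close>, and \<open>a \<le> p\<close> makes the denominator uniform in \<open>\<delta>\<close>.\<close>
    have "exp (- a) \<le> 1 / (1 + a)"
      using exp_ge_add_one_self[of a] a by (simp add: exp_minus field_simps)
    then have "a / (1 + a) \<le> 1 - exp (- a)" using a by (simp add: field_simps)
    moreover have "a \<le> p" using p \<delta> by (simp add: a_def)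
    then have "a / (1 + p) \<le> a / (1 + a)" using a by (intro divide_left_mono) auto
    ultimately show "a / (1 + p) \<le> 1 - exp (- a)" by simp
    then show "0 < (1 - exp (- a)) * (a / (1 + p))" using a p by simp
    show "0 \<le> (m + L) * (\<delta> * sqrt \<delta>)" using m L \<delta> by simp
  qed
  also have "\<dots> = 2 * (m + L) * (1 + p) / p * sqrt \<delta>"
    using \<delta> p by (simp add: a_def field_simps)
  finally show ?thesis unfolding c_def .
qed

text \<open>The steps \<open>h, 0, - h\<close> with probabilities \<open>1/4, 1/2, 1/4\<close> have variance \<open>h\<^sup>2 / 2\<close>.\<close>
lemma lazy_step_generator:
  assumes sol: "smooth_extension p q u L" and x: "0 < x" and h: "0 < h"
  shows "\<bar>(u (x + h) + 2 * u x + u (x - h)) / 4 - (1 + h\<^sup>2 / 2 * (p + q * x) / 2) * u x\<bar> \<le> 2 * L * (h\<^sup>2 / 2 * sqrt (h\<^sup>2 / 2))"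
proof -
  obtain D where D: "\<And>s. \<bar>u (x + s) - u x - D * s - (p + q * x) * u x * s\<^sup>2 / 2\<bar> \<le> L * \<bar>s\<bar> ^ 3"
    using sol x unfolding smooth_extension_def by blast
  have L: "0 \<le> L" using order_trans[OF abs_ge_zero, of "u 0" L] sol unfolding smooth_extension_def by blast
  define K where "K = (p + q * x) * u x * h\<^sup>2"
  have eq: "(1 + h\<^sup>2 / 2 * (p + q * x) / 2) * u x = u x + K / 4" by (simp add: K_def algebra_simps)
  define A B where "A = u (x + h) - u x - D * h - K / 2" and "B = u (x - h) - u x + D * h - K / 2"
  have AB: "\<bar>A\<bar> \<le> L * h ^ 3" "\<bar>B\<bar> \<le> L * h ^ 3"
    using D[of h] D[of "- h"] h by (simp_all add: K_def A_def B_def)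
  have "(u (x + h) + 2 * u x + u (x - h)) / 4 - (1 + h\<^sup>2 / 2 * (p + q * x) / 2) * u x = (A + B) / 4"
    unfolding eq A_def B_def by (simp add: field_simps)
  also have "\<bar>\<dots>\<bar> \<le> L * h ^ 3 / 2" using AB by simp
  also have "\<dots> \<le> 2 * L * (h\<^sup>2 / 2 * sqrt (h\<^sup>2 / 2))"
  proof -
    have "h / 2 \<le> sqrt (h\<^sup>2 / 2)"
      using h by (intro real_le_rsqrt) (simp add: power_divide)
    then have "L * h\<^sup>2 * (h / 2) \<le> L * h\<^sup>2 * sqrt (h\<^sup>2 / 2)" using L by (intro mult_left_mono) auto
    then show ?thesis by (simp add: power2_eq_square power3_eq_cube mult_ac)
  qed
  finally show ?thesis .
qed

text \<open>The Taylor polynomial is integrated exactly by the first three moments, and the third absolute moment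
of the Gaussian controls the remainder.\<close>
lemma gaussian_step_generator:
  assumes sol: "smooth_extension p q u L" and x: "0 < x" and \<delta>: "0 < \<delta>"
  shows "\<bar>(\<integral>s. normal_density 0 (sqrt \<delta>) s * u (x + s) \<partial>lborel) - (1 + \<delta> * (p + q * x) / 2) * u x\<bar>
     \<le> 2 * L * (\<delta> * sqrt \<delta>)"
proof -
  let ?n = "normal_density 0 (sqrt \<delta>)"
  obtain D where D: "\<And>s. \<bar>u (x + s) - u x - D * s - (p + q * x) * u x * s\<^sup>2 / 2\<bar> \<le> L * \<bar>s\<bar> ^ 3"
    using sol x unfolding smooth_extension_def by blast
  have uL: "\<bar>u y\<bar> \<le> L" for y using sol unfolding smooth_extension_def by blast
  have L: "0 \<le> L" using uL[of 0] by simp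
  have [measurable]: "u \<in> borel_measurable borel"
    using sol unfolding smooth_extension_def by (intro borel_measurable_continuous_onI) auto
  have sd: "0 < sqrt \<delta>" using \<delta> by simp
  have m0: "has_bochner_integral lborel (\<lambda>s. ?n s) 1"
    using normal_moment_even[OF sd, of 0 0] by simp
  have m1: "has_bochner_integral lborel (\<lambda>s. ?n s * s) 0"
    using normal_moment_odd[OF sd, of 0 0] by simp
  have "has_bochner_integral lborel (\<lambda>s. ?n s * s\<^sup>2) (fact (2 * 1) / ((2 / (sqrt \<delta>)\<^sup>2) ^ 1 * fact 1))"
    using normal_moment_even[OF sd, of 0 1] unfolding diff_zero mult_1_right .
  also have "fact (2 * 1) / ((2 / (sqrt \<delta>)\<^sup>2) ^ 1 * fact 1) = \<delta>" using \<delta> by simp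
  finally have m2: "has_bochner_integral lborel (\<lambda>s. ?n s * s\<^sup>2) \<delta>" .
  have "has_bochner_integral lborel (\<lambda>s. ?n s * \<bar>s\<bar> ^ (2 * 1 + 1))
      (2 ^ 1 * sqrt \<delta> ^ (2 * 1 + 1) * fact 1 * sqrt (2 / pi))"
    using normal_moment_abs_odd[OF sd, of 0 1] unfolding diff_zero .
  also have "2 ^ 1 * sqrt \<delta> ^ (2 * 1 + 1) * fact 1 * sqrt (2 / pi) = 2 * sqrt (2 / pi) * \<delta> * sqrt \<delta>"
    using \<delta> by (simp add: power3_eq_cube)
  finally have m3: "has_bochner_integral lborel (\<lambda>s. ?n s * \<bar>s\<bar> ^ 3) (2 * sqrt (2 / pi) * \<delta> * sqrt \<delta>)"
    by simp
  have int_u: "integrable lborel (\<lambda>s. ?n s * u (x + s))"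
  proof (rule Bochner_Integration.integrable_bound[OF integrable_mult_left[OF integrable_normal_density, of L]])
    show "AE s in lborel. norm (?n s * u (x + s)) \<le> norm (?n s * L)"
      using uL L by (auto simp: abs_mult intro!: mult_left_mono)
  qed (use \<delta> in \<open>auto intro!: borel_measurable_times measurable_compose[of "\<lambda>s. x + s" _ _ u]\<close>)
  define T where "T s = u x + D * s + (p + q * x) * u x / 2 * s\<^sup>2" for s
  have "has_bochner_integral lborel (\<lambda>s. u x * ?n s + D * (?n s * s) + (p + q * x) * u x / 2 * (?n s * s\<^sup>2))
      (u x * 1 + D * 0 + (p + q * x) * u x / 2 * \<delta>)"
    by (intro has_bochner_integral_add has_bochner_integral_mult_right m0 m1 m2)
  then have T: "has_bochner_integral lborel (\<lambda>s. ?n s * T s) ((1 + \<delta> * (p + q * x) / 2) * u x)"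
    by (simp add: T_def algebra_simps)
  then have T_int: "integrable lborel (\<lambda>s. ?n s * T s)"
    and T_integral: "(\<integral>s. ?n s * T s \<partial>lborel) = (1 + \<delta> * (p + q * x) / 2) * u x"
    unfolding has_bochner_integral_iff by auto
  have "\<bar>(\<integral>s. ?n s * u (x + s) \<partial>lborel) - (\<integral>s. ?n s * T s \<partial>lborel)\<bar> \<le> (\<integral>s. L * (?n s * \<bar>s\<bar> ^ 3) \<partial>lborel)"
  proof (rule integral_abs_diff_le[OF int_u T_int _ AE_I2])
    show "integrable lborel (\<lambda>s. L * (?n s * \<bar>s\<bar> ^ 3))" using m3 by (simp add: has_bochner_integral_iff)
    fix s
    have "\<bar>?n s * u (x + s) - ?n s * T s\<bar> = ?n s * \<bar>u (x + s) - T s\<bar>"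
      by (simp add: abs_mult flip: right_diff_distrib)
    also have "\<dots> \<le> ?n s * (L * \<bar>s\<bar> ^ 3)"
      using D[of s] by (intro mult_left_mono) (auto simp: T_def algebra_simps)
    finally show "\<bar>?n s * u (x + s) - ?n s * T s\<bar> \<le> L * (?n s * \<bar>s\<bar> ^ 3)"
      by (simp only: mult.left_commute)
  qed
  also have "\<dots> = L * (2 * sqrt (2 / pi) * \<delta> * sqrt \<delta>)" using m3 by (simp add: has_bochner_integral_iff)
  also have "\<dots> \<le> L * (2 * 1 * \<delta> * sqrt \<delta>)"
    using L \<delta> pi_gt3 by (intro mult_left_mono mult_right_mono) auto
  finally show ?thesis unfolding T_integral by (simp add: mult_ac)
qed

section \<open>Passage of a continuous path along dyadic grids\<close>

lemma grid_riemann_sum_error: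
  fixes g :: "real \<Rightarrow> real" and K :: nat and h e :: real
  assumes g: "continuous_on {0..} g" and h: "0 < h"
    and osc: "\<And>s t. 0 \<le> s \<Longrightarrow> s \<le> t \<Longrightarrow> t \<le> s + h \<Longrightarrow> t \<le> K * h \<Longrightarrow> \<bar>g s - g t\<bar> \<le> e"
  shows "\<bar>(\<Sum>j<K. g (real j * h)) * h - integral {0..K * h} g\<bar> \<le> e * (K * h)"
  using osc
proof (induction K)
  case (Suc K)
  have int: "g integrable_on {a..b}" if "0 \<le> a" for a b
    using that by (intro integrable_continuous_real continuous_on_subset[OF g]) auto
  let ?a = "real K * h" and ?b = "real (Suc K) * h"
  have ab: "0 \<le> ?a" "?a \<le> ?b" "?b - ?a = h" using h by (auto simp: algebra_simps)
  have "integral {0..?a} g + integral {?a..?b} g = integral {0..?b} g"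
    using ab by (intro Henstock_Kurzweil_Integration.integral_combine int) auto
  moreover have "\<bar>g ?a * h - integral {?a..?b} g\<bar> \<le> e * h"
  proof -
    have "g ?a * h - integral {?a..?b} g = integral {?a..?b} (\<lambda>t. g ?a - g t)"
      using ab int by (subst Henstock_Kurzweil_Integration.integral_diff) (auto simp: mult.commute)
    also have "\<bar>integral {?a..?b} (\<lambda>t. g ?a - g t)\<bar> \<le> integral {?a..?b} (\<lambda>t. e)"
    unfolding real_norm_def[symmetric]
    proof (rule integral_norm_bound_integral)
      fix t assume "t \<in> {?a..?b}"
      then show "norm (g ?a - g t) \<le> e" unfolding real_norm_def using ab by (intro Suc.prems) auto
    qed (use ab int in \<open>auto intro!: Henstock_Kurzweil_Integration.integrable_diff\<close>)
    also have "\<dots> = e * h" using ab by simp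
    finally show ?thesis .
  qed
  moreover have "\<bar>(\<Sum>j<K. g (real j * h)) * h - integral {0..?a} g\<bar> \<le> e * ?a"
    using ab by (intro Suc.IH Suc.prems) auto
  moreover have "e * ?b = e * ?a + e * h" by (simp add: algebra_simps)
  moreover have "(\<Sum>j<Suc K. g (real j * h)) * h = (\<Sum>j<K. g (real j * h)) * h + g ?a * h"
    by (simp add: algebra_simps)
  ultimately show ?case by linarith
qed simp

lemma grid_riemann_sum_tendsto:
  fixes g :: "real \<Rightarrow> real" and K :: "nat \<Rightarrow> nat" and h :: "nat \<Rightarrow> real"
  assumes g: "continuous_on {0..} g" and h: "\<And>n. 0 < h n" "h \<longlonglongrightarrow> 0"
    and lim: "(\<lambda>n. K n * h n) \<longlonglongrightarrow> T"
  shows "(\<lambda>n. (\<Sum>j<K n. g (real j * h n)) * h n) \<longlonglongrightarrow> integral {0..T} g"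
proof -
  have T0: "0 \<le> T" using LIMSEQ_le_const[OF lim, of 0] h(1) by (auto simp: less_imp_le)
  have ev: "\<forall>\<^sub>F n in sequentially. K n * h n \<le> T + 1"
    using order_tendstoD(2)[OF lim, of "T + 1"] by (auto elim: eventually_mono)
  have gT: "continuous_on {0..T + 1} g" by (rule continuous_on_subset[OF g]) auto
  have "(\<lambda>n. integral {0..K n * h n} g) \<longlonglongrightarrow> integral {0..T} g"
  proof (rule continuous_on_tendsto_compose[where s = "{0..T + 1}" and f = "\<lambda>b. integral {0..b} g"])
    show "continuous_on {0..T + 1} (\<lambda>b. integral {0..b} g)"
      by (intro indefinite_integral_continuous_1 integrable_continuous_real gT)
    show "\<forall>\<^sub>F n in sequentially. K n * h n \<in> {0..T + 1}"
      using ev by eventually_elim (use less_imp_le[OF h(1)] in auto)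
  qed (use lim T0 in auto)
  moreover have "(\<lambda>n. (\<Sum>j<K n. g (real j * h n)) * h n - integral {0..K n * h n} g) \<longlonglongrightarrow> 0"
  proof (rule tendstoI)
    fix e :: real assume e: "0 < e"
    define d where "d = e / (2 * (T + 1))"
    have d: "0 < d" using e T0 by (simp add: d_def)
    have "uniformly_continuous_on {0..T + 1} g" by (rule compact_uniformly_continuous[OF gT]) auto
    then obtain r where r: "0 < r"
      "\<And>s t. s \<in> {0..T + 1} \<Longrightarrow> t \<in> {0..T + 1} \<Longrightarrow> dist t s < r \<Longrightarrow> dist (g t) (g s) < d"
      using d unfolding uniformly_continuous_on_def by metis
    have "\<forall>\<^sub>F n in sequentially. h n < r" using order_tendstoD(2)[OF h(2) r(1)] .
    then show "\<forall>\<^sub>F n in sequentially. dist ((\<Sum>j<K n. g (real j * h n)) * h n - integral {0..K n * h n} g) 0 < e"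
      using ev
    proof eventually_elim
      case (elim n)
      have "\<bar>(\<Sum>j<K n. g (real j * h n)) * h n - integral {0..K n * h n} g\<bar> \<le> d * (K n * h n)"
      proof (rule grid_riemann_sum_error[OF g h(1)])
        fix s t assume "0 \<le> s" "s \<le> t" "t \<le> s + h n" "t \<le> K n * h n"
        then show "\<bar>g s - g t\<bar> \<le> d"
          using r(2)[of t s] elim by (auto simp: dist_real_def)
      qed
      also have "\<dots> \<le> d * (T + 1)" using elim d by (intro mult_left_mono) auto
      also have "\<dots> < e" using e T0 by (simp add: d_def field_simps add_pos_nonneg)
      finally show ?case by simp
    qed
  qed
  ultimately show ?thesis using tendsto_add by fastforce
qed

text \<open>The grids of mesh \<open>(1/2) ^ n\<close> see a path only at dyadic times; the limit of the passages seen by them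
is the infimum of the following set.\<close>
definition dyadic_passage_times :: "(real \<Rightarrow> real) \<Rightarrow> real set" where
  "dyadic_passage_times w = {t. \<exists>n k. t = real k / 2 ^ n \<and> w t \<le> 0}"

definition dyadic_passage :: "(real \<Rightarrow> real) \<Rightarrow> real" where
  "dyadic_passage w = Inf (dyadic_passage_times w)"

lemma dyadic_between:
  fixes a b :: real
  assumes "0 \<le> a" "a < b"
  shows "\<exists>n k. a < real k / 2 ^ n \<and> real k / 2 ^ n < b"
proof -
  obtain n where n: "(1/2) ^ n < b - a" using real_arch_pow_inv[of "b - a" "1/2"] assms by auto
  define k where "k = nat \<lfloor>a * 2 ^ n\<rfloor> + 1"
  have "a * 2 ^ n < k" "k \<le> a * 2 ^ n + 1" using assms by (auto simp: k_def) linarith+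
  then have "a < real k / 2 ^ n" "real k / 2 ^ n \<le> a + (1/2) ^ n" by (auto simp: field_simps)
  with n show ?thesis by (intro exI[of _ n] exI[of _ k]) auto
qed

lemma dyadic_passage_times_bdd: "bdd_below (dyadic_passage_times w)"
  unfolding dyadic_passage_times_def by (rule bdd_belowI[of _ 0]) auto

text \<open>The grids are nested, so a dyadic time found once is found by all finer grids.\<close>
lemma grid_passage_tendsto:
  assumes "dyadic_passage_times w \<noteq> {}"
  shows "\<forall>\<^sub>F n in sequentially. \<exists>k. w (real k * (1/2) ^ n) \<le> 0"
    and "(\<lambda>n. first_passage (\<lambda>k. w (real k * (1/2) ^ n)) * (1/2) ^ n) \<longlonglongrightarrow> dyadic_passage w"
proof -
  have early: "\<forall>\<^sub>F n in sequentially. \<exists>k. w (real k * (1/2) ^ n) \<le> 0 \<and> real k * (1/2) ^ n < c"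
    if c: "dyadic_passage w < c" for c
  proof -
    obtain t where "t \<in> dyadic_passage_times w" "t < c"
      using c cInf_less_iff[OF assms dyadic_passage_times_bdd] unfolding dyadic_passage_def by blast
    then obtain m k where mk: "t = real k / 2 ^ m" "w t \<le> 0" unfolding dyadic_passage_times_def by auto
    have "t = real (k * 2 ^ (n - m)) * (1/2) ^ n" if "m \<le> n" for n
    proof -
      have "(2::real) ^ n = 2 ^ (n - m) * 2 ^ m" using that by (simp add: power_add[symmetric])
      then show ?thesis by (simp add: mk(1) power_divide)
    qed
    with mk(2) \<open>t < c\<close> show ?thesis
      unfolding eventually_sequentially by (intro exI[of _ m]) metis
  qed
  show ev: "\<forall>\<^sub>F n in sequentially. \<exists>k. w (real k * (1/2) ^ n) \<le> 0"
    using early[of "dyadic_passage w + 1"] by (auto elim: eventually_mono)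
  show "(\<lambda>n. first_passage (\<lambda>k. w (real k * (1/2) ^ n)) * (1/2) ^ n) \<longlonglongrightarrow> dyadic_passage w"
  proof (rule order_tendstoI)
    fix c assume c: "c < dyadic_passage w"
    show "\<forall>\<^sub>F n in sequentially. c < first_passage (\<lambda>k. w (real k * (1/2) ^ n)) * (1/2) ^ n"
      using ev
    proof eventually_elim
      case (elim n)
      then obtain k where "w (real k * (1/2) ^ n) \<le> 0" by blast
      then have "w (first_passage (\<lambda>k. w (real k * (1/2) ^ n)) * (1/2) ^ n) \<le> 0"
        by (rule first_passageE(1)[of "\<lambda>k. w (real k * (1/2) ^ n)"])
      then have "first_passage (\<lambda>k. w (real k * (1/2) ^ n)) * (1/2) ^ n \<in> dyadic_passage_times w"
        unfolding dyadic_passage_times_def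
        by (intro CollectI exI[of _ n] exI[of _ "first_passage (\<lambda>k. w (real k * (1/2) ^ n))"]) (simp add: power_divide)
      then show ?case using c dyadic_passage_times_bdd unfolding dyadic_passage_def
        by (meson cInf_lower less_le_trans)
    qed
  next
    fix c assume "dyadic_passage w < c"
    from early[OF this] show "\<forall>\<^sub>F n in sequentially. first_passage (\<lambda>k. w (real k * (1/2) ^ n)) * (1/2) ^ n < c"
    proof eventually_elim
      case (elim n)
      then obtain k where k: "w (real k * (1/2) ^ n) \<le> 0" "real k * (1/2) ^ n < c" by blast
      have "first_passage (\<lambda>k. w (real k * (1/2) ^ n)) \<le> k"
        using k(1) by (rule first_passageE(2)[of "\<lambda>k. w (real k * (1/2) ^ n)"])
      then have "first_passage (\<lambda>k. w (real k * (1/2) ^ n)) * (1/2) ^ n \<le> real k * (1/2) ^ n"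
        by (intro mult_right_mono) auto
      then show ?case using k(2) by (rule le_less_trans)
    qed
  qed
qed

text \<open>The grid passages approach the infimum from above and dyadic times are dense before it, so the path is
nonpositive at the infimum and nonnegative up to it.\<close>
lemma dyadic_passage_zero:
  assumes w: "continuous_on {0..} w" "0 < w 0" and D: "dyadic_passage_times w \<noteq> {}"
  shows "0 < dyadic_passage w" "w (dyadic_passage w) = 0" "\<And>t. 0 \<le> t \<Longrightarrow> t \<le> dyadic_passage w \<Longrightarrow> 0 \<le> w t"
proof -
  let ?\<rho> = "dyadic_passage w"
  let ?t = "\<lambda>n. real (first_passage (\<lambda>k. w (real k * (1/2) ^ n))) * (1/2) ^ n"
  have \<rho>0: "0 \<le> ?\<rho>" unfolding dyadic_passage_def
    by (rule cInf_greatest[OF D]) (auto simp: dyadic_passage_times_def)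
  have "(\<lambda>n. w (?t n)) \<longlonglongrightarrow> w ?\<rho>"
    by (rule continuous_on_tendsto_compose[OF w(1) grid_passage_tendsto(2)[OF D]]) (use \<rho>0 in auto)
  moreover have "\<forall>\<^sub>F n in sequentially. w (?t n) \<le> 0"
    using grid_passage_tendsto(1)[OF D]
    by eventually_elim (auto dest: first_passageE(1)[of "\<lambda>k. w (real k * (1/2) ^ n)" for n])
  ultimately have le: "w ?\<rho> \<le> 0" by (intro tendsto_upperbound) auto
  have "?\<rho> \<noteq> 0"
  proof
    assume "?\<rho> = 0"
    then show False using le w(2) by simp
  qed
  with \<rho>0 show \<rho>: "0 < ?\<rho>" by simp
  have less: "0 \<le> w t" if t: "0 \<le> t" "t < ?\<rho>" for t
  proof (rule ccontr)
    assume neg: "\<not> 0 \<le> w t"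
    have "\<exists>d>0. \<forall>s\<in>{0..}. dist s t < d \<longrightarrow> dist (w s) (w t) < - w t"
      using w(1) t(1) neg unfolding continuous_on_iff by simp
    then obtain d where d: "0 < d" "\<And>s. 0 \<le> s \<Longrightarrow> \<bar>s - t\<bar> < d \<Longrightarrow> \<bar>w s - w t\<bar> < - w t"
      unfolding dist_real_def by auto
    obtain n k where nk: "t < real k / 2 ^ n" "real k / 2 ^ n < min (t + d) ?\<rho>"
      using dyadic_between[of t "min (t + d) ?\<rho>"] t d by auto
    then have "w (real k / 2 ^ n) \<le> 0" using d(2)[of "real k / 2 ^ n"] by auto
    then have "real k / 2 ^ n \<in> dyadic_passage_times w" unfolding dyadic_passage_times_def by blast
    then have "?\<rho> \<le> real k / 2 ^ n" unfolding dyadic_passage_def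
      by (intro cInf_lower dyadic_passage_times_bdd)
    with nk show False by simp
  qed
  have "0 \<le> w ?\<rho>"
  proof (rule tendsto_lowerbound)
    show "(\<lambda>n. w (?\<rho> * (1 - (1/2) ^ n))) \<longlonglongrightarrow> w ?\<rho>"
    proof (rule continuous_on_tendsto_compose[OF w(1)])
      have "(\<lambda>n. ?\<rho> * (1 - (1/2) ^ n)) \<longlonglongrightarrow> ?\<rho> * (1 - 0)"
        by (intro tendsto_intros LIMSEQ_realpow_zero) auto
      then show "(\<lambda>n. ?\<rho> * (1 - (1/2) ^ n)) \<longlonglongrightarrow> ?\<rho>" by simp
    qed (use \<rho> in \<open>auto simp: power_le_one\<close>)
    show "\<forall>\<^sub>F n in sequentially. 0 \<le> w (?\<rho> * (1 - (1/2) ^ n))"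
    proof (rule always_eventually, rule allI, rule less)
      fix n :: nat
      show "0 \<le> ?\<rho> * (1 - (1/2) ^ n)" using \<rho> by (simp add: power_le_one)
      show "?\<rho> * (1 - (1/2) ^ n) < ?\<rho>" using \<rho> by (simp add: algebra_simps)
    qed
  qed simp
  with le show zero: "w ?\<rho> = 0" by simp
  show "0 \<le> w t" if "0 \<le> t" "t \<le> ?\<rho>" for t using less[of t] that zero by (cases "t = ?\<rho>") auto
qed

text \<open>The continuous counterpart of \<open>passage_value\<close> for the reward \<open>1\<close>: here the path is exactly \<open>0\<close> at the
passage, so a reward \<open>u\<close> with \<open>u 0 = 1\<close> disappears in the limit.\<close>
definition killed_weight :: "real \<Rightarrow> real \<Rightarrow> (real \<Rightarrow> real) \<Rightarrow> real" where
  "killed_weight p q w = (if dyadic_passage_times w = {} then 0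
     else exp (- integral {0..dyadic_passage w} (\<lambda>t. (p + q * w t) / 2)))"

lemma grid_passage_value_tendsto:
  assumes w: "continuous_on {0..} w" "0 < w 0" and u: "continuous_on UNIV u" "u 0 = 1"
  shows "(\<lambda>n. passage_value (\<lambda>x. (1/2) ^ n * (p + q * x) / 2) u (\<lambda>k. w (real k * (1/2) ^ n)))
    \<longlonglongrightarrow> killed_weight p q w"
proof (cases "dyadic_passage_times w = {}")
  case True
  then have "\<not> w (real k * (1/2) ^ n) \<le> 0" for k n
    unfolding dyadic_passage_times_def by (auto simp: power_divide)
  then have "passage_value (\<lambda>x. (1/2) ^ n * (p + q * x) / 2) u (\<lambda>k. w (real k * (1/2) ^ n)) = 0" for n
    unfolding passage_value_def by metis
  with True show ?thesis by (simp add: killed_weight_def)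
next
  case False
  let ?K = "\<lambda>n. first_passage (\<lambda>k. w (real k * (1/2) ^ n))"
  let ?g = "\<lambda>t. (p + q * w t) / 2"
  note zero = dyadic_passage_zero[OF w False]
  have "(\<lambda>n. (\<Sum>j<?K n. ?g (real j * (1/2) ^ n)) * (1/2) ^ n) \<longlonglongrightarrow> integral {0..dyadic_passage w} ?g"
    by (rule grid_riemann_sum_tendsto[OF _ _ _ grid_passage_tendsto(2)[OF False]])
      (auto intro!: continuous_intros w LIMSEQ_realpow_zero)
  moreover have "(\<lambda>n. w (?K n * (1/2) ^ n)) \<longlonglongrightarrow> w (dyadic_passage w)"
    by (rule continuous_on_tendsto_compose[OF w(1) grid_passage_tendsto(2)[OF False]]) (use zero(1) in auto)
  then have "(\<lambda>n. u (w (?K n * (1/2) ^ n))) \<longlonglongrightarrow> u (w (dyadic_passage w))"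
    by (rule continuous_on_tendsto_compose[OF u(1)]) auto
  ultimately have "(\<lambda>n. exp (- ((\<Sum>j<?K n. ?g (real j * (1/2) ^ n)) * (1/2) ^ n)) * u (w (?K n * (1/2) ^ n)))
      \<longlonglongrightarrow> exp (- integral {0..dyadic_passage w} ?g) * u (w (dyadic_passage w))"
    by (intro tendsto_intros)
  then have lim: "(\<lambda>n. exp (- ((\<Sum>j<?K n. ?g (real j * (1/2) ^ n)) * (1/2) ^ n)) * u (w (?K n * (1/2) ^ n)))
      \<longlonglongrightarrow> killed_weight p q w"
    using False zero(2) u(2) by (simp add: killed_weight_def)
  have sum_eq: "(\<Sum>j<m. ?g (real j * (1/2) ^ n)) * (1/2) ^ n =
      (\<Sum>j<m. (1/2) ^ n * (p + q * w (real j * (1/2) ^ n)) / 2)" for m n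
    unfolding sum_distrib_right by (intro sum.cong) auto
  show ?thesis
  proof (rule Lim_transform_eventually[OF lim])
    show "\<forall>\<^sub>F n in sequentially. exp (- ((\<Sum>j<?K n. ?g (real j * (1/2) ^ n)) * (1/2) ^ n)) * u (w (?K n * (1/2) ^ n))
      = passage_value (\<lambda>x. (1/2) ^ n * (p + q * x) / 2) u (\<lambda>k. w (real k * (1/2) ^ n))"
      using grid_passage_tendsto(1)[OF False]
      by eventually_elim (simp add: passage_value_def sum_eq)
  qed
qed

section \<open>The Laplace transform of the Brownian passage\<close>

text \<open>Fubini's theorem for the joint distribution. The two components of an independent pair share one
type, so the real variable appears as a function of \<open>W\<close>.\<close>
lemma (in prob_space) expectation_indep_density:
  fixes h :: "'c \<times> real \<Rightarrow> real" and g :: "'c \<Rightarrow> real"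
  assumes ind: "indep_var S U T W" and g: "g \<in> borel_measurable T"
    and V: "distributed M lborel (\<lambda>\<omega>. g (W \<omega>)) f"
    and f: "f \<in> borel_measurable lborel" "\<And>s. 0 \<le> f s"
    and h: "h \<in> borel_measurable (S \<Otimes>\<^sub>M borel)" "\<And>z. \<bar>h z\<bar> \<le> C"
  shows "expectation (\<lambda>\<omega>. h (U \<omega>, g (W \<omega>))) = expectation (\<lambda>\<omega>. \<integral>s. f s * h (U \<omega>, s) \<partial>lborel)"
proof -
  have U [measurable]: "U \<in> measurable M S" and W [measurable]: "W \<in> measurable M T"
    using ind indep_var_rv1 indep_var_rv2 by blast+
  note [measurable] = h(1) f(1) g
  interpret DU: prob_space "distr M S U" by (rule prob_space_distr) simp
  interpret DW: prob_space "distr M T W" by (rule prob_space_distr) simp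
  interpret P: pair_prob_space "distr M S U" "distr M T W" ..
  have dV: "distr M borel (\<lambda>\<omega>. g (W \<omega>)) = density lborel f"
    using V unfolding distributed_def by (simp cong: distr_cong)
  have "expectation (\<lambda>\<omega>. h (U \<omega>, g (W \<omega>))) =
      (\<integral>z. h (fst z, g (snd z)) \<partial>distr M (S \<Otimes>\<^sub>M T) (\<lambda>\<omega>. (U \<omega>, W \<omega>)))"
    by (subst integral_distr) auto
  also have "\<dots> = (\<integral>z. h (fst z, g (snd z)) \<partial>(distr M S U \<Otimes>\<^sub>M distr M T W))"
    using ind by (simp add: indep_var_distribution_eq)
  also have "\<dots> = (\<integral>x. (\<integral>y. h (x, g y) \<partial>distr M T W) \<partial>distr M S U)"
    using h(2) by (subst P.integral_fst'[symmetric]) (auto intro!: P.integrable_const_bound[of _ C])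
  also have "\<dots> = (\<integral>x. (\<integral>s. f s * h (x, s) \<partial>lborel) \<partial>distr M S U)"
  proof (rule Bochner_Integration.integral_cong[OF refl])
    fix x assume "x \<in> space (distr M S U)"
    then have [measurable]: "(\<lambda>s. h (x, s)) \<in> borel_measurable borel" by simp
    have "(\<integral>y. h (x, g y) \<partial>distr M T W) = (\<integral>s. h (x, s) \<partial>distr M borel (\<lambda>\<omega>. g (W \<omega>)))"
      by (simp add: integral_distr)
    also have "\<dots> = (\<integral>s. f s * h (x, s) \<partial>lborel)"
      unfolding dV by (subst integral_density) (auto simp: f)
    finally show "(\<integral>y. h (x, g y) \<partial>distr M T W) = (\<integral>s. f s * h (x, s) \<partial>lborel)" .
  qed
  also have "\<dots> = expectation (\<lambda>\<omega>. \<integral>s. f s * h (U \<omega>, s) \<partial>lborel)"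
    by (subst integral_distr) auto
  finally show ?thesis .
qed

text \<open>The definition of Brownian motion unpacked, so that its clauses can be used as rules.\<close>
locale brownian_motion = prob_space N for N :: "'b measure" +
  fixes B :: "real \<Rightarrow> 'b \<Rightarrow> real"
  assumes measurable_at: "0 \<le> t \<Longrightarrow> B t \<in> borel_measurable N"
    and start: "\<omega> \<in> space N \<Longrightarrow> B 0 \<omega> = 0"
    and cont: "\<omega> \<in> space N \<Longrightarrow> continuous_on {0..} (\<lambda>t. B t \<omega>)"
    and increment: "0 \<le> s \<Longrightarrow> s < t \<Longrightarrow>
      distributed N lborel (\<lambda>\<omega>. B t \<omega> - B s \<omega>) (normal_density 0 (sqrt (t - s)))"
    and indep_increments: "0 \<le> r 0 \<Longrightarrow> (\<And>i. i < n \<Longrightarrow> r i \<le> r (Suc i)) \<Longrightarrow>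
      indep_vars (\<lambda>_. borel) (\<lambda>i \<omega>. B (r (Suc i)) \<omega> - B (r i) \<omega>) {..<n::nat}"

lemma standard_brownian_motion_locale: "standard_brownian_motion N B \<Longrightarrow> brownian_motion N B"
  unfolding standard_brownian_motion_def brownian_motion_def brownian_motion_axioms_def by blast

context brownian_motion
begin

text \<open>All positions up to time \<open>k\<close> on the grid are functions of the first \<open>k\<close> increments, and the next
increment is independent of these.\<close>
lemma grid_markov:
  assumes \<delta>: "0 < \<delta>" and [measurable]: "c \<in> borel_measurable borel" "u \<in> borel_measurable borel"
    and c: "\<And>x. 0 < x \<Longrightarrow> 0 \<le> c x" and u: "\<And>x. \<bar>u x\<bar> \<le> L"
  shows "expectation (\<lambda>\<omega>. survival_weight c (\<lambda>k. x + B (real k * \<delta>) \<omega>) (Suc k) * u (x + B (real (Suc k) * \<delta>) \<omega>))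
    = expectation (\<lambda>\<omega>. survival_weight c (\<lambda>k. x + B (real k * \<delta>) \<omega>) (Suc k) *
        (\<integral>s. normal_density 0 (sqrt \<delta>) s * u (x + B (real k * \<delta>) \<omega> + s) \<partial>lborel))"
proof -
  define \<xi> where "\<xi> i \<omega> = B (real (Suc i) * \<delta>) \<omega> - B (real i * \<delta>) \<omega>" for i \<omega>
  define U where "U \<omega> = restrict (\<lambda>i. \<xi> i \<omega>) {..<k}" for \<omega>
  define pos where "pos y j = x + (\<Sum>i<j. y i)" for y :: "nat \<Rightarrow> real" and j
  let ?S = "PiM {..<k} (\<lambda>_. borel :: real measure)"
  have "indep_vars (\<lambda>_. borel) \<xi> {..<Suc k}"
    unfolding \<xi>_def using \<delta> by (intro indep_increments) auto
  then have ind: "indep_var ?S U (PiM {k} (\<lambda>_. borel)) (\<lambda>\<omega>. restrict (\<lambda>i. \<xi> i \<omega>) {k})"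
    unfolding U_def by (rule indep_var_restrict) auto
  have "distributed N lborel (\<xi> k) (normal_density 0 (sqrt (real (Suc k) * \<delta> - real k * \<delta>)))"
    unfolding \<xi>_def using \<delta> by (intro increment) (auto simp: algebra_simps)
  then have dist: "distributed N lborel (\<lambda>\<omega>. restrict (\<lambda>i. \<xi> i \<omega>) {k} k) (normal_density 0 (sqrt \<delta>))"
    by (simp add: algebra_simps)
  have pos_U: "pos (U \<omega>) j = x + B (real j * \<delta>) \<omega>" if "j \<le> k" "\<omega> \<in> space N" for j \<omega>
  proof -
    have "(\<Sum>i<j. U \<omega> i) = (\<Sum>i<j. \<xi> i \<omega>)" using that by (intro sum.cong) (auto simp: U_def)
    also have "\<dots> = B (real j * \<delta>) \<omega> - B (real 0 * \<delta>) \<omega>"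
      unfolding \<xi>_def by (rule sum_lessThan_telescope)
    finally show ?thesis using start[OF that(2)] by (simp add: pos_def)
  qed
  have sw: "survival_weight c (\<lambda>k. x + B (real k * \<delta>) \<omega>) (Suc k) = survival_weight c (pos (U \<omega>)) (Suc k)"
    if "\<omega> \<in> space N" for \<omega>
    unfolding survival_weight_def using that pos_U by (auto simp: less_Suc_eq_le intro!: sum.cong)
  have [measurable]: "(\<lambda>y. pos y j) \<in> borel_measurable ?S" if "j \<le> k" for j
    unfolding pos_def using that by (intro borel_measurable_add borel_measurable_sum measurable_component_singleton) auto
  have sw_meas [measurable]: "(\<lambda>y. survival_weight c (pos y) (Suc k)) \<in> borel_measurable ?S"
  proof -
    have "(\<lambda>y. survival_weight c (\<lambda>j. pos y (min j k)) (Suc k)) \<in> borel_measurable ?S"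
      by (rule measurable_survival_weight) auto
    also have "(\<lambda>y. survival_weight c (\<lambda>j. pos y (min j k)) (Suc k)) = (\<lambda>y. survival_weight c (pos y) (Suc k))"
      unfolding survival_weight_def by (auto simp: less_Suc_eq_le min_absorb1 intro!: ext sum.cong)
    finally show ?thesis .
  qed
  define h where "h z = survival_weight c (pos (fst z)) (Suc k) * u (pos (fst z) k + snd z)" for z
  have h_meas: "h \<in> borel_measurable (?S \<Otimes>\<^sub>M borel)"
    unfolding h_def by measurable
  have h_bound: "\<bar>h z\<bar> \<le> 1 * L" for z
    unfolding h_def abs_mult using u survival_weight_bound[of 0 c "pos (fst z)" "Suc k"] c
    by (intro mult_mono) auto
  have "expectation (\<lambda>\<omega>. survival_weight c (\<lambda>k. x + B (real k * \<delta>) \<omega>) (Suc k) * u (x + B (real (Suc k) * \<delta>) \<omega>))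
      = expectation (\<lambda>\<omega>. h (U \<omega>, restrict (\<lambda>i. \<xi> i \<omega>) {k} k))"
  proof (rule Bochner_Integration.integral_cong[OF refl])
    fix \<omega> assume \<omega>: "\<omega> \<in> space N"
    show "survival_weight c (\<lambda>k. x + B (real k * \<delta>) \<omega>) (Suc k) * u (x + B (real (Suc k) * \<delta>) \<omega>) = h (U \<omega>, restrict (\<lambda>i. \<xi> i \<omega>) {k} k)"
      unfolding sw[OF \<omega>] h_def fst_conv snd_conv pos_U[OF order_refl \<omega>] by (simp add: \<xi>_def)
  qed
  also have "\<dots> = expectation (\<lambda>\<omega>. \<integral>s. normal_density 0 (sqrt \<delta>) s * h (U \<omega>, s) \<partial>lborel)"
    by (rule expectation_indep_density[OF ind _ dist _ _ h_meas h_bound]) auto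
  also have "\<dots> = expectation (\<lambda>\<omega>. survival_weight c (\<lambda>k. x + B (real k * \<delta>) \<omega>) (Suc k) *
        (\<integral>s. normal_density 0 (sqrt \<delta>) s * u (x + B (real k * \<delta>) \<omega> + s) \<partial>lborel))"
  proof (rule Bochner_Integration.integral_cong[OF refl])
    fix \<omega> assume \<omega>: "\<omega> \<in> space N"
    show "(\<integral>s. normal_density 0 (sqrt \<delta>) s * h (U \<omega>, s) \<partial>lborel) =
      survival_weight c (\<lambda>k. x + B (real k * \<delta>) \<omega>) (Suc k) *
        (\<integral>s. normal_density 0 (sqrt \<delta>) s * u (x + B (real k * \<delta>) \<omega> + s) \<partial>lborel)"
      unfolding sw[OF \<omega>] h_def fst_conv snd_conv pos_U[OF order_refl \<omega>]
      by (simp add: mult.left_commute[of "normal_density 0 (sqrt \<delta>) _"])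
  qed
  finally show ?thesis .
qed

lemma cont_shift: "\<omega> \<in> space N \<Longrightarrow> continuous_on {0..} (\<lambda>t. x + B t \<omega>)"
  by (intro continuous_intros cont)

text \<open>Along the grid of mesh \<open>(1/2) ^ n\<close> the error is of order \<open>sqrt ((1/2) ^ n)\<close>, and the discounted rewards
converge boundedly for every path.\<close>
lemma killed_weight_expectation:
  assumes sol: "decaying_solution p q u u1" and p: "0 < p" and q: "0 \<le> q" and x: "0 < x"
  shows "integrable N (\<lambda>\<omega>. killed_weight p q (\<lambda>t. x + B t \<omega>))"
    and "expectation (\<lambda>\<omega>. killed_weight p q (\<lambda>t. x + B t \<omega>)) = u x"
proof -
  obtain v L where v: "smooth_extension p q v L" "\<And>x. 0 \<le> x \<Longrightarrow> v x = u x"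
    using smooth_extension_exists[OF sol p q] by blast
  have vc: "continuous_on UNIV v" "v 0 = 1" and vL: "\<And>x. \<bar>v x\<bar> \<le> L"
    using v(1) unfolding smooth_extension_def by auto
  have L: "0 \<le> L" using vL[of 0] by simp
  have [measurable]: "v \<in> borel_measurable borel" by (rule borel_measurable_continuous_onI) fact
  define d :: "nat \<Rightarrow> real" where "d n = (1/2) ^ n" for n
  have d: "0 < d n" "d n \<le> 1" for n by (auto simp: d_def power_le_one)
  have [measurable]: "B (real k * d n) \<in> borel_measurable N" for k n
    using d(1)[of n] by (intro measurable_at) auto
  let ?V = "\<lambda>n \<omega>. passage_value (\<lambda>x. d n * (p + q * x) / 2) v (\<lambda>k. x + B (real k * d n) \<omega>)"
  have V_meas: "?V n \<in> borel_measurable N" for n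
  proof (rule measurable_passage_value)
    show "d n * p / 2 \<le> d n * (p + q * y) / 2" if "0 < y" for y
      using that q d(1)[of n] by simp
  qed (use vL p d in auto)
  have V_bound: "\<bar>?V n \<omega>\<bar> \<le> L" for n \<omega>
    using vL p q d(1)[of n] by (intro passage_value_bound) auto
  have V_lim: "(\<lambda>n. ?V n \<omega>) \<longlonglongrightarrow> killed_weight p q (\<lambda>t. x + B t \<omega>)" if "\<omega> \<in> space N" for \<omega>
    using grid_passage_value_tendsto[OF cont_shift[OF that, of x] _ vc, of p q] x start[OF that] by (simp add: d_def)
  have W_meas: "(\<lambda>\<omega>. killed_weight p q (\<lambda>t. x + B t \<omega>)) \<in> borel_measurable N"
    by (rule borel_measurable_LIMSEQ_real[OF V_lim V_meas])
  have lim: "(\<lambda>n. expectation (?V n)) \<longlonglongrightarrow> expectation (\<lambda>\<omega>. killed_weight p q (\<lambda>t. x + B t \<omega>))"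
  proof (rule integral_dominated_convergence[where w = "\<lambda>_. L", OF W_meas V_meas])
    show "AE \<omega> in N. (\<lambda>n. ?V n \<omega>) \<longlonglongrightarrow> killed_weight p q (\<lambda>t. x + B t \<omega>)" using V_lim by (rule AE_I2)
    show "AE \<omega> in N. norm (?V n \<omega>) \<le> L" for n unfolding real_norm_def using V_bound by (rule AE_I2)
  qed simp
  show "integrable N (\<lambda>\<omega>. killed_weight p q (\<lambda>t. x + B t \<omega>))"
  proof (rule integrable_dominated_convergence[where w = "\<lambda>_. L" and s = ?V, OF W_meas V_meas])
    show "AE \<omega> in N. (\<lambda>n. ?V n \<omega>) \<longlonglongrightarrow> killed_weight p q (\<lambda>t. x + B t \<omega>)" using V_lim by (rule AE_I2)
    show "AE \<omega> in N. norm (?V n \<omega>) \<le> L" for n unfolding real_norm_def using V_bound by (rule AE_I2)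
  qed simp
  have "\<bar>expectation (?V n) - v x\<bar> \<le> 2 * (2 * L + L) * (1 + p) / p * sqrt (d n)" for n
  proof (rule passage_value_expectation[OF v(1) p q])
    let ?P = "\<lambda>y. \<integral>s. normal_density 0 (sqrt (d n)) s * v (y + s) \<partial>lborel"
    show "?P \<in> borel_measurable borel" by measurable
    show "\<bar>?P y\<bar> \<le> L" for y
    proof -
      have "\<bar>?P y\<bar> \<le> (\<integral>s. \<bar>normal_density 0 (sqrt (d n)) s * v (y + s)\<bar> \<partial>lborel)" by (rule integral_abs_bound)
      also have "\<dots> \<le> (\<integral>s. normal_density 0 (sqrt (d n)) s * L \<partial>lborel)"
      proof (rule integral_mono')
        show "integrable lborel (\<lambda>s. normal_density 0 (sqrt (d n)) s * L)" using d by auto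
      qed (use vL L in \<open>auto simp: abs_mult intro!: mult_left_mono\<close>)
      also have "\<dots> = L" using d(1)[of n] by simp
      finally show ?thesis .
    qed
    show "x + B (real 0 * d n) \<omega> = x" if "\<omega> \<in> space N" for \<omega> using start[OF that] by simp
    show "expectation (\<lambda>\<omega>. survival_weight (\<lambda>x. d n * (p + q * x) / 2) (\<lambda>k. x + B (real k * d n) \<omega>) (Suc k) * v (x + B (real (Suc k) * d n) \<omega>))
      = expectation (\<lambda>\<omega>. survival_weight (\<lambda>x. d n * (p + q * x) / 2) (\<lambda>k. x + B (real k * d n) \<omega>) (Suc k) * ?P (x + B (real k * d n) \<omega>))" for k
    proof (rule grid_markov[where u = v and \<delta> = "d n" and L = L, OF d(1)])
      show "0 \<le> d n * (p + q * y) / 2" if "0 < y" for y using that p q d(1)[of n] by simp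
    qed (use vL in auto)
    show "\<bar>?P y - (1 + d n * (p + q * y) / 2) * v y\<bar> \<le> 2 * L * (d n * sqrt (d n))" if "0 < y" for y
      using gaussian_step_generator[OF v(1) that d(1)] .
  qed (use d in auto)
  then have bound: "\<forall>\<^sub>F n in sequentially. norm (expectation (?V n) - v x) \<le> 2 * (2 * L + L) * (1 + p) / p * sqrt (d n)"
    unfolding real_norm_def by (intro always_eventually allI)
  have "(\<lambda>n. 2 * (2 * L + L) * (1 + p) / p * sqrt (d n)) \<longlonglongrightarrow> 0"
  proof -
    have "d \<longlonglongrightarrow> 0" unfolding d_def by (rule LIMSEQ_realpow_zero) auto
    then have "(\<lambda>n. 2 * (2 * L + L) * (1 + p) / p * sqrt (d n)) \<longlonglongrightarrow> 2 * (2 * L + L) * (1 + p) / p * sqrt 0"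
      by (intro tendsto_mult tendsto_const tendsto_real_sqrt)
    then show ?thesis by simp
  qed
  then have "(\<lambda>n. expectation (?V n) - v x) \<longlonglongrightarrow> 0" by (rule Lim_null_comparison[OF bound])
  then have "(\<lambda>n. expectation (?V n)) \<longlonglongrightarrow> v x" by (simp add: LIM_zero_iff)
  with lim have "expectation (\<lambda>\<omega>. killed_weight p q (\<lambda>t. x + B t \<omega>)) = v x" by (rule LIMSEQ_unique)
  then show "expectation (\<lambda>\<omega>. killed_weight p q (\<lambda>t. x + B t \<omega>)) = u x" using v(2) x by simp
qed

lemma killed_weight_zero_slope:
  "killed_weight p 0 w = (if dyadic_passage_times w = {} then 0 else exp (- (p / 2 * dyadic_passage w)))"
proof -
  have "0 \<le> dyadic_passage w" if "dyadic_passage_times w \<noteq> {}"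
    unfolding dyadic_passage_def by (rule cInf_greatest[OF that]) (auto simp: dyadic_passage_times_def)
  then show ?thesis by (auto simp: killed_weight_def)
qed

text \<open>For \<open>q = 0\<close> the solution is \<open>exp (- sqrt p x)\<close>. The transform is at most the probability of a passage
and tends to \<open>1\<close> with \<open>p\<close> tending to \<open>0\<close>.\<close>
lemma dyadic_passage_finite: "AE \<omega> in N. dyadic_passage_times (\<lambda>t. 1 + B t \<omega>) \<noteq> {}"
proof -
  let ?D = "\<lambda>\<omega>. dyadic_passage_times (\<lambda>t. 1 + B t \<omega>)"
  have [measurable]: "B (real k / 2 ^ n) \<in> borel_measurable N" for k n by (intro measurable_at) auto
  have D_eq: "?D \<omega> \<noteq> {} \<longleftrightarrow> (\<exists>n k. 1 + B (real k / 2 ^ n) \<omega> \<le> 0)" for \<omega>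
    unfolding dyadic_passage_times_def by auto
  have meas [measurable]: "Measurable.pred N (\<lambda>\<omega>. ?D \<omega> \<noteq> {})" unfolding D_eq by measurable
  have "1 - sqrt p \<le> prob {\<omega> \<in> space N. ?D \<omega> \<noteq> {}}" if p: "0 < p" for p
  proof -
    have "1 - sqrt p \<le> exp (- sqrt p)" using exp_ge_add_one_self[of "- sqrt p"] by simp
    also have "\<dots> = expectation (\<lambda>\<omega>. killed_weight p 0 (\<lambda>t. 1 + B t \<omega>))"
      using killed_weight_expectation(2)[OF decaying_solution_exp, of p 1] p by simp
    also have "\<dots> \<le> expectation (\<lambda>\<omega>. indicator {\<omega> \<in> space N. ?D \<omega> \<noteq> {}} \<omega>)"
    proof (rule integral_mono)
      show "integrable N (\<lambda>\<omega>. killed_weight p 0 (\<lambda>t. 1 + B t \<omega>))"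
        using killed_weight_expectation(1)[OF decaying_solution_exp, of p 1] p by simp
      show "integrable N (\<lambda>\<omega>. indicator {\<omega> \<in> space N. ?D \<omega> \<noteq> {}} \<omega> :: real)"
        by (rule integrable_real_indicator) (auto simp: emeasure_eq_measure)
      fix \<omega> assume "\<omega> \<in> space N"
      have "0 \<le> dyadic_passage w" if "dyadic_passage_times w \<noteq> {}" for w
        unfolding dyadic_passage_def by (rule cInf_greatest[OF that]) (auto simp: dyadic_passage_times_def)
      then show "killed_weight p 0 (\<lambda>t. 1 + B t \<omega>) \<le> indicator {\<omega> \<in> space N. ?D \<omega> \<noteq> {}} \<omega>"
        using p \<open>\<omega> \<in> space N\<close> by (auto simp: killed_weight_zero_slope)
    qed
    finally show ?thesis by (simp add: meas)
  qed
  note lower = this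
  have "1 \<le> prob {\<omega> \<in> space N. ?D \<omega> \<noteq> {}} + e" if "0 < e" for e
    using lower[of "e\<^sup>2"] that by simp
  then have "1 \<le> prob {\<omega> \<in> space N. ?D \<omega> \<noteq> {}}" by (rule field_le_epsilon)
  then have "prob {\<omega> \<in> space N. ?D \<omega> \<noteq> {}} = 1" by (intro antisym prob_le_1)
  then show ?thesis by (subst (asm) prob_Collect_eq_1) auto
qed

text \<open>At its first zero the path started from \<open>x\<close> lies strictly below \<open>0\<close> when it is shifted down to a
starting point \<open>y < x\<close>, hence so it does at all nearby dyadic times.\<close>
lemma passage_time_sandwich:
  assumes \<omega>: "\<omega> \<in> space N" and Z: "0 \<le> t" "x + B t \<omega> = 0" and x: "0 < x"
  defines "\<sigma> \<equiv> Inf {t. 0 \<le> t \<and> x + B t \<omega> = 0}"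
  shows "0 \<le> \<sigma>" "x + B \<sigma> \<omega> = 0"
    and "y < x \<Longrightarrow> dyadic_passage_times (\<lambda>t. y + B t \<omega>) \<noteq> {} \<and> dyadic_passage (\<lambda>t. y + B t \<omega>) \<le> \<sigma>"
proof -
  let ?Z = "{t. 0 \<le> t \<and> x + B t \<omega> = 0}"
  have "closed ({0..} \<inter> (\<lambda>t. x + B t \<omega>) -` {0})"
    by (rule continuous_closed_preimage[OF cont_shift[OF \<omega>]]) auto
  moreover have "{0..} \<inter> (\<lambda>t. x + B t \<omega>) -` {0} = ?Z" by blast
  ultimately have "closed ?Z" by (simp only:)
  moreover have "?Z \<noteq> {}" using Z by blast
  moreover have "bdd_below ?Z" by (rule bdd_belowI[of _ 0]) simp
  ultimately have \<sigma>_mem: "\<sigma> \<in> ?Z" unfolding \<sigma>_def by (intro closed_contains_Inf)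
  show \<sigma>: "0 \<le> \<sigma>" "x + B \<sigma> \<omega> = 0" using \<sigma>_mem by simp_all
  show "dyadic_passage_times (\<lambda>t. y + B t \<omega>) \<noteq> {} \<and> dyadic_passage (\<lambda>t. y + B t \<omega>) \<le> \<sigma>" if y: "y < x"
  proof -
    have "\<sigma> \<in> {0..}" "0 < x - y" using y \<sigma>(1) by (simp_all only: atLeast_iff diff_gt_0_iff_gt)
    then obtain d where d: "0 < d" "\<And>s. s \<in> {0..} \<Longrightarrow> dist s \<sigma> \<le> d \<Longrightarrow> dist (B s \<omega>) (B \<sigma> \<omega>) < x - y"
      by (rule continuous_onE[OF cont[OF \<omega>]]) (rule that)
    have near: "\<exists>t\<in>dyadic_passage_times (\<lambda>t. y + B t \<omega>). t < \<sigma> + e" if e: "0 < e" for e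
    proof -
      obtain n k where nk: "\<sigma> < real k / 2 ^ n" "real k / 2 ^ n < \<sigma> + min d e"
      proof -
        have "\<sigma> < \<sigma> + min d e" using d(1) e by simp
        from dyadic_between[OF \<sigma>(1) this] show ?thesis using that by blast
      qed
      define s where "s = real k / 2 ^ n"
      have "dist s \<sigma> \<le> d" "s \<in> {0..}"
        using nk \<sigma>(1) unfolding s_def[symmetric] dist_real_def by auto
      then have "dist (B s \<omega>) (B \<sigma> \<omega>) < x - y" by (intro d(2))
      then have "\<bar>B s \<omega> - B \<sigma> \<omega>\<bar> < x - y" unfolding dist_real_def .
      then have "y + B s \<omega> \<le> 0" using \<sigma>(2) by linarith
      then have "s \<in> dyadic_passage_times (\<lambda>t. y + B t \<omega>)"
        unfolding dyadic_passage_times_def s_def by blast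
      moreover have "s < \<sigma> + e" using nk unfolding s_def[symmetric] by linarith
      ultimately show ?thesis by (rule bexI[rotated])
    qed
    have "dyadic_passage (\<lambda>t. y + B t \<omega>) \<le> \<sigma> + e" if e: "0 < e" for e
    proof -
      obtain s where s: "s \<in> dyadic_passage_times (\<lambda>t. y + B t \<omega>)" "s < \<sigma> + e" 
        using near[OF e] by (elim bexE) (rule that)
      have "dyadic_passage (\<lambda>t. y + B t \<omega>) \<le> s"
        unfolding dyadic_passage_def by (rule cInf_lower[OF s(1) dyadic_passage_times_bdd])
      with s(2) show ?thesis by linarith
    qed
    then have "dyadic_passage (\<lambda>t. y + B t \<omega>) \<le> \<sigma>" by (rule field_le_epsilon)
    moreover have "dyadic_passage_times (\<lambda>t. y + B t \<omega>) \<noteq> {}" 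
      using near[OF zero_less_one] by (elim bexE) (metis empty_iff)
    ultimately show ?thesis by blast
  qed
qed

end

context brownian_motion
begin

text \<open>A continuous path started at \<open>1\<close> vanishes before \<open>t\<close> exactly if it comes arbitrarily close to \<open>0\<close> or
below at rational times before \<open>t\<close>.\<close>
lemma hits_before_measurable:
  assumes "0 \<le> t"
  shows "{\<omega> \<in> space N. \<exists>s. 0 \<le> s \<and> s \<le> t \<and> 1 + B s \<omega> = 0} \<in> sets N"
proof -
  let ?Q = "\<lambda>\<omega>. \<forall>m::nat. \<exists>r::rat. 0 \<le> real_of_rat r \<and> real_of_rat r \<le> t \<and> 1 + B (max 0 (real_of_rat r)) \<omega> < inverse (Suc m)"
  have [measurable]: "B (max 0 (real_of_rat r)) \<in> borel_measurable N" for r by (intro measurable_at) simp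
  have "{\<omega> \<in> space N. ?Q \<omega>} \<in> sets N" by measurable
  also have "{\<omega> \<in> space N. ?Q \<omega>} = {\<omega> \<in> space N. \<exists>s. 0 \<le> s \<and> s \<le> t \<and> 1 + B s \<omega> = 0}"
  proof (intro Collect_cong conj_cong refl iffI)
    fix \<omega> assume \<omega>: "\<omega> \<in> space N" and Q: "?Q \<omega>"
    have c: "continuous_on {0..t} (\<lambda>s. 1 + B s \<omega>)" by (rule continuous_on_subset[OF cont_shift[OF \<omega>]]) auto
    have "compact {0..t}" "{0..t} \<noteq> {}" using assms by auto
    from continuous_attains_inf[OF this c] obtain s
      where s: "s \<in> {0..t}" "\<And>y. y \<in> {0..t} \<Longrightarrow> 1 + B s \<omega> \<le> 1 + B y \<omega>" by blast
    have "1 + B s \<omega> \<le> 0"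
    proof (rule field_le_epsilon)
      fix e :: real assume "0 < e"
      then obtain m where m: "inverse (real (Suc m)) < e" using reals_Archimedean by blast
      obtain r where r: "0 \<le> real_of_rat r" "real_of_rat r \<le> t" "1 + B (max 0 (real_of_rat r)) \<omega> < inverse (Suc m)"
        using Q by blast
      have "1 + B s \<omega> \<le> 1 + B (real_of_rat r) \<omega>" using r(1,2) by (intro s(2)) simp
      moreover have "max 0 (real_of_rat r) = real_of_rat r" using r(1) by (simp only: max_absorb2)
      ultimately show "1 + B s \<omega> \<le> 0 + e" using r(3) m by (simp only:)
    qed
    moreover have "continuous_on {0..s} (\<lambda>s. 1 + B s \<omega>)" using s(1) by (intro continuous_on_subset[OF c]) auto
    ultimately have "\<exists>z\<ge>0. z \<le> s \<and> 1 + B z \<omega> = 0"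
      using s(1) start[OF \<omega>] by (intro IVT2') simp_all
    then obtain z where "0 \<le> z" "z \<le> s" "1 + B z \<omega> = 0" by blast
    then show "\<exists>s. 0 \<le> s \<and> s \<le> t \<and> 1 + B s \<omega> = 0" using s(1) by (intro exI[of _ z]) simp
  next
    fix \<omega> assume \<omega>: "\<omega> \<in> space N" and "\<exists>s. 0 \<le> s \<and> s \<le> t \<and> 1 + B s \<omega> = 0"
    then obtain s where s: "0 \<le> s" "s \<le> t" "1 + B s \<omega> = 0" by blast
    have "s \<noteq> 0" using s(3) start[OF \<omega>] by auto
    with s have s0: "0 < s" by simp
    show "?Q \<omega>"
    proof
      fix m :: nat
      have "s \<in> {0..}" "0 < inverse (real (Suc m))" using s(1) by simp_all
      then obtain d where d: "0 < d" "\<And>y. y \<in> {0..} \<Longrightarrow> dist y s \<le> d \<Longrightarrow> dist (B y \<omega>) (B s \<omega>) < inverse (real (Suc m))"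
        by (rule continuous_onE[OF cont[OF \<omega>]]) (rule that)
      obtain r where r: "max 0 (s - d) < real_of_rat r" "real_of_rat r < s"
        using of_rat_dense[of "max 0 (s - d)" s] s0 d(1) by auto
      have "dist (B (real_of_rat r) \<omega>) (B s \<omega>) < inverse (real (Suc m))"
        using r d(1) by (intro d(2)) (auto simp: dist_real_def)
      then have "1 + B (real_of_rat r) \<omega> < inverse (real (Suc m))" using s(3) unfolding dist_real_def by linarith
      moreover have "0 \<le> real_of_rat r" "real_of_rat r \<le> t" using r s(2) by linarith+
      moreover from this have "max 0 (real_of_rat r) = real_of_rat r" by (simp only: max_absorb2)
      ultimately show "\<exists>r::rat. 0 \<le> real_of_rat r \<and> real_of_rat r \<le> t \<and> 1 + B (max 0 (real_of_rat r)) \<omega> < inverse (Suc m)"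
        by (intro exI[of _ r] conjI) (simp_all only:)
    qed
  qed
  finally show ?thesis .
qed

text \<open>Paths that never hit all receive the same value \<open>Inf {}\<close>, so they only add a measurable set to each
sublevel set.\<close>
lemma hitting_time_measurable: "hitting_time B \<in> borel_measurable N"
proof -
  let ?Z = "\<lambda>\<omega>. {t. 0 \<le> t \<and> 1 + B t \<omega> = 0}"
  let ?A = "\<lambda>t. {\<omega> \<in> space N. \<exists>s. 0 \<le> s \<and> s \<le> t \<and> 1 + B s \<omega> = 0}"
  define E where "E = (\<Union>n::nat. ?A (real n))"
  have E: "E \<in> sets N" unfolding E_def by (intro sets.countable_UN image_subsetI hits_before_measurable of_nat_0_le_iff)
  have E_iff: "\<omega> \<in> E \<longleftrightarrow> \<omega> \<in> space N \<and> ?Z \<omega> \<noteq> {}" for \<omega>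
  proof
    show "\<omega> \<in> space N \<and> ?Z \<omega> \<noteq> {}" if "\<omega> \<in> E" using that unfolding E_def by blast
    assume *: "\<omega> \<in> space N \<and> ?Z \<omega> \<noteq> {}"
    then obtain t where t: "0 \<le> t" "1 + B t \<omega> = 0" by blast
    obtain n :: nat where "t \<le> n" using real_arch_simple by blast
    then have "\<omega> \<in> ?A (real n)" using * t by (intro CollectI conjI exI[of _ t]) (rule conjunct1)
    then show "\<omega> \<in> E" unfolding E_def by (rule UN_I[OF UNIV_I])
  qed
  have A: "?A c \<in> sets N" for c
  proof (cases "0 \<le> c")
    case False
    then have "?A c = {}" by auto
    then show ?thesis by (simp only: sets.empty_sets)
  qed (rule hits_before_measurable)
  have "{\<omega> \<in> space N. hitting_time B \<omega> \<le> c} \<in> sets N" for c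
  proof -
    have on_E: "hitting_time B \<omega> \<le> c \<longleftrightarrow> \<omega> \<in> ?A c" if "\<omega> \<in> E" for \<omega>
    proof
      note mem = iffD1[OF E_iff that]
      from mem have \<omega>: "\<omega> \<in> space N" by (rule conjunct1)
      from mem have "?Z \<omega> \<noteq> {}" by (rule conjunct2)
      then obtain t where t: "0 \<le> t" "1 + B t \<omega> = 0" by blast
      note h = passage_time_sandwich(1,2)[OF \<omega> t zero_less_one, folded hitting_time_def]
      show "\<omega> \<in> ?A c" if "hitting_time B \<omega> \<le> c"
        using that h \<omega> by (intro CollectI conjI exI[of _ "hitting_time B \<omega>"])
      show "hitting_time B \<omega> \<le> c" if in_A: "\<omega> \<in> ?A c"
      proof -
        obtain s where s: "0 \<le> s" "s \<le> c" "1 + B s \<omega> = 0" using in_A by blast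
        have "hitting_time B \<omega> \<le> s" unfolding hitting_time_def
          using s(1,3) by (intro cInf_lower bdd_belowI[of _ 0]) simp_all
        with s(2) show ?thesis by (rule order_trans[rotated])
      qed
    qed
    have off_E: "hitting_time B \<omega> = Inf {}" if "\<omega> \<in> space N - E" for \<omega>
    proof -
      have "?Z \<omega> = {}" using that E_iff by blast
      then show ?thesis unfolding hitting_time_def by (simp only:)
    qed
    have "{\<omega> \<in> space N. hitting_time B \<omega> \<le> c} = (E \<inter> ?A c) \<union> (if Inf {} \<le> c then space N - E else {})"
    proof (rule set_eqI)
      fix \<omega>
      show "\<omega> \<in> {\<omega> \<in> space N. hitting_time B \<omega> \<le> c} \<longleftrightarrow> \<omega> \<in> (E \<inter> ?A c) \<union> (if Inf {} \<le> c then space N - E else {})"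
      proof (cases "\<omega> \<in> E")
        case True
        then show ?thesis using on_E[OF True] E_iff[of \<omega>] by (auto simp only: mem_Collect_eq Un_iff Int_iff Diff_iff empty_iff split: if_splits)
      next
        case False
        then show ?thesis using off_E[of \<omega>] by (auto simp only: mem_Collect_eq Un_iff Int_iff Diff_iff empty_iff split: if_splits)
      qed
    qed
    moreover have "(E \<inter> ?A c) \<union> (if Inf {} \<le> c then space N - E else {}) \<in> sets N"
      using E A[of c] by (cases "Inf {} \<le> c") (simp_all only: if_True if_False sets.Un sets.Int sets.compl_sets sets.empty_sets)
    ultimately show ?thesis by (simp only:)
  qed
  then show ?thesis unfolding borel_measurable_iff_le by (intro allI)
qed

text \<open>The path can only become negative after it has hit \<open>0\<close>, and a path started at \<open>y < 1\<close> becomes negative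
before the path started at \<open>1\<close> hits \<open>0\<close>. With \<open>q = 0\<close> and \<open>p = 1\<close> the transforms of the outer times
are \<open>exp (- 1)\<close> and \<open>exp (- y)\<close>. As \<open>y\<close> tends to \<open>1\<close> they agree, so the ordered variables in between
have equal expectation and coincide almost surely.\<close>
lemma hitting_time_eq_dyadic_passage:
  "AE \<omega> in N. dyadic_passage_times (\<lambda>t. 1 + B t \<omega>) \<noteq> {} \<and> hitting_time B \<omega> = dyadic_passage (\<lambda>t. 1 + B t \<omega>)"
proof -
  let ?w = "\<lambda>\<omega> t. 1 + B t \<omega>"
  \<comment> \<open>The weight of the hitting time itself, counted only if some dyadic grid sees a passage.\<close>
  define H where "H \<omega> = (if dyadic_passage_times (?w \<omega>) = {} then 0 else exp (- (1 / 2 * hitting_time B \<omega>)))" for \<omega>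
  have K_int: "integrable N (\<lambda>\<omega>. killed_weight 1 0 (\<lambda>t. x + B t \<omega>))"
    and K_exp: "expectation (\<lambda>\<omega>. killed_weight 1 0 (\<lambda>t. x + B t \<omega>)) = exp (- x)" if "0 < x" for x
    using killed_weight_expectation[OF decaying_solution_exp[of 1] _ _ that] by simp_all
  have [measurable]: "B (real k / 2 ^ n) \<in> borel_measurable N" for k n by (intro measurable_at) auto
  have D_eq: "dyadic_passage_times (?w \<omega>) = {} \<longleftrightarrow> \<not> (\<exists>n k. 1 + B (real k / 2 ^ n) \<omega> \<le> 0)" for \<omega>
    unfolding dyadic_passage_times_def by auto
  have H_meas [measurable]: "H \<in> borel_measurable N"
    unfolding H_def D_eq using hitting_time_measurable by measurable
  have facts: "killed_weight 1 0 (?w \<omega>) \<le> H \<omega> \<and> H \<omega> \<le> 1 \<and> 0 \<le> H \<omega> \<and> (0 < y \<longrightarrow> y < 1 \<longrightarrow> H \<omega> \<le> killed_weight 1 0 (\<lambda>t. y + B t \<omega>))"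
    if \<omega>: "\<omega> \<in> space N" for \<omega> y
  proof (cases "dyadic_passage_times (?w \<omega>) = {}")
    case True
    then show ?thesis by (simp add: H_def killed_weight_def)
  next
    case False
    note z = dyadic_passage_zero[OF cont_shift[OF \<omega>] _ False]
    have w0: "0 < 1 + B 0 \<omega>" using start[OF \<omega>] by simp
    note zero = z(1,2)[OF w0]
    note h = passage_time_sandwich[OF \<omega> less_imp_le[OF zero(1)] zero(2) zero_less_one]
    have le: "hitting_time B \<omega> \<le> dyadic_passage (?w \<omega>)"
      unfolding hitting_time_def using zero by (intro cInf_lower bdd_belowI[of _ 0]) auto
    have h0: "0 \<le> hitting_time B \<omega>" using h(1) unfolding hitting_time_def .
    have 1: "H \<omega> = exp (- (1 / 2 * hitting_time B \<omega>))" using False by (simp add: H_def)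
    have "H \<omega> \<le> killed_weight 1 0 (\<lambda>t. y + B t \<omega>)" if "y < 1"
      using h(3)[OF that] unfolding 1 killed_weight_zero_slope hitting_time_def by auto
    moreover have "killed_weight 1 0 (?w \<omega>) \<le> H \<omega>" using False le unfolding 1 killed_weight_zero_slope by auto
    ultimately show ?thesis using h0 by (simp add: 1)
  qed
  have H_int: "integrable N H"
    by (rule integrable_const_bound[of _ 1]) (use facts H_meas in auto)
  have "expectation H \<le> exp (- 1)"
  proof (rule tendsto_lowerbound[where F = "at_left (1::real)"])
    show "((\<lambda>y. exp (- y)) \<longlongrightarrow> exp (- 1)) (at_left (1::real))" by (intro tendsto_intros)
    have "\<forall>\<^sub>F y in at_left (1::real). y \<in> {0<..<1}" by (rule eventually_at_left_real) simp
    then show "\<forall>\<^sub>F y in at_left (1::real). expectation H \<le> exp (- y)"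
    proof eventually_elim
      case (elim y)
      then have y: "0 < y" "y < 1" by auto
      have "expectation H \<le> expectation (\<lambda>\<omega>. killed_weight 1 0 (\<lambda>t. y + B t \<omega>))"
        using y facts by (intro integral_mono H_int K_int) auto
      then show ?case using K_exp[OF y(1)] by simp
    qed
  qed simp
  moreover have "exp (- 1) \<le> expectation H"
    unfolding K_exp[OF zero_less_one, symmetric] using facts by (intro integral_mono H_int K_int) auto
  ultimately have "expectation (\<lambda>\<omega>. H \<omega> - killed_weight 1 0 (?w \<omega>)) = 0"
    using H_int K_int[of 1] K_exp[of 1] by simp
  moreover have "AE \<omega> in N. 0 \<le> H \<omega> - killed_weight 1 0 (?w \<omega>)" using facts by auto
  moreover have "integrable N (\<lambda>\<omega>. H \<omega> - killed_weight 1 0 (?w \<omega>))" using H_int K_int[of 1] by simp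
  ultimately have "AE \<omega> in N. H \<omega> - killed_weight 1 0 (?w \<omega>) = 0"
    by (subst (asm) integral_nonneg_eq_0_iff_AE)
  with dyadic_passage_finite show ?thesis
    by eventually_elim (simp add: H_def killed_weight_zero_slope)
qed

text \<open>Continuity of the paths makes the process a pointwise limit of its values at dyadic times.\<close>
lemma joint_measurable: "(\<lambda>(\<omega>, t). B (max 0 t) \<omega>) \<in> borel_measurable (N \<Otimes>\<^sub>M lborel)"
proof (rule borel_measurable_LIMSEQ_real)
  let ?r = "\<lambda>n (t::real). real (nat \<lfloor>max 0 t * 2 ^ n\<rfloor>) / 2 ^ n"
  fix n :: nat
  have [measurable]: "B (real k / 2 ^ n) \<in> borel_measurable N" for k by (intro measurable_at) auto
  have "(\<lambda>z. (\<lambda>k z. B (real k / 2 ^ n) (fst z)) (nat \<lfloor>max 0 (snd z :: real) * 2 ^ n\<rfloor>) z) \<in> borel_measurable (N \<Otimes>\<^sub>M (lborel :: real measure))"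
  proof (rule measurable_compose_countable[where f = "\<lambda>k z. B (real k / 2 ^ n) (fst z)"])
    show "(\<lambda>z. B (real k / 2 ^ n) (fst z)) \<in> borel_measurable (N \<Otimes>\<^sub>M (lborel :: real measure))" for k by measurable
    show "(\<lambda>z. nat \<lfloor>max 0 (snd z :: real) * 2 ^ n\<rfloor>) \<in> N \<Otimes>\<^sub>M lborel \<rightarrow>\<^sub>M count_space UNIV" by measurable
  qed
  then show "(\<lambda>(\<omega>, t). B (?r n t) \<omega>) \<in> borel_measurable (N \<Otimes>\<^sub>M lborel)" unfolding case_prod_unfold .
next
  let ?r = "\<lambda>n (t::real). real (nat \<lfloor>max 0 t * 2 ^ n\<rfloor>) / 2 ^ n"
  fix z assume "z \<in> space (N \<Otimes>\<^sub>M (lborel :: real measure))"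
  then have \<omega>: "fst z \<in> space N" by (auto simp: space_pair_measure)
  have lim: "(\<lambda>n. ?r n t) \<longlonglongrightarrow> max 0 t" for t :: real
  proof (rule tendsto_sandwich)
    have "(\<lambda>n. max 0 t - (1/2) ^ n) \<longlonglongrightarrow> max 0 t - 0" by (intro tendsto_diff tendsto_const LIMSEQ_realpow_zero) auto
    then show "(\<lambda>n. max 0 t - (1/2) ^ n) \<longlonglongrightarrow> max 0 t" by simp
    show "(\<lambda>n. max 0 t) \<longlonglongrightarrow> max 0 t" by simp
    have bounds: "max 0 t - (1/2) ^ n \<le> ?r n t \<and> ?r n t \<le> max 0 t" for n
    proof -
      define m where "m = max 0 t * 2 ^ n"
      have "real (nat \<lfloor>m\<rfloor>) = of_int \<lfloor>m\<rfloor>" unfolding m_def by (simp add: zero_le_mult_iff)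
      then have "m - 1 \<le> real (nat \<lfloor>m\<rfloor>)" "real (nat \<lfloor>m\<rfloor>) \<le> m" by linarith+
      then have "(m - 1) / 2 ^ n \<le> real (nat \<lfloor>m\<rfloor>) / 2 ^ n" "real (nat \<lfloor>m\<rfloor>) / 2 ^ n \<le> m / 2 ^ n"
        by (auto intro!: divide_right_mono)
      moreover have "(m - 1) / 2 ^ n = max 0 t - (1/2) ^ n" "m / 2 ^ n = max 0 t"
        by (simp_all add: m_def diff_divide_distrib power_divide)
      ultimately show ?thesis unfolding m_def by simp
    qed
    show "\<forall>\<^sub>F n in sequentially. max 0 t - (1/2) ^ n \<le> ?r n t" "\<forall>\<^sub>F n in sequentially. ?r n t \<le> max 0 t"
      using bounds by (auto intro: always_eventually)
  qed
  have "(\<lambda>n. B (?r n (snd z)) (fst z)) \<longlonglongrightarrow> B (max 0 (snd z)) (fst z)"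
    by (rule continuous_on_tendsto_compose[OF cont[OF \<omega>] lim]) auto
  then show "(\<lambda>n. (case z of (\<omega>, t) \<Rightarrow> B (?r n t) \<omega>)) \<longlonglongrightarrow> (case z of (\<omega>, t) \<Rightarrow> B (max 0 t) \<omega>)"
    by (simp add: case_prod_unfold)
qed

lemma passage_area_measurable: "(\<lambda>\<omega>. LBINT t:{0..hitting_time B \<omega>}. 1 + B t \<omega>) \<in> borel_measurable N"
proof -
  note [measurable] = hitting_time_measurable joint_measurable
  have "(LBINT t:{0..hitting_time B \<omega>}. 1 + B t \<omega>) =
      (\<integral>t. (if 0 \<le> t \<and> t \<le> hitting_time B \<omega> then 1 + (case (\<omega>, t) of (\<omega>, t) \<Rightarrow> B (max 0 t) \<omega>) else 0) \<partial>lborel)" for \<omega>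
    unfolding set_lebesgue_integral_def
    by (rule Bochner_Integration.integral_cong) (auto simp: indicator_def max_absorb2)
  moreover have "(\<lambda>\<omega>. \<integral>t. (if 0 \<le> t \<and> t \<le> hitting_time B \<omega> then 1 + (case (\<omega>, t) of (\<omega>, t) \<Rightarrow> B (max 0 t) \<omega>) else 0) \<partial>lborel) \<in> borel_measurable N"
    by measurable
  ultimately show ?thesis by simp
qed

lemma passage_laplace:
  assumes sol: "decaying_solution a (b / 2) u u1" and a: "0 < a" and b: "0 \<le> b"
  shows "expectation (\<lambda>\<omega>. exp (- (a * (hitting_time B \<omega> / 2) + b * (1 / 4 * (LBINT t:{0..hitting_time B \<omega>}. 1 + B t \<omega>))))) = u 1"
    and "AE \<omega> in N. 0 \<le> hitting_time B \<omega> \<and> 0 \<le> (LBINT t:{0..hitting_time B \<omega>}. 1 + B t \<omega>)"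
proof -
  let ?w = "\<lambda>\<omega> t. 1 + B t \<omega>"
  let ?A = "\<lambda>\<omega>. LBINT t:{0..hitting_time B \<omega>}. 1 + B t \<omega>"
  let ?f = "\<lambda>\<omega>. exp (- (a * (hitting_time B \<omega> / 2) + b * (1 / 4 * ?A \<omega>)))"
  have ae: "AE \<omega> in N. 0 \<le> hitting_time B \<omega> \<and> 0 \<le> ?A \<omega> \<and>
      killed_weight a (b / 2) (?w \<omega>) =
        ?f \<omega>"
    using hitting_time_eq_dyadic_passage AE_space
  proof eventually_elim
    case (elim \<omega>)
    then have D: "dyadic_passage_times (?w \<omega>) \<noteq> {}" and \<omega>: "\<omega> \<in> space N"
      and eq: "dyadic_passage (?w \<omega>) = hitting_time B \<omega>" by auto
    let ?\<rho> = "hitting_time B \<omega>"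
    have w0: "0 < ?w \<omega> 0" using start[OF \<omega>] by simp
    note zero = dyadic_passage_zero[OF cont_shift[OF \<omega>] w0 D, unfolded eq]
    have c: "continuous_on {0..?\<rho>} (?w \<omega>)" by (rule continuous_on_subset[OF cont_shift[OF \<omega>]]) auto
    have int: "?w \<omega> integrable_on {0..?\<rho>}" by (rule integrable_continuous_real[OF c])
    have "set_integrable lborel {0..?\<rho>} (?w \<omega>)" by (rule borel_integrable_atLeastAtMost') (rule c)
    then have area: "(LBINT t:{0..?\<rho>}. 1 + B t \<omega>) = integral {0..?\<rho>} (?w \<omega>)"
      by (rule set_borel_integral_eq_integral(2))
    have nonneg: "0 \<le> integral {0..?\<rho>} (?w \<omega>)" using zero(3) by (intro Henstock_Kurzweil_Integration.integral_nonneg int) auto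
    have exponent: "integral {0..?\<rho>} (\<lambda>t. (a + b / 2 * ?w \<omega> t) / 2) = a * (?\<rho> / 2) + b * (1 / 4 * integral {0..?\<rho>} (?w \<omega>))"
    proof -
      have "integral {0..?\<rho>} (\<lambda>t. (a + b / 2 * ?w \<omega> t) / 2) = integral {0..?\<rho>} (\<lambda>t. a / 2 + b / 4 * ?w \<omega> t)"
        by (rule arg_cong[where f = "integral _"]) (simp add: fun_eq_iff field_simps)
      also have "\<dots> = integral {0..?\<rho>} (\<lambda>t. a / 2) + integral {0..?\<rho>} (\<lambda>t. b / 4 * ?w \<omega> t)"
        by (rule Henstock_Kurzweil_Integration.integral_add) (intro integrable_continuous_real continuous_intros c)+
      also have "integral {0..?\<rho>} (\<lambda>t. b / 4 * ?w \<omega> t) = b / 4 * integral {0..?\<rho>} (?w \<omega>)"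
        by (rule Henstock_Kurzweil_Integration.integral_mult_right)
      also have "integral {0..?\<rho>} (\<lambda>t. a / 2) = a * (?\<rho> / 2)" using zero(1) by simp
      finally show ?thesis by simp
    qed
    have "killed_weight a (b / 2) (?w \<omega>) = exp (- integral {0..?\<rho>} (\<lambda>t. (a + b / 2 * ?w \<omega> t) / 2))"
      unfolding killed_weight_def eq using D by (simp only: if_False)
    then show ?case using less_imp_le[OF zero(1)] nonneg unfolding area exponent by (intro conjI)
  qed
  then show "AE \<omega> in N. 0 \<le> hitting_time B \<omega> \<and> 0 \<le> ?A \<omega>" by auto
  note [measurable] = hitting_time_measurable passage_area_measurable
  have "expectation ?f
      = expectation (\<lambda>\<omega>. killed_weight a (b / 2) (?w \<omega>))"
    by (rule integral_cong_AE) (use ae killed_weight_expectation(1)[OF sol a] b in auto)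
  also have "\<dots> = u 1" using b by (intro killed_weight_expectation(2)[OF sol a]) auto
  finally show "expectation ?f = u 1" .
qed

end

section \<open>The traffic through a segment as a random walk\<close>

text \<open>The edges of the block of nodes whose paths end between \<open>L\<close> and \<open>U\<close> in column \<open>c\<close>, seen from column
\<open>c + n\<close>. The candidates just outside the block are \<open>upper_edge + 1\<close> and \<open>lower_edge - 1\<close> in the next
column; each of them either joins the block or moves its edge inwards. The recursion is continued
after the edges have met, where it has no meaning for the block.\<close>
primrec upper_edge :: "(int \<times> int \<Rightarrow> bool) \<Rightarrow> int \<Rightarrow> int \<Rightarrow> nat \<Rightarrow> int" where
  "upper_edge \<eta> c U 0 = U"
| "upper_edge \<eta> c U (Suc n) = upper_edge \<eta> c U n +
     (if \<eta> (c + int n + 1, upper_edge \<eta> c U n + 1) then - 1 else 1)"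

primrec lower_edge :: "(int \<times> int \<Rightarrow> bool) \<Rightarrow> int \<Rightarrow> int \<Rightarrow> nat \<Rightarrow> int" where
  "lower_edge \<eta> c L 0 = L"
| "lower_edge \<eta> c L (Suc n) = lower_edge \<eta> c L n +
     (if \<eta> (c + int n + 1, lower_edge \<eta> c L n - 1) then - 1 else 1)"

definition cluster_width :: "(int \<times> int \<Rightarrow> bool) \<Rightarrow> int \<Rightarrow> int \<Rightarrow> int \<Rightarrow> nat \<Rightarrow> int" where
  "cluster_width \<eta> c L U n = (upper_edge \<eta> c U n - lower_edge \<eta> c L n) div 2 + 1"

lemma edge_parity:
  "even (c + int n + upper_edge \<eta> c U n) \<longleftrightarrow> even (c + U)"
  "even (c + int n + lower_edge \<eta> c L n) \<longleftrightarrow> even (c + L)"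
  by (induction n) (auto simp: algebra_simps)

lemma edge_range:
  "\<bar>upper_edge \<eta> c U n - U\<bar> \<le> int n" "\<bar>lower_edge \<eta> c L n - L\<bar> \<le> int n"
  by (induction n) auto

lemma edge_cong:
  assumes "\<And>i. i < n \<Longrightarrow> \<eta> (c + int i + 1, upper_edge \<eta> c U i + 1) = \<eta>' (c + int i + 1, upper_edge \<eta> c U i + 1)"
  shows "upper_edge \<eta>' c U n = upper_edge \<eta> c U n"
  using assms by (induction n) auto

lemma lower_edge_cong:
  assumes "\<And>i. i < n \<Longrightarrow> \<eta> (c + int i + 1, lower_edge \<eta> c L i - 1) = \<eta>' (c + int i + 1, lower_edge \<eta> c L i - 1)"
  shows "lower_edge \<eta>' c L n = lower_edge \<eta> c L n"
  using assms by (induction n) auto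

lemma path_at_fst: "fst (path_at \<eta> y n) = fst y - int n"
  by (induction n) (auto simp: path_at_def step_def)

lemma path_at_Suc: "path_at \<eta> y (Suc n) = path_at \<eta> (step \<eta> y) n"
  by (simp add: path_at_def funpow_swap1)

lemma step_even_lattice: "y \<in> even_lattice \<Longrightarrow> step \<eta> y \<in> even_lattice"
  by (auto simp: even_lattice_def step_def split: if_splits)

lemma path_at_even_lattice: "y \<in> even_lattice \<Longrightarrow> path_at \<eta> y n \<in> even_lattice"
  by (induction n) (auto simp: path_at_def step_even_lattice)

lemma path_length: "card (path_at \<eta> y ` {..n}) = Suc n"
proof -
  have "inj_on (path_at \<eta> y) {..n}"
  proof (rule inj_onI)
    fix i j assume "path_at \<eta> y i = path_at \<eta> y j"
    then have "fst y - int i = fst y - int j" by (metis path_at_fst)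
    then show "i = j" by simp
  qed
  then show ?thesis by (simp add: card_image)
qed

text \<open>Nodes of the next column lie between those of the present one. Those strictly inside the block have
both possible targets in it, the two candidates outside have one, and all others have none. An empty
block stays empty.\<close>
lemma path_lands_between_iff:
  assumes "even (c + L)" "even (c + U)" "y \<in> even_lattice" "fst y = c + int n"
  shows "L \<le> snd (path_at \<eta> y n) \<and> snd (path_at \<eta> y n) \<le> U \<longleftrightarrow>
    (\<forall>j<n. lower_edge \<eta> c L j \<le> upper_edge \<eta> c U j) \<and> lower_edge \<eta> c L n \<le> snd y \<and> snd y \<le> upper_edge \<eta> c U n"
  using assms(3,4)
proof (induction n arbitrary: y)
  case 0
  then show ?case by (simp add: path_at_def)
next
  case (Suc n)
  let ?u = "upper_edge \<eta> c U n" and ?l = "lower_edge \<eta> c L n"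
  obtain h where y: "y = (c + int n + 1, h)" using Suc.prems(2) by (cases y) auto
  have hpar: "even (c + int n + 1 + h)" using Suc.prems(1) by (simp add: even_lattice_def y)
  have par: "even (c + int n + ?u)" "even (c + int n + ?l)"
    using assms(1,2) edge_parity[where c = c and n = n] by auto
  have "L \<le> snd (path_at \<eta> y (Suc n)) \<and> snd (path_at \<eta> y (Suc n)) \<le> U \<longleftrightarrow>
      (\<forall>j<n. lower_edge \<eta> c L j \<le> upper_edge \<eta> c U j) \<and> ?l \<le> snd (step \<eta> y) \<and> snd (step \<eta> y) \<le> ?u"
    unfolding path_at_Suc
  proof (rule Suc.IH)
    show "step \<eta> y \<in> even_lattice" by (rule step_even_lattice[OF Suc.prems(1)])
    show "fst (step \<eta> y) = c + int n" using Suc.prems(2) by (simp add: step_def)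
  qed
  also have "?l \<le> snd (step \<eta> y) \<and> snd (step \<eta> y) \<le> ?u \<longleftrightarrow>
      ?l \<le> ?u \<and> lower_edge \<eta> c L (Suc n) \<le> h \<and> h \<le> upper_edge \<eta> c U (Suc n)"
  proof -
    \<comment> \<open>Parity excludes the heights of the edges themselves, which belong to the other sublattice.\<close>
    have n1: "h \<noteq> ?u" "h \<noteq> ?l" using hpar par by auto
    have n2: "?u \<noteq> ?l + 1" using par by auto
    consider "h > ?u + 1" | "h = ?u + 1" | "h < ?l - 1" | "h = ?l - 1" | "?l + 1 \<le> h" "h \<le> ?u - 1"
      using n1 by linarith
    then show ?thesis
    proof cases
      case 2
      show ?thesis
      proof (cases "\<eta> (c + int n + 1, ?u + 1)")
        case True
        then show ?thesis by (simp add: y step_def 2)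
      next
        case False
        then show ?thesis by (auto simp add: y step_def 2)
      qed
    next
      case 4
      show ?thesis
      proof (cases "\<eta> (c + int n + 1, ?l - 1)")
        case True
        then show ?thesis by (auto simp add: y step_def 4)
      next
        case False
        then show ?thesis by (simp add: y step_def 4)
      qed
    qed (auto simp: y step_def)
  qed
  finally show ?case by (auto simp: y less_Suc_eq)
qed

lemma cluster_width_pos_iff:
  assumes "even (c + L)" "even (c + U)"
  shows "0 < cluster_width \<eta> c L U n \<longleftrightarrow> lower_edge \<eta> c L n \<le> upper_edge \<eta> c U n"
    and "upper_edge \<eta> c U n = lower_edge \<eta> c L n + 2 * (cluster_width \<eta> c L U n - 1)"
proof -
  have "even (upper_edge \<eta> c U n - lower_edge \<eta> c L n)"
    using assms edge_parity[where c = c and n = n] by (metis even_add even_diff)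
  then obtain k where k: "upper_edge \<eta> c U n - lower_edge \<eta> c L n = 2 * k" by (elim evenE)
  then show "upper_edge \<eta> c U n = lower_edge \<eta> c L n + 2 * (cluster_width \<eta> c L U n - 1)"
    unfolding cluster_width_def by simp
  then show "0 < cluster_width \<eta> c L U n \<longleftrightarrow> lower_edge \<eta> c L n \<le> upper_edge \<eta> c U n" by auto
qed

lemma cluster_width_Suc:
  assumes "even (c + L)" "even (c + U)"
  shows "cluster_width \<eta> c L U (Suc n) = cluster_width \<eta> c L U n +
      (if \<eta> (c + int n + 1, upper_edge \<eta> c U n + 1) then (if \<eta> (c + int n + 1, lower_edge \<eta> c L n - 1) then 0 else - 1)
       else (if \<eta> (c + int n + 1, lower_edge \<eta> c L n - 1) then 1 else 0))"
  using cluster_width_pos_iff(2)[OF assms, of \<eta> n] cluster_width_pos_iff(2)[OF assms, of \<eta> "Suc n"]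
  by (auto split: if_splits)

lemma card_parity_interval:
  fixes a w :: int
  shows "finite {h. even (a + h) \<and> a \<le> h \<and> h \<le> a + 2 * (w - 1)}"
    and "card {h. even (a + h) \<and> a \<le> h \<and> h \<le> a + 2 * (w - 1)} = nat w"
proof -
  have eq: "{h. even (a + h) \<and> a \<le> h \<and> h \<le> a + 2 * (w - 1)} = (\<lambda>i. a + 2 * i) ` {0..<w}"
  proof (intro equalityI subsetI)
    fix h assume h: "h \<in> {h. even (a + h) \<and> a \<le> h \<and> h \<le> a + 2 * (w - 1)}"
    then have "even (h - a)" by auto
    then obtain i where "h - a = 2 * i" by (elim evenE)
    with h show "h \<in> (\<lambda>i. a + 2 * i) ` {0..<w}" by (intro image_eqI[of _ _ i]) auto
  qed auto
  show "finite {h. even (a + h) \<and> a \<le> h \<and> h \<le> a + 2 * (w - 1)}" unfolding eq by simp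
  show "card {h. even (a + h) \<and> a \<le> h \<and> h \<le> a + 2 * (w - 1)} = nat w"
    unfolding eq by (subst card_image) (auto simp: inj_on_def)
qed

definition top_node :: "int \<Rightarrow> real \<Rightarrow> int" where
  "top_node c b = (if even (c + \<lfloor>b\<rfloor>) then \<lfloor>b\<rfloor> else \<lfloor>b\<rfloor> - 1)"

definition bottom_node :: "int \<Rightarrow> real \<Rightarrow> int" where
  "bottom_node c a = (if even (c + \<lceil>a\<rceil>) then \<lceil>a\<rceil> else \<lceil>a\<rceil> + 1)"

lemma top_node:
  fixes c h :: int and b :: real
  shows "even (c + top_node c b)" "b - 2 < top_node c b" "top_node c b \<le> b"
  "even (c + h) \<Longrightarrow> real_of_int h \<le> b \<longleftrightarrow> h \<le> top_node c b"
proof -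
  show "even (c + top_node c b)" unfolding top_node_def by auto
  have "real_of_int \<lfloor>b\<rfloor> \<le> b" "b < real_of_int \<lfloor>b\<rfloor> + 1" by linarith+
  note floor = this
  show "b - 2 < top_node c b" using floor unfolding top_node_def
    by (cases "even (c + \<lfloor>b\<rfloor>)"; simp only: if_True if_False not_True_eq_False of_int_diff of_int_1; linarith)
  show "top_node c b \<le> b" using floor unfolding top_node_def
    by (cases "even (c + \<lfloor>b\<rfloor>)"; simp only: if_True if_False not_True_eq_False of_int_diff of_int_1; linarith)
  show "real_of_int h \<le> b \<longleftrightarrow> h \<le> top_node c b" if "even (c + h)"
  proof -
    have "real_of_int h \<le> b \<longleftrightarrow> h \<le> \<lfloor>b\<rfloor>" by (simp add: le_floor_iff)
    moreover have "h \<noteq> \<lfloor>b\<rfloor>" if "odd (c + \<lfloor>b\<rfloor>)" using that \<open>even (c + h)\<close> by auto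
    ultimately show ?thesis unfolding top_node_def by (auto simp: order_le_less)
  qed
qed

lemma bottom_node:
  fixes c h :: int and a :: real
  shows "even (c + bottom_node c a)" "bottom_node c a < a + 2" "a \<le> bottom_node c a"
  "even (c + h) \<Longrightarrow> a \<le> real_of_int h \<longleftrightarrow> bottom_node c a \<le> h"
proof -
  show "even (c + bottom_node c a)" unfolding bottom_node_def by auto
  have "a \<le> real_of_int \<lceil>a\<rceil>" "real_of_int \<lceil>a\<rceil> < a + 1" by linarith+
  note ceiling = this
  show "bottom_node c a < a + 2" using ceiling unfolding bottom_node_def
    by (cases "even (c + \<lceil>a\<rceil>)"; simp only: if_True if_False not_True_eq_False of_int_add of_int_1; linarith)
  show "a \<le> bottom_node c a" using ceiling unfolding bottom_node_def
    by (cases "even (c + \<lceil>a\<rceil>)"; simp only: if_True if_False not_True_eq_False of_int_add of_int_1; linarith)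
  show "a \<le> real_of_int h \<longleftrightarrow> bottom_node c a \<le> h" if "even (c + h)"
  proof -
    have "a \<le> real_of_int h \<longleftrightarrow> \<lceil>a\<rceil> \<le> h" by (simp add: ceiling_le_iff)
    moreover have "h \<noteq> \<lceil>a\<rceil>" if "odd (c + \<lceil>a\<rceil>)" using that \<open>even (c + h)\<close> by auto
    ultimately show ?thesis unfolding bottom_node_def by (auto simp: order_le_less)
  qed
qed

locale traffic_segment =
  fixes c :: int and m l :: real and L U :: int
  assumes l: "0 < l"
    and L_def: "L = bottom_node c (m - l / 2)" and U_def: "U = top_node c (m + l / 2)"
begin

lemma LU: "even (c + L)" "even (c + U)" "l - 4 < U - L" "U - L \<le> l"
  unfolding L_def U_def using top_node(1-3)[where c = c and b = "m + l / 2"] bottom_node(1-3)[where c = c and a = "m - l / 2"] by auto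

abbreviation width :: "(int \<times> int \<Rightarrow> bool) \<Rightarrow> nat \<Rightarrow> int" where
  "width \<eta> n \<equiv> cluster_width \<eta> c L U n"

definition alive :: "(int \<times> int \<Rightarrow> bool) \<Rightarrow> nat \<Rightarrow> bool" where
  "alive \<eta> n \<longleftrightarrow> (\<forall>j\<le>n. 0 < width \<eta> j)"

lemma width_0: "width \<eta> 0 = (U - L) div 2 + 1"
  by (simp add: cluster_width_def)

lemma width_0_bounds: "l / 2 - 1 < width \<eta> 0" "width \<eta> 0 \<le> l / 2 + 1" "0 \<le> width \<eta> 0"
proof -
  have eq: "real_of_int U = L + 2 * (width \<eta> 0 - 1)"
    using cluster_width_pos_iff(2)[OF LU(1,2), of \<eta> 0] by simp
  show 1: "l / 2 - 1 < width \<eta> 0" "width \<eta> 0 \<le> l / 2 + 1" using LU(3,4) unfolding of_int_diff eq by simp_all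
  have "- 1 < real_of_int (width \<eta> 0)" using 1(1) l by simp
  then show "0 \<le> width \<eta> 0" by linarith
qed

lemma hits_at_iff:
  assumes y: "y \<in> even_lattice"
  shows "hits_at \<eta> l (real_of_int c, m) y n \<longleftrightarrow> fst y = c + int n \<and> alive \<eta> n \<and>
    lower_edge \<eta> c L n \<le> snd y \<and> snd y \<le> upper_edge \<eta> c U n"
proof (cases "fst y = c + int n")
  case True
  let ?h = "snd (path_at \<eta> y n)"
  have "path_at \<eta> y n \<in> even_lattice" by (rule path_at_even_lattice[OF y])
  moreover have f: "fst (path_at \<eta> y n) = c" using True by (simp add: path_at_fst)
  ultimately have par: "even (c + ?h)" unfolding even_lattice_def by (auto simp: case_prod_unfold)
  then have "hits_at \<eta> l (real_of_int c, m) y n \<longleftrightarrow> L \<le> ?h \<and> ?h \<le> U"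
    unfolding hits_at_def segment_def L_def U_def using f top_node(4)[OF par] bottom_node(4)[OF par] by simp
  also have "\<dots> \<longleftrightarrow> (\<forall>j<n. lower_edge \<eta> c L j \<le> upper_edge \<eta> c U j) \<and> lower_edge \<eta> c L n \<le> snd y \<and> snd y \<le> upper_edge \<eta> c U n"
    by (rule path_lands_between_iff[OF LU(1,2) y True])
  also have "\<dots> \<longleftrightarrow> alive \<eta> n \<and> lower_edge \<eta> c L n \<le> snd y \<and> snd y \<le> upper_edge \<eta> c U n"
  proof -
    have "alive \<eta> n \<longleftrightarrow> lower_edge \<eta> c L n \<le> upper_edge \<eta> c U n \<and> (\<forall>j<n. lower_edge \<eta> c L j \<le> upper_edge \<eta> c U j)"
      unfolding alive_def cluster_width_pos_iff(1)[OF LU(1,2)]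
      using All_less_Suc[of n "\<lambda>j. lower_edge \<eta> c L j \<le> upper_edge \<eta> c U j"] unfolding less_Suc_eq_le .
    then show ?thesis by (meson order_trans)
  qed
  finally show ?thesis using True by simp
next
  case False
  then show ?thesis by (auto simp: hits_at_def segment_def path_at_fst)
qed

definition cluster :: "(int \<times> int \<Rightarrow> bool) \<Rightarrow> nat \<Rightarrow> (int \<times> int) set" where
  "cluster \<eta> n = {y \<in> even_lattice. hits_at \<eta> l (real_of_int c, m) y n}"

text \<open>A nonempty block consists of all heights of the right parity between its edges.\<close>
lemma cluster_eq:
  "cluster \<eta> n = (if alive \<eta> n then Pair (c + int n) `
     {h. even (lower_edge \<eta> c L n + h) \<and> lower_edge \<eta> c L n \<le> h \<and> h \<le> lower_edge \<eta> c L n + 2 * (width \<eta> n - 1)} else {})"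
proof -
  have par: "even (c + int n + h) \<longleftrightarrow> even (lower_edge \<eta> c L n + h)" for h
    using edge_parity(2)[of c n \<eta> L] LU(1) by (auto simp: even_add)
  have mem: "(a, h) \<in> cluster \<eta> n \<longleftrightarrow> even (a + h) \<and> a = c + int n \<and> alive \<eta> n \<and>
      lower_edge \<eta> c L n \<le> h \<and> h \<le> upper_edge \<eta> c U n" for a h
    using hits_at_iff[of "(a, h)" \<eta> n] by (auto simp: cluster_def even_lattice_def)
  have "(a, h) \<in> cluster \<eta> n \<longleftrightarrow> a = c + int n \<and> alive \<eta> n \<and> even (lower_edge \<eta> c L n + h) \<and>
      lower_edge \<eta> c L n \<le> h \<and> h \<le> lower_edge \<eta> c L n + 2 * (width \<eta> n - 1)" for a h
    unfolding mem cluster_width_pos_iff(2)[OF LU(1,2), of \<eta> n] using par[of h] by auto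
  then show ?thesis by (intro set_eqI) (simp add: image_iff split_paired_all)
qed

lemma finite_cluster: "finite (cluster \<eta> n)"
  unfolding cluster_eq by (simp add: card_parity_interval(1))

lemma card_cluster: "card (cluster \<eta> n) = (if alive \<eta> n then nat (width \<eta> n) else 0)"
  
  unfolding cluster_eq using card_parity_interval(2)[of "lower_edge \<eta> c L n" "width \<eta> n"]
  by (simp add: card_image inj_on_def)

lemma cluster_nonempty_iff: "cluster \<eta> n \<noteq> {} \<longleftrightarrow> alive \<eta> n"
proof
  show "alive \<eta> n" if "cluster \<eta> n \<noteq> {}" using that unfolding cluster_eq by (auto split: if_splits)
  assume *: "alive \<eta> n"
  then have "0 < width \<eta> n" unfolding alive_def by blast
  with * have "0 < card (cluster \<eta> n)" by (simp add: card_cluster)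
  then show "cluster \<eta> n \<noteq> {}" by (simp add: card_gt_0_iff)
qed

lemma cluster_disjoint: "i \<noteq> j \<Longrightarrow> cluster \<eta> i \<inter> cluster \<eta> j = {}"
  unfolding cluster_eq by auto

text \<open>The width decreases by at most \<open>1\<close> per column, so it is exactly \<open>0\<close> at its first nonpositive value.
The initial width is nonnegative because \<open>U - L\<close> is even and exceeds \<open>l - 4 > - 4\<close>.\<close>
lemma alive_first_passage:
  assumes "\<exists>n. width \<eta> n \<le> 0"
  defines "K \<equiv> first_passage (\<lambda>n. real_of_int (width \<eta> n))"
  shows "alive \<eta> n \<longleftrightarrow> n < K" "width \<eta> K = 0"
proof -
  obtain n0 where n0: "real_of_int (width \<eta> n0) \<le> 0" using assms(1) by auto
  note E = first_passageE[of "\<lambda>n. real_of_int (width \<eta> n)", OF n0, folded K_def]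
  show *: "alive \<eta> n \<longleftrightarrow> n < K" for n
    using E(1) E(3) unfolding alive_def by (auto simp: not_less[symmetric] intro: le_less_trans)
  show "width \<eta> K = 0"
  proof (cases K)
    case 0
    then show ?thesis using E(1) width_0_bounds(3)[of \<eta>] by simp
  next
    case (Suc k)
    then have "0 < width \<eta> k" using E(3)[of k] by simp
    then have "0 \<le> width \<eta> (Suc k)" unfolding cluster_width_Suc[OF LU(1,2)] by auto
    then show ?thesis using E(1) Suc by simp
  qed
qed

lemma traffic_eq:
  assumes "\<exists>n. width \<eta> n \<le> 0"
  shows "real (traffic \<eta> l (real_of_int c, m)) =
    (\<Sum>n<first_passage (\<lambda>n. real_of_int (width \<eta> n)). real_of_int (width \<eta> n))"
proof -
  let ?K = "first_passage (\<lambda>n. real_of_int (width \<eta> n))"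
  have "{y \<in> even_lattice. \<exists>n. hits_at \<eta> l (real_of_int c, m) y n} = (\<Union>n<?K. cluster \<eta> n)"
    using alive_first_passage(1)[OF assms] cluster_nonempty_iff[of \<eta>] unfolding cluster_def by blast
  then have "traffic \<eta> l (real_of_int c, m) = card (\<Union>n<?K. cluster \<eta> n)" by (simp only: traffic_def)
  also have "\<dots> = (\<Sum>n<?K. card (cluster \<eta> n))"
    by (intro card_UN_disjoint) (auto simp: finite_cluster cluster_disjoint)
  finally have "real (traffic \<eta> l (real_of_int c, m)) = (\<Sum>n<?K. real (card (cluster \<eta> n)))" by simp
  also have "\<dots> = (\<Sum>n<?K. real_of_int (width \<eta> n))"
  proof (rule sum.cong[OF refl])
    fix n assume "n \<in> {..<?K}"
    then have "alive \<eta> n" using alive_first_passage(1)[OF assms] by simp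
    moreover from this have "0 < width \<eta> n" unfolding alive_def by blast
    ultimately show "real (card (cluster \<eta> n)) = real_of_int (width \<eta> n)"
      by (simp add: card_cluster)
  qed
  finally show ?thesis .
qed

lemma path_lengths_eq: "path_lengths \<eta> l (real_of_int c, m) = Suc ` {n. alive \<eta> n}"
  unfolding path_lengths_def path_length using cluster_nonempty_iff[of \<eta>] unfolding cluster_def by blast

lemma longest_path_eq:
  assumes "\<exists>n. width \<eta> n \<le> 0"
  shows "longest_path \<eta> l (real_of_int c, m) = first_passage (\<lambda>n. real_of_int (width \<eta> n))"
proof -
  let ?K = "first_passage (\<lambda>n. real_of_int (width \<eta> n))"
  have "path_lengths \<eta> l (real_of_int c, m) = Suc ` {..<?K}"
    unfolding path_lengths_eq using alive_first_passage(1)[OF assms] by auto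
  moreover have "Max (Suc ` {..<?K}) = ?K" if "0 < ?K"
    using that by (intro Max_eqI) (auto intro!: image_eqI[of _ _ "?K - 1"])
  ultimately show ?thesis unfolding longest_path_def by (cases "?K = 0") auto
qed

text \<open>If the block never dies out, infinitely many nodes contribute. The conventions for \<open>card\<close> and \<open>Max\<close>
of infinite sets then make both quantities constant, which is all that measurability requires.\<close>
lemma immortal_traffic:
  assumes "\<not> (\<exists>n. width \<eta> n \<le> 0)"
  shows "traffic \<eta> l (real_of_int c, m) = 0" "longest_path \<eta> l (real_of_int c, m) = Max (range Suc)"
proof -
  have alive: "alive \<eta> n" for n using assms by (auto simp: alive_def not_le)
  have "infinite {y \<in> even_lattice. \<exists>n. hits_at \<eta> l (real_of_int c, m) y n}"
  proof
    assume "finite {y \<in> even_lattice. \<exists>n. hits_at \<eta> l (real_of_int c, m) y n}"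
    then have fin: "finite (\<Union>n. cluster \<eta> n)" by (rule finite_subset[rotated]) (auto simp: cluster_def)
    have "infinite (range (cluster \<eta>))"
    proof
      assume "finite (range (cluster \<eta>))"
      moreover have "inj (cluster \<eta>)"
      proof (rule injI)
        fix i j assume "cluster \<eta> i = cluster \<eta> j"
        then have "cluster \<eta> i \<inter> cluster \<eta> j \<noteq> {}" using alive[of i] cluster_nonempty_iff[of \<eta> i] by simp
        then show "i = j" using cluster_disjoint[of i j \<eta>] by (rule contrapos_np)
      qed
      ultimately have "finite (UNIV :: nat set)" by (rule finite_imageD)
      then show False by simp
    qed
    moreover have "finite (range (cluster \<eta>))" by (rule finite_UnionD[OF fin])
    ultimately show False by (rule notE)
  qed
  then show "traffic \<eta> l (real_of_int c, m) = 0" by (simp add: traffic_def)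
  show "longest_path \<eta> l (real_of_int c, m) = Max (range Suc)"
  proof -
    have "{n. alive \<eta> n} = UNIV" using alive by blast
    then show ?thesis unfolding longest_path_def path_lengths_eq by simp
  qed
qed

end

section \<open>The random environment and the Markov property of the width\<close>

lemma measurable_finite_bool_PiM:
  assumes "finite A"
  shows "f \<in> borel_measurable (PiM A (\<lambda>_. count_space (UNIV :: bool set)))"
  using count_space_PiM_finite[OF assms, of "\<lambda>_. UNIV :: bool set"] by simp

lemma sum_bool_pair:
  "(\<Sum>q\<in>UNIV. f q) = f (False, False) + f (False, True) + f (True, False) + f (True, True)"
  for f :: "bool \<times> bool \<Rightarrow> real"
  unfolding UNIV_Times_UNIV[symmetric] sum.cartesian_product' by (simp add: UNIV_bool)

text \<open>The change of the width when \<open>q\<close> lists the coins of the upper and of the lower candidate: a candidate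
joins the block if the upper coin points down, or the lower one up.\<close>
definition width_increment :: "bool \<times> bool \<Rightarrow> int" where
  "width_increment q = (if fst q then (if snd q then 0 else - 1) else (if snd q then 1 else 0))"

lemma sum_width_increment:
  "(\<Sum>q\<in>UNIV. e * (1 / 4) * u (h * real_of_int (w + width_increment q))) =
    e * ((u (h * real_of_int w + h) + 2 * u (h * real_of_int w) + u (h * real_of_int w - h)) / 4)"
  for e h :: real and u :: "real \<Rightarrow> real"
proof -
  have "h * real_of_int (w + 1) = h * real_of_int w + h" "h * real_of_int (w + - 1) = h * real_of_int w - h"
    by (simp_all add: algebra_simps)
  then show ?thesis
    unfolding sum_bool_pair width_increment_def fst_conv snd_conv if_True if_False add_0_right
    by (simp only:) (simp add: field_simps)
qed

locale random_traffic = prob_space M + traffic_segment c m l L U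
  for M :: "'a measure" and c :: int and m l :: real and L U :: int +
  fixes \<xi> :: "int \<times> int \<Rightarrow> 'a \<Rightarrow> bool"
  assumes indep: "indep_vars (\<lambda>_. count_space UNIV) \<xi> even_lattice"
    and fair: "z \<in> even_lattice \<Longrightarrow> distr M (count_space UNIV) (\<xi> z) = measure_pmf (bernoulli_pmf (1/2))"
begin

abbreviation config :: "'a \<Rightarrow> int \<times> int \<Rightarrow> bool" where
  "config \<omega> \<equiv> \<lambda>z. \<xi> z \<omega>"

text \<open>A finite set of nodes that determines the edges up to column \<open>c + k\<close>. Finiteness makes every function
of the coins on it measurable.\<close>
definition past_nodes :: "nat \<Rightarrow> (int \<times> int) set" where
  "past_nodes k = even_lattice \<inter> ({c + 1..c + int k} \<times> {min L U - int k - 1..max L U + int k + 1})"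

lemma finite_past_nodes: "finite (past_nodes k)"
  unfolding past_nodes_def by (intro finite_Int disjI2 finite_cartesian_product) auto

lemma past_nodes_subset: "past_nodes k \<subseteq> even_lattice"
  unfolding past_nodes_def by blast

lemma \<xi>_measurable: "z \<in> even_lattice \<Longrightarrow> \<xi> z \<in> measurable M (count_space UNIV)"
  using indep unfolding indep_vars_def by blast

lemma edge_past:
  assumes "j \<le> k"
  shows "upper_edge (restrict \<eta> (past_nodes k)) c U j = upper_edge \<eta> c U j"
    and "lower_edge (restrict \<eta> (past_nodes k)) c L j = lower_edge \<eta> c L j"
proof -
  have nodes: "(c + int i + 1, upper_edge \<eta> c U i + 1) \<in> past_nodes k"
      "(c + int i + 1, lower_edge \<eta> c L i - 1) \<in> past_nodes k" if "i < j" for i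
  proof -
    have "even (c + int i + upper_edge \<eta> c U i)" "even (c + int i + lower_edge \<eta> c L i)"
      using edge_parity(1)[of c i \<eta> U] edge_parity(2)[of c i \<eta> L] LU(1,2) by blast+
    then have "(c + int i + 1, upper_edge \<eta> c U i + 1) \<in> even_lattice" "(c + int i + 1, lower_edge \<eta> c L i - 1) \<in> even_lattice"
      by (simp_all add: even_lattice_def)
    moreover have "int i < int k" using that assms by simp
    moreover note edge_range(1)[of \<eta> c U i] edge_range(2)[of \<eta> c L i]
    ultimately show "(c + int i + 1, upper_edge \<eta> c U i + 1) \<in> past_nodes k"
      "(c + int i + 1, lower_edge \<eta> c L i - 1) \<in> past_nodes k"
      unfolding past_nodes_def by (simp_all only: Int_iff mem_Sigma_iff atLeastAtMost_iff simp_thms) linarith+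
  qed
  show "upper_edge (restrict \<eta> (past_nodes k)) c U j = upper_edge \<eta> c U j"
    by (rule edge_cong) (simp only: nodes restrict_apply if_True)
  show "lower_edge (restrict \<eta> (past_nodes k)) c L j = lower_edge \<eta> c L j"
    by (rule lower_edge_cong) (simp only: nodes restrict_apply if_True)
qed

lemma width_past: "j \<le> k \<Longrightarrow> width (restrict \<eta> (past_nodes k)) j = width \<eta> j"
  unfolding cluster_width_def by (simp add: edge_past)

lemma past_measurable: "(\<lambda>\<omega>. f (restrict (config \<omega>) (past_nodes k))) \<in> borel_measurable M"
proof (rule measurable_compose[OF _ measurable_finite_bool_PiM[OF finite_past_nodes[of k]]])
  show "(\<lambda>\<omega>. restrict (config \<omega>) (past_nodes k)) \<in> measurable M (PiM (past_nodes k) (\<lambda>_. count_space UNIV))"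
    using past_nodes_subset by (intro measurable_restrict \<xi>_measurable) auto
qed

lemma width_measurable: "(\<lambda>\<omega>. real_of_int (width (config \<omega>) k)) \<in> borel_measurable M"
  using past_measurable[of "\<lambda>\<eta>. real_of_int (width \<eta> k)" k] by (simp add: width_past)

lemma fair_prob:
  assumes "z \<in> even_lattice"
  shows "prob (\<xi> z -` {i} \<inter> space M) = 1 / 2"
proof -
  have "prob (\<xi> z -` {i} \<inter> space M) = measure (distr M (count_space UNIV) (\<xi> z)) {i}"
    by (rule measure_distr[symmetric]) (use \<xi>_measurable[OF assms] in auto)
  also have "\<dots> = 1 / 2" unfolding fair[OF assms] by (cases i) (simp_all add: measure_pmf_single)
  finally show ?thesis .
qed

text \<open>For fixed edges the two candidates are distinct nodes of a new column, so their coins are independent of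
the past and of each other.\<close>
lemma expectation_next_column:
  fixes F :: "(int \<times> int \<Rightarrow> bool) \<Rightarrow> real"
  assumes ab: "even (c + int k + a)" "even (c + int k + b)" "b \<le> a" and F: "\<And>\<eta>. \<bar>F \<eta>\<bar> \<le> 1"
  defines "z1 \<equiv> (c + int k + 1, a + 1)" and "z2 \<equiv> (c + int k + 1, b - 1)"
  shows "expectation (\<lambda>\<omega>. F (restrict (config \<omega>) (past_nodes k)) * of_bool (\<xi> z1 \<omega> = i \<and> \<xi> z2 \<omega> = j))
    = expectation (\<lambda>\<omega>. F (restrict (config \<omega>) (past_nodes k))) * (1 / 4)"
proof -
  let ?R = "\<lambda>A \<omega>. restrict (\<lambda>z. \<xi> z \<omega>) A"
  let ?G = "\<lambda>y :: int \<times> int \<Rightarrow> bool. of_bool (y z1 = i \<and> y z2 = j) :: real"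
  have z: "z1 \<in> even_lattice" "z2 \<in> even_lattice" "z1 \<noteq> z2"
    using ab by (auto simp: z1_def z2_def even_lattice_def)
  have disj: "past_nodes k \<inter> {z1, z2} = {}" by (auto simp: past_nodes_def z1_def z2_def)
  have "indep_var (PiM (past_nodes k) (\<lambda>_. count_space UNIV)) (?R (past_nodes k))
      (PiM {z1, z2} (\<lambda>_. count_space UNIV)) (?R {z1, z2})"
    using z past_nodes_subset by (intro indep_var_restrict[OF indep disj]) auto
  then have "indep_var borel (F \<circ> ?R (past_nodes k)) borel (?G \<circ> ?R {z1, z2})"
    by (rule indep_var_compose) (intro measurable_finite_bool_PiM finite_past_nodes; simp)+
  moreover have "?G \<circ> ?R {z1, z2} = (\<lambda>\<omega>. of_bool (\<xi> z1 \<omega> = i \<and> \<xi> z2 \<omega> = j))"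
    by (simp add: fun_eq_iff)
  ultimately have ind: "indep_var borel (\<lambda>\<omega>. F (?R (past_nodes k) \<omega>)) borel (\<lambda>\<omega>. of_bool (\<xi> z1 \<omega> = i \<and> \<xi> z2 \<omega> = j) :: real)"
    by (simp add: o_def)
  have "integrable M (\<lambda>\<omega>. F (?R (past_nodes k) \<omega>))"
    using F past_measurable by (intro integrable_const_bound[of _ 1]) auto
  moreover have "integrable M (\<lambda>\<omega>. of_bool (\<xi> z1 \<omega> = i \<and> \<xi> z2 \<omega> = j) :: real)"
    using indep_var_rv2[OF ind] by (intro integrable_const_bound[of _ 1]) auto
  ultimately have "expectation (\<lambda>\<omega>. F (?R (past_nodes k) \<omega>) * of_bool (\<xi> z1 \<omega> = i \<and> \<xi> z2 \<omega> = j)) =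
      expectation (\<lambda>\<omega>. F (?R (past_nodes k) \<omega>)) * expectation (\<lambda>\<omega>. of_bool (\<xi> z1 \<omega> = i \<and> \<xi> z2 \<omega> = j))"
    using ind by (intro indep_var_lebesgue_integral)
  also have "expectation (\<lambda>\<omega>. of_bool (\<xi> z1 \<omega> = i \<and> \<xi> z2 \<omega> = j) :: real) = 1 / 4"
  proof -
    define A where "A z = (if z = z1 then {i} else {j})" for z
    have "expectation (\<lambda>\<omega>. of_bool (\<xi> z1 \<omega> = i \<and> \<xi> z2 \<omega> = j) :: real) =
        expectation (indicator (\<Inter>z\<in>{z1, z2}. \<xi> z -` A z \<inter> space M))"
      using z(3) by (intro Bochner_Integration.integral_cong) (auto simp: indicator_def A_def)
    also have "\<dots> = prob (\<Inter>z\<in>{z1, z2}. \<xi> z -` A z \<inter> space M)"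
    proof -
      have "(\<Inter>z\<in>{z1, z2}. \<xi> z -` A z \<inter> space M) \<inter> space M = (\<Inter>z\<in>{z1, z2}. \<xi> z -` A z \<inter> space M)" by auto
      then show ?thesis by (simp only: Bochner_Integration.integral_indicator)
    qed
    also have "\<dots> = (\<Prod>z\<in>{z1, z2}. prob (\<xi> z -` A z \<inter> space M))"
      using z by (intro indep_varsD[OF indep]) auto
    also have "\<dots> = (1 / 2) * (1 / 2)"
      using z by (simp add: A_def fair_prob)
    finally show ?thesis by simp
  qed
  finally show ?thesis .
qed

text \<open>The width is measured in units of \<open>l / 2\<close>, so one step changes the scaled width by \<open>2 / l\<close>.\<close>
definition mesh :: real where "mesh = 2 / l"

definition X :: "nat \<Rightarrow> 'a \<Rightarrow> real" where
  "X k \<omega> = mesh * real_of_int (width (config \<omega>) k)"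

lemma mesh_pos: "0 < mesh"
  using l by (simp add: mesh_def)

lemma X_measurable [measurable]: "X k \<in> borel_measurable M"
  unfolding X_def using width_measurable by (intro borel_measurable_times) auto

text \<open>The positions of the two candidates depend on the past. Splitting according to the finitely many
possible positions of the edges reduces the claim to fixed candidates. A positive weight forces a
nonempty block, for which the candidates are distinct.\<close>
lemma walk_markov:
  assumes cost: "\<And>x. 0 < x \<Longrightarrow> 0 \<le> cost x"
  shows "expectation (\<lambda>\<omega>. survival_weight cost (\<lambda>k. X k \<omega>) (Suc k) * u (X (Suc k) \<omega>)) =
    expectation (\<lambda>\<omega>. survival_weight cost (\<lambda>k. X k \<omega>) (Suc k) *
      ((u (X k \<omega> + mesh) + 2 * u (X k \<omega>) + u (X k \<omega> - mesh)) / 4))"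
proof -
  let ?R = "\<lambda>\<omega>. restrict (config \<omega>) (past_nodes k)"
  let ?e = "\<lambda>\<omega>. (upper_edge (config \<omega>) c U k, lower_edge (config \<omega>) c L k)"
  let ?P = "\<lambda>x. (u (x + mesh) + 2 * u x + u (x - mesh)) / 4"
  \<comment> \<open>The possible positions of the upper and the lower edge of a nonempty block after \<open>k\<close> columns.\<close>
  define S where "S = {(a, b). a \<in> {U - int k..U + int k} \<and> b \<in> {L - int k..L + int k} \<and>
      even (c + int k + a) \<and> even (c + int k + b) \<and> b \<le> a}"
  have fin: "finite S"
    by (rule finite_subset[of _ "{U - int k..U + int k} \<times> {L - int k..L + int k}"]) (auto simp: S_def)
  define w where "w p = (fst p - snd p) div 2 + (1 :: int)" for p :: "int \<times> int"
  let ?u = "\<lambda>p q. u (mesh * real_of_int (w p + width_increment q))"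
  define SW where "SW \<eta> = survival_weight cost (\<lambda>j. mesh * real_of_int (width \<eta> j)) (Suc k)" for \<eta>
  \<comment> \<open>The event that the edges are at \<open>p\<close>, determined by the past, and the event that the two candidates show
    the coins \<open>q\<close>, which concerns the next column.\<close>
  define F where "F p \<eta> = SW \<eta> * of_bool (upper_edge \<eta> c U k = fst p \<and> lower_edge \<eta> c L k = snd p)" for p \<eta>
  define Q where "Q p q \<omega> = (of_bool (\<xi> (c + int k + 1, fst p + 1) \<omega> = fst q \<and> \<xi> (c + int k + 1, snd p - 1) \<omega> = snd q) :: real)" for p q \<omega>
  let ?E = "\<lambda>p. expectation (\<lambda>\<omega>. F p (?R \<omega>))"
  have SW01: "0 \<le> SW \<eta>" "SW \<eta> \<le> 1" for \<eta>
    using survival_weight_bound[of 0 cost] cost unfolding SW_def by auto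
  have F01: "\<bar>F p \<eta>\<bar> \<le> 1" for p \<eta> unfolding F_def using SW01[of \<eta>] by auto
  have SW_R: "SW (?R \<omega>) = SW (config \<omega>)" for \<omega>
    unfolding SW_def survival_weight_def by (simp add: width_past less_Suc_eq_le)
  have SW_X: "survival_weight cost (\<lambda>k. X k \<omega>) (Suc k) = SW (config \<omega>)" for \<omega>
    unfolding SW_def X_def ..
  have F_R: "F p (?R \<omega>) = F p (config \<omega>)" for p \<omega>
    unfolding F_def SW_R by (simp add: edge_past)
  have F_meas: "(\<lambda>\<omega>. F p (?R \<omega>)) \<in> borel_measurable M" for p by (rule past_measurable)
  have F_int: "integrable M (\<lambda>\<omega>. F p (?R \<omega>))" for p
    by (rule integrable_const_bound[of _ 1, OF AE_I2 F_meas]) (simp only: real_norm_def F01)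
  have F_eq: "F p (?R \<omega>) = SW (config \<omega>) *
      of_bool (upper_edge (config \<omega>) c U k = fst p \<and> lower_edge (config \<omega>) c L k = snd p)" for p \<omega>
    unfolding F_R by (simp only: F_def)
  have decompose: "SW (config \<omega>) * g (?e \<omega>) = (\<Sum>p\<in>S. F p (?R \<omega>) * g p)"
    for g :: "int \<times> int \<Rightarrow> real" and \<omega>
  proof (cases "SW (config \<omega>) = 0")
    case True
    then show ?thesis unfolding F_eq by simp
  next
    case False
    have "0 < mesh * real_of_int (width (config \<omega>) k)"
      using False unfolding SW_def survival_weight_def by (auto split: if_splits)
    then have "0 < width (config \<omega>) k" using mesh_pos by (simp add: zero_less_mult_iff)
    then have "lower_edge (config \<omega>) c L k \<le> upper_edge (config \<omega>) c U k"
      by (simp add: cluster_width_pos_iff(1)[OF LU(1,2)])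
    moreover have "even (c + int k + upper_edge (config \<omega>) c U k)" "even (c + int k + lower_edge (config \<omega>) c L k)"
      using edge_parity(1)[of c k "config \<omega>" U] edge_parity(2)[of c k "config \<omega>" L] LU(1,2) by blast+
    moreover have "upper_edge (config \<omega>) c U k \<in> {U - int k..U + int k}"
      using edge_range(1)[of "config \<omega>" c U k] unfolding atLeastAtMost_iff by linarith
    moreover have "lower_edge (config \<omega>) c L k \<in> {L - int k..L + int k}"
      using edge_range(2)[of "config \<omega>" c L k] unfolding atLeastAtMost_iff by linarith
    ultimately have "?e \<omega> \<in> S" unfolding S_def by blast
    have "(\<Sum>p\<in>S. F p (?R \<omega>) * g p) = (\<Sum>p\<in>S. if p = ?e \<omega> then SW (config \<omega>) * g (?e \<omega>) else 0)"
      unfolding F_eq by (intro sum.cong refl) auto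
    also have "\<dots> = SW (config \<omega>) * g (?e \<omega>)" using fin \<open>?e \<omega> \<in> S\<close> by simp
    finally show ?thesis ..
  qed
  have w: "w (?e \<omega>) = width (config \<omega>) k" for \<omega>
    by (simp add: w_def cluster_width_def)
  have next_X: "u (X (Suc k) \<omega>) = (\<Sum>q\<in>UNIV. Q (?e \<omega>) q \<omega> *
      u (mesh * real_of_int (width (config \<omega>) k + width_increment q)))" for \<omega>
    unfolding X_def cluster_width_Suc[OF LU(1,2)] sum_bool_pair Q_def width_increment_def
    by simp
  have "expectation (\<lambda>\<omega>. survival_weight cost (\<lambda>k. X k \<omega>) (Suc k) * u (X (Suc k) \<omega>))
      = expectation (\<lambda>\<omega>. \<Sum>p\<in>S. \<Sum>q\<in>UNIV. F p (?R \<omega>) * Q p q \<omega> * ?u p q)"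
  proof (rule Bochner_Integration.integral_cong[OF refl])
    fix \<omega>
    have "survival_weight cost (\<lambda>k. X k \<omega>) (Suc k) * u (X (Suc k) \<omega>)
        = (\<Sum>p\<in>S. F p (?R \<omega>) * (\<Sum>q\<in>UNIV. Q p q \<omega> * ?u p q))"
      unfolding SW_X next_X w[symmetric]
      by (rule decompose[of \<omega> "\<lambda>p. \<Sum>q\<in>UNIV. Q p q \<omega> * ?u p q"])
    then show "survival_weight cost (\<lambda>k. X k \<omega>) (Suc k) * u (X (Suc k) \<omega>)
        = (\<Sum>p\<in>S. \<Sum>q\<in>UNIV. F p (?R \<omega>) * Q p q \<omega> * ?u p q)"
      by (simp add: sum_distrib_left mult.assoc)
  qed
  also have "\<dots> = (\<Sum>p\<in>S. \<Sum>q\<in>UNIV. expectation (\<lambda>\<omega>. F p (?R \<omega>) * Q p q \<omega> * ?u p q))"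
  proof -
    have "integrable M (\<lambda>\<omega>. F p (?R \<omega>) * Q p q \<omega> * ?u p q)" if "p \<in> S" for p q
    proof -
      have "(c + int k + 1, fst p + 1) \<in> even_lattice" "(c + int k + 1, snd p - 1) \<in> even_lattice"
        using that by (auto simp: S_def even_lattice_def)
      note [measurable] = this[THEN \<xi>_measurable]
      have "Q p q \<in> borel_measurable M" unfolding Q_def by measurable
      then have "(\<lambda>\<omega>. F p (?R \<omega>) * Q p q \<omega>) \<in> borel_measurable M" by (rule borel_measurable_times[OF F_meas])
      moreover have "norm (F p (?R \<omega>) * Q p q \<omega>) \<le> 1" for \<omega>
        using F01[of p "?R \<omega>"] by (simp add: Q_def abs_mult)
      ultimately have "integrable M (\<lambda>\<omega>. F p (?R \<omega>) * Q p q \<omega>)" by (intro integrable_const_bound[of _ 1] AE_I2)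
      then show ?thesis by (rule integrable_mult_left)
    qed
    then show ?thesis by (simp add: Bochner_Integration.integral_sum)
  qed
  also have "\<dots> = (\<Sum>p\<in>S. \<Sum>q\<in>UNIV. ?E p * (1 / 4) * ?u p q)"
  proof (intro sum.cong refl)
    fix p q assume "p \<in> S"
    then have "even (c + int k + fst p)" "even (c + int k + snd p)" "snd p \<le> fst p" by (auto simp: S_def)
    from expectation_next_column[OF this, of "F p" "fst q" "snd q", OF F01]
    have factor: "expectation (\<lambda>\<omega>. F p (?R \<omega>) * Q p q \<omega>) = ?E p * (1 / 4)"
      unfolding Q_def .
    have "expectation (\<lambda>\<omega>. F p (?R \<omega>) * Q p q \<omega> * ?u p q) =
        expectation (\<lambda>\<omega>. F p (?R \<omega>) * Q p q \<omega>) * ?u p q"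
      by (rule Bochner_Integration.integral_mult_left_zero)
    then show "expectation (\<lambda>\<omega>. F p (?R \<omega>) * Q p q \<omega> * ?u p q) =
        ?E p * (1 / 4) * ?u p q"
      unfolding factor .
  qed
  also have "\<dots> = (\<Sum>p\<in>S. ?E p * ?P (mesh * real_of_int (w p)))"
  proof (intro sum.cong refl)
    fix p
    show "(\<Sum>q\<in>UNIV. ?E p * (1 / 4) * ?u p q) =
        ?E p * ?P (mesh * real_of_int (w p))"
      by (rule sum_width_increment)
  qed
  also have "\<dots> = expectation (\<lambda>\<omega>. \<Sum>p\<in>S. F p (?R \<omega>) * ?P (mesh * real_of_int (w p)))"
  proof -
    have "expectation (\<lambda>\<omega>. \<Sum>p\<in>S. F p (?R \<omega>) * ?P (mesh * real_of_int (w p))) =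
        (\<Sum>p\<in>S. expectation (\<lambda>\<omega>. F p (?R \<omega>) * ?P (mesh * real_of_int (w p))))"
      by (rule Bochner_Integration.integral_sum) (rule integrable_mult_left[OF F_int])
    then show ?thesis unfolding Bochner_Integration.integral_mult_left_zero by (rule sym)
  qed
  also have "\<dots> = expectation (\<lambda>\<omega>. survival_weight cost (\<lambda>k. X k \<omega>) (Suc k) * ?P (X k \<omega>))"
    unfolding SW_X unfolding X_def w[symmetric] decompose[symmetric, of _ "\<lambda>p. ?P (mesh * real_of_int (w p))"] ..
  finally show ?thesis .
qed

end

section \<open>Convergence of the rescaled traffic\<close>

lemma abs_weighted_mean_le:
  "\<bar>a\<bar> \<le> K \<Longrightarrow> \<bar>b\<bar> \<le> K \<Longrightarrow> \<bar>d\<bar> \<le> K \<Longrightarrow> \<bar>(a + 2 * b + d) / 4\<bar> \<le> K"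
  for a b d K :: real
  by (simp add: abs_le_iff field_simps)

context random_traffic
begin

definition start :: real where
  "start = mesh * real_of_int ((U - L) div 2 + 1)"

lemma X_0: "X 0 \<omega> = start"
  by (simp add: X_def start_def width_0)

text \<open>An interval of length \<open>l\<close> contains \<open>l / 2\<close> lattice points of a column, up to an error of \<open>1\<close>.\<close>
lemma start_bounds: "\<bar>start - 1\<bar> \<le> mesh" "0 \<le> start"
proof -
  have w: "l / 2 - 1 < real_of_int ((U - L) div 2 + 1)" "real_of_int ((U - L) div 2 + 1) \<le> l / 2 + 1"
    "0 \<le> (U - L) div 2 + 1"
    using width_0_bounds[of undefined] unfolding width_0 by blast+
  have "mesh * (l / 2 - 1) \<le> start" "start \<le> mesh * (l / 2 + 1)"
    unfolding start_def using w mesh_pos by (auto intro!: mult_left_mono less_imp_le)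
  moreover have "mesh * (l / 2 - 1) = 1 - mesh" "mesh * (l / 2 + 1) = 1 + mesh"
    using l by (simp_all add: mesh_def field_simps)
  ultimately show "\<bar>start - 1\<bar> \<le> mesh" by linarith
  show "0 \<le> start" unfolding start_def using w(3) mesh_pos by (intro mult_nonneg_nonneg) auto
qed

lemma walk_passage_bound:
  assumes sol: "smooth_extension p q u K" and p: "0 < p" and q: "0 \<le> q" and fine: "mesh\<^sup>2 / 2 \<le> 1"
  shows "\<bar>expectation (\<lambda>\<omega>. passage_value (\<lambda>x. mesh\<^sup>2 / 2 * (p + q * x) / 2) u (\<lambda>k. X k \<omega>)) - u start\<bar>
    \<le> 2 * (2 * K + K) * (1 + p) / p * sqrt (mesh\<^sup>2 / 2)"
proof (rule passage_value_expectation[where P = "\<lambda>x. (u (x + mesh) + 2 * u x + u (x - mesh)) / 4", OF sol p q])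
  have bound: "\<bar>u x\<bar> \<le> K" for x using sol unfolding smooth_extension_def by blast
  have [measurable]: "u \<in> borel_measurable borel"
    using sol unfolding smooth_extension_def by (intro borel_measurable_continuous_onI) blast
  show "(\<lambda>x. (u (x + mesh) + 2 * u x + u (x - mesh)) / 4) \<in> borel_measurable borel" by measurable
  show "\<bar>(u (x + mesh) + 2 * u x + u (x - mesh)) / 4\<bar> \<le> K" for x
    by (intro abs_weighted_mean_le bound)
  show "0 < mesh\<^sup>2 / 2" using mesh_pos by simp
  show "\<bar>(u (x + mesh) + 2 * u x + u (x - mesh)) / 4 - (1 + mesh\<^sup>2 / 2 * (p + q * x) / 2) * u x\<bar>
      \<le> 2 * K * (mesh\<^sup>2 / 2 * sqrt (mesh\<^sup>2 / 2))" if "0 < x" for x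
    by (rule lazy_step_generator[OF sol that mesh_pos])
  show "expectation (\<lambda>\<omega>. survival_weight (\<lambda>x. mesh\<^sup>2 / 2 * (p + q * x) / 2) (\<lambda>k. X k \<omega>) (Suc k) * u (X (Suc k) \<omega>)) =
      expectation (\<lambda>\<omega>. survival_weight (\<lambda>x. mesh\<^sup>2 / 2 * (p + q * x) / 2) (\<lambda>k. X k \<omega>) (Suc k) *
        ((u (X k \<omega> + mesh) + 2 * u (X k \<omega>) + u (X k \<omega> - mesh)) / 4))" for k
    by (rule walk_markov) (use p q in simp)
qed (use fine in \<open>simp_all only: X_0 X_measurable\<close>)

text \<open>The probability of this event tends to \<open>1\<close>, by the same estimate with the exponential in place of \<open>u\<close>.\<close>
definition mortal :: "'a \<Rightarrow> bool" where
  "mortal \<omega> \<longleftrightarrow> (\<exists>k. X k \<omega> \<le> 0)"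

lemma X_le_0_iff: "X k \<omega> \<le> 0 \<longleftrightarrow> width (config \<omega>) k \<le> 0"
  using mesh_pos by (simp add: X_def mult_le_0_iff)

lemma first_passage_X: "first_passage (\<lambda>k. X k \<omega>) = first_passage (\<lambda>k. real_of_int (width (config \<omega>) k))"
  unfolding first_passage_def X_le_0_iff by simp

lemma mortal_measurable [measurable]: "Measurable.pred M mortal"
  unfolding mortal_def by measurable

abbreviation tau :: "'a \<Rightarrow> real" where
  "tau \<omega> \<equiv> real (longest_path (config \<omega>) l (real_of_int c, m))"

abbreviation T :: "'a \<Rightarrow> real" where
  "T \<omega> \<equiv> real (traffic (config \<omega>) l (real_of_int c, m))"

lemma tau_eq: "tau \<omega> = (if mortal \<omega> then real (first_passage (\<lambda>k. X k \<omega>)) else real (Max (range Suc)))"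
proof (cases "mortal \<omega>")
  case True
  then have "\<exists>n. width (config \<omega>) n \<le> 0" unfolding mortal_def X_le_0_iff .
  from longest_path_eq[OF this] True show ?thesis by (simp add: first_passage_X)
next
  case False
  then have "\<not> (\<exists>n. width (config \<omega>) n \<le> 0)" unfolding mortal_def X_le_0_iff .
  from immortal_traffic(2)[OF this] False show ?thesis by simp
qed

lemma T_eq: "T \<omega> = (if mortal \<omega> then l / 2 * (\<Sum>n<first_passage (\<lambda>k. X k \<omega>). X n \<omega>) else 0)"
proof (cases "mortal \<omega>")
  case True
  then have *: "\<exists>n. width (config \<omega>) n \<le> 0" unfolding mortal_def X_le_0_iff .
  have "l / 2 * (\<Sum>n<first_passage (\<lambda>k. X k \<omega>). X n \<omega>) = (\<Sum>n<first_passage (\<lambda>k. X k \<omega>). real_of_int (width (config \<omega>) n))"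
    unfolding sum_distrib_left X_def using l by (simp add: mesh_def)
  with traffic_eq[OF *] True show ?thesis by (simp add: first_passage_X)
next
  case False
  then have "\<not> (\<exists>n. width (config \<omega>) n \<le> 0)" unfolding mortal_def X_le_0_iff .
  from immortal_traffic(1)[OF this] False show ?thesis by simp
qed

lemma first_passage_measurable [measurable]:
  "(\<lambda>\<omega>. first_passage (\<lambda>k. X k \<omega>)) \<in> measurable M (count_space UNIV)"
  unfolding first_passage_def by measurable

lemma tau_measurable: "tau \<in> borel_measurable M"
  unfolding tau_eq by measurable

lemma T_measurable: "T \<in> borel_measurable M"
proof -
  have "(\<lambda>\<omega>. (\<lambda>k \<omega>. \<Sum>n<k. X n \<omega>) (first_passage (\<lambda>k. X k \<omega>)) \<omega>) \<in> borel_measurable M"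
    by (rule measurable_compose_countable[where f = "\<lambda>k \<omega>. \<Sum>n<k. X n \<omega>"]) measurable
  then have [measurable]: "(\<lambda>\<omega>. \<Sum>n<first_passage (\<lambda>k. X k \<omega>). X n \<omega>) \<in> borel_measurable M" .
  show ?thesis unfolding T_eq by measurable
qed

text \<open>This is where the constants of the scaling arise: with variance \<open>\<delta> = 2 / l\<^sup>2\<close> per column and unit of width
\<open>l / 2\<close>, the accumulated cost \<open>\<Sum>j. \<delta> (a + b X j / 2) / 2\<close> is \<open>a \<tau> / l\<^sup>2 + b T / l\<^sup>3\<close>.\<close>
lemma passage_value_mortal:
  assumes "mortal \<omega>" and u: "u 0 = 1"
  shows "passage_value (\<lambda>x. mesh\<^sup>2 / 2 * (a + b / 2 * x) / 2) u (\<lambda>k. X k \<omega>) =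
    exp (- (a * (tau \<omega> / l\<^sup>2) + b * (T \<omega> / l ^ 3)))"
proof -
  let ?K = "first_passage (\<lambda>k. X k \<omega>)"
  have *: "\<exists>n. width (config \<omega>) n \<le> 0" using assms(1) unfolding mortal_def X_le_0_iff .
  have "X ?K \<omega> = 0" unfolding X_def first_passage_X[unfolded X_def] using alive_first_passage(2)[OF *] by simp
  have "(\<Sum>j<?K. mesh\<^sup>2 / 2 * (a + b / 2 * X j \<omega>) / 2) = (\<Sum>j<?K. a / l\<^sup>2 + b / (2 * l\<^sup>2) * X j \<omega>)"
    by (rule sum.cong[OF refl]) (use l in \<open>simp add: mesh_def power2_eq_square field_simps\<close>)
  also have "\<dots> = a * (real ?K / l\<^sup>2) + b / (2 * l\<^sup>2) * (\<Sum>j<?K. X j \<omega>)"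
    by (simp add: sum.distrib sum_distrib_left)
  also have "\<dots> = a * (tau \<omega> / l\<^sup>2) + b * (T \<omega> / l ^ 3)"
    using assms(1) l by (simp add: tau_eq T_eq power2_eq_square power3_eq_cube)
  finally show ?thesis
    using assms(1) \<open>X ?K \<omega> = 0\<close> u unfolding passage_value_def mortal_def by simp
qed

text \<open>On configurations whose block dies out the transform equals the passage value; the probability of the
others is estimated by the passage value with the reward \<open>v\<close>, which vanishes there and is at most \<open>1\<close>
elsewhere.\<close>
lemma laplace_error:
  assumes u: "smooth_extension a (b / 2) u K" and v: "smooth_extension p 0 v K'"
    and a: "0 < a" and b: "0 \<le> b" and p: "0 < p" and fine: "mesh\<^sup>2 / 2 \<le> 1"
  shows "\<bar>expectation (\<lambda>\<omega>. exp (- (a * (tau \<omega> / l\<^sup>2) + b * (T \<omega> / l ^ 3)))) - u start\<bar>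
    \<le> (6 * K * (1 + a) / a + 6 * K' * (1 + p) / p) * mesh + (1 - v start)"
proof -
  let ?f = "\<lambda>\<omega>. exp (- (a * (tau \<omega> / l\<^sup>2) + b * (T \<omega> / l ^ 3)))"
  let ?V = "\<lambda>q u \<omega>. passage_value (\<lambda>x. mesh\<^sup>2 / 2 * (q + b / 2 * x) / 2) u (\<lambda>k. X k \<omega>)"
  let ?W = "\<lambda>\<omega>. passage_value (\<lambda>x. mesh\<^sup>2 / 2 * (p + 0 * x) / 2) v (\<lambda>k. X k \<omega>)"
  have u0: "u 0 = 1" "\<And>x. \<bar>u x\<bar> \<le> K" and v0: "v 0 = 1" "\<And>x. \<bar>v x\<bar> \<le> K'"
    using u v unfolding smooth_extension_def by blast+
  have [measurable]: "u \<in> borel_measurable borel" "v \<in> borel_measurable borel"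
    using u v unfolding smooth_extension_def by (auto intro!: borel_measurable_continuous_onI)
  note [measurable] = tau_measurable T_measurable
  have f01: "0 \<le> ?f \<omega>" "?f \<omega> \<le> 1" for \<omega>
  proof -
    have "0 \<le> a * (tau \<omega> / l\<^sup>2) + b * (T \<omega> / l ^ 3)"
      using a b l by (intro add_nonneg_nonneg mult_nonneg_nonneg divide_nonneg_nonneg) auto
    then show "?f \<omega> \<le> 1" by simp
  qed simp
  have f_int: "integrable M ?f" by (rule integrable_const_bound[of _ 1]) (use f01 in auto)
  have V_int: "integrable M (?V a u)"
  proof (rule integrable_const_bound[of _ K])
    show "AE \<omega> in M. norm (?V a u \<omega>) \<le> K"
      unfolding real_norm_def by (intro AE_I2 passage_value_bound u0(2)) (use a b in simp)
    show "?V a u \<in> borel_measurable M"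
    proof (rule measurable_passage_value)
      show "mesh\<^sup>2 / 2 * a / 2 \<le> mesh\<^sup>2 / 2 * (a + b / 2 * x) / 2" if "0 < x" for x
        using that b by (intro divide_right_mono mult_left_mono) auto
      show "0 < mesh\<^sup>2 / 2 * a / 2" using mesh_pos a by simp
    qed (use u0 in auto)
  qed
  have W_int: "integrable M ?W"
  proof (rule integrable_const_bound[of _ K'])
    show "AE \<omega> in M. norm (?W \<omega>) \<le> K'"
      unfolding real_norm_def by (intro AE_I2 passage_value_bound v0(2)) (use p in simp)
    show "?W \<in> borel_measurable M"
    proof (rule measurable_passage_value)
      show "mesh\<^sup>2 / 2 * p / 2 \<le> mesh\<^sup>2 / 2 * (p + 0 * x) / 2" if "0 < x" for x by simp
      show "0 < mesh\<^sup>2 / 2 * p / 2" using mesh_pos p by simp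
    qed (use v0 in auto)
  qed
  have sqrt_le: "sqrt (mesh\<^sup>2 / 2) \<le> mesh"
    using mesh_pos by (intro real_le_lsqrt) auto
  have K: "0 \<le> K" "0 \<le> K'" using order_trans[OF abs_ge_zero u0(2)[of 0]] order_trans[OF abs_ge_zero v0(2)[of 0]] by auto
  have diff: "\<bar>?f \<omega> - ?V a u \<omega>\<bar> \<le> 1 - ?W \<omega>" for \<omega>
  proof (cases "mortal \<omega>")
    case True
    have "?W \<omega> = exp (- (p * (tau \<omega> / l\<^sup>2) + 0 * (T \<omega> / l ^ 3)))"
      using passage_value_mortal[where a = p and b = 0 and u = v, OF True v0(1)] by simp
    also have "\<dots> \<le> 1" using p by simp
    finally show ?thesis using passage_value_mortal[where a = a and b = b and u = u, OF True u0(1)] by simp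
  next
    case False
    then have "?V a u \<omega> = 0" "?W \<omega> = 0" unfolding passage_value_def mortal_def by simp_all
    then show ?thesis using f01[of \<omega>] by simp
  qed
  have "\<bar>expectation ?f - expectation (?V a u)\<bar> \<le> expectation (\<lambda>\<omega>. 1 - ?W \<omega>)"
    by (rule integral_abs_diff_le[OF f_int V_int _ AE_I2[OF diff]]) (use W_int in simp)
  also have "\<dots> = 1 - expectation ?W" using W_int by (simp add: prob_space)
  finally have 1: "\<bar>expectation ?f - expectation (?V a u)\<bar> \<le> 1 - expectation ?W" .
  have rate: "2 * (2 * k + k) * (1 + r) / r * sqrt (mesh\<^sup>2 / 2) \<le> 6 * k * (1 + r) / r * mesh" if "0 \<le> k" "0 < r" for k r :: real
  proof -
    have "2 * (2 * k + k) * (1 + r) / r * sqrt (mesh\<^sup>2 / 2) \<le> 2 * (2 * k + k) * (1 + r) / r * mesh"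
      using that by (intro mult_left_mono[OF sqrt_le]) simp
    then show ?thesis by simp
  qed
  have 2: "\<bar>expectation (?V a u) - u start\<bar> \<le> 6 * K * (1 + a) / a * mesh"
    using walk_passage_bound[OF u a _ fine] b rate[OF K(1) a] by simp
  have 3: "\<bar>expectation ?W - v start\<bar> \<le> 6 * K' * (1 + p) / p * mesh"
    using order_trans[OF walk_passage_bound[OF v p order_refl fine] rate[OF K(2) p]] .
  show ?thesis using 1 2 3 unfolding distrib_right by linarith
qed

end

theorem theorem1p1:
  fixes M :: "'a measure" and \<xi> :: "int \<times> int \<Rightarrow> 'a \<Rightarrow> bool"
    and N :: "'b measure" and B :: "real \<Rightarrow> 'b \<Rightarrow> real"
    and x1 x2 :: int
  assumes "prob_space M"
    and "prob_space.indep_vars M (\<lambda>_. count_space UNIV) \<xi> even_lattice"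
    and "\<And>z. z \<in> even_lattice \<Longrightarrow>
           distr M (count_space UNIV) (\<xi> z) = measure_pmf (bernoulli_pmf (1/2))"
    and "standard_brownian_motion N B"
    and "(x1, x2) \<in> even_lattice"
  shows "converges_in_distribution
           (inf at_top (principal {l::real. 0 < l \<and> l\<^sup>2 * real_of_int x1 \<in> \<int>}))
           M (\<lambda>l \<omega>.
                (real (longest_path (\<lambda>z. \<xi> z \<omega>) l (l\<^sup>2 * real_of_int x1, l\<^sup>2 * real_of_int x2)) / l\<^sup>2,
                 real (traffic (\<lambda>z. \<xi> z \<omega>) l (l\<^sup>2 * real_of_int x1, l\<^sup>2 * real_of_int x2)) / l ^ 3))
           N (\<lambda>\<omega>.
                (hitting_time B \<omega> / 2,
                 (1 / 4) * (LBINT t:{0..hitting_time B \<omega>}. 1 + B t \<omega>)))"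
proof -
  interpret BM: brownian_motion N B by (rule standard_brownian_motion_locale[OF assms(4)])
  let ?F = "inf at_top (principal {l::real. 0 < l \<and> l\<^sup>2 * real_of_int x1 \<in> \<int>})"
  let ?c = "\<lambda>l. \<lfloor>l\<^sup>2 * real_of_int x1\<rfloor>"
  let ?m = "\<lambda>l. l\<^sup>2 * real_of_int x2"
  let ?L = "\<lambda>l. bottom_node (?c l) (?m l - l / 2)"
  let ?U = "\<lambda>l. top_node (?c l) (?m l + l / 2)"
  let ?tau = "\<lambda>l \<omega>. real (longest_path (\<lambda>z. \<xi> z \<omega>) l (l\<^sup>2 * real_of_int x1, l\<^sup>2 * real_of_int x2))"
  let ?T = "\<lambda>l \<omega>. real (traffic (\<lambda>z. \<xi> z \<omega>) l (l\<^sup>2 * real_of_int x1, l\<^sup>2 * real_of_int x2))"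
  let ?X = "\<lambda>l \<omega>. (?tau l \<omega> / l\<^sup>2, ?T l \<omega> / l ^ 3)"
  let ?Y = "\<lambda>\<omega>. (hitting_time B \<omega> / 2, 1 / 4 * (LBINT t:{0..hitting_time B \<omega>}. 1 + B t \<omega>))"
  have seg: "random_traffic M (?c l) (?m l) l (?L l) (?U l) \<xi>" if "0 < l" for l
    using assms(1-3) that
    by (intro random_traffic.intro traffic_segment.intro random_traffic_axioms.intro) auto
  have col: "real_of_int (?c l) = l\<^sup>2 * real_of_int x1" if "l\<^sup>2 * real_of_int x1 \<in> \<int>" for l
    using that by (auto elim: Ints_cases)
  \<comment> \<open>Under the integrality condition the column \<open>l\<^sup>2 x1\<close> agrees with its floor, so everything can be stated
    for the floor and large real \<open>l\<close>.\<close>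
  have ev: "\<forall>\<^sub>F l in ?F. P l" if "\<forall>\<^sub>F l in at_top. 0 < l \<longrightarrow> l\<^sup>2 * real_of_int x1 \<in> \<int> \<longrightarrow> P l" for P
    using that by (auto simp: eventually_inf_principal elim: eventually_mono)
  show ?thesis
  proof (rule converges_in_distribution_laplace[OF assms(1) BM.prob_space_axioms])
    show "\<forall>\<^sub>F l in ?F. ?X l \<in> borel_measurable M"
    proof (intro ev always_eventually allI impI)
      fix l :: real assume l: "0 < l" "l\<^sup>2 * real_of_int x1 \<in> \<int>"
      note [measurable] = random_traffic.tau_measurable[OF seg[OF l(1)], unfolded col[OF l(2)]]
        random_traffic.T_measurable[OF seg[OF l(1)], unfolded col[OF l(2)]]
      show "?X l \<in> borel_measurable M" by measurable
    qed
    show "\<forall>\<^sub>F l in ?F. \<forall>\<omega>. 0 \<le> fst (?X l \<omega>) \<and> 0 \<le> snd (?X l \<omega>)"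
      by (intro ev always_eventually) auto
    note [measurable] = BM.hitting_time_measurable BM.passage_area_measurable
    show "?Y \<in> borel_measurable N"
      by measurable
    show "AE \<omega> in N. 0 \<le> fst (?Y \<omega>) \<and> 0 \<le> snd (?Y \<omega>)"
      using BM.passage_laplace(2)[of 1 0, OF _ zero_less_one order_refl] decaying_solution_exists[of 1 0]
      by auto
    fix a b :: real assume a: "0 < a" and b: "0 \<le> b"
    obtain u u1 where sol: "decaying_solution a (b / 2) u u1" using decaying_solution_exists[of a "b / 2"] a b by auto
    obtain v K where v: "smooth_extension a (b / 2) v K" "\<And>x. 0 \<le> x \<Longrightarrow> v x = u x"
      using smooth_extension_exists[OF sol a] b by auto
    let ?E = "\<lambda>l. \<integral>\<omega>. exp (- (a * (?tau l \<omega> / l\<^sup>2) + b * (?T l \<omega> / l ^ 3))) \<partial>M"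
    have limit: "(\<integral>\<omega>. exp (- (a * fst (?Y \<omega>) +
          b * snd (?Y \<omega>))) \<partial>N) = v 1"
      unfolding fst_conv snd_conv using BM.passage_laplace(1)[OF sol a b] v(2)[of 1] by simp
    have "((\<lambda>l. ?E l) \<longlongrightarrow> v 1) ?F"
    proof (rule tendstoI)
      fix e :: real assume e: "0 < e"
      \<comment> \<open>Starting points are at most \<open>2\<close>, and \<open>sqrt p * 2 = e / 4\<close> bounds \<open>1 - r x\<close> for \<open>x \<le> 2\<close>.\<close>
      define p where "p = (e / 8)\<^sup>2"
      have p: "0 < p" "sqrt p = e / 8" using e by (auto simp: p_def)
      obtain r R where r: "smooth_extension p 0 r R" "\<And>x. 0 \<le> x \<Longrightarrow> r x = exp (- sqrt p * x)"
        using smooth_extension_exists[OF decaying_solution_exp p(1) order_refl] p(1) by auto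
      have vc: "continuous_on UNIV v" using v(1) unfolding smooth_extension_def by blast
      obtain d where d: "0 < d" "\<And>s. \<bar>s - 1\<bar> \<le> d \<Longrightarrow> \<bar>v s - v 1\<bar> < e / 4"
        using continuous_onE[OF vc, of 1 "e / 4"] e unfolding dist_real_def by auto
      define C where "C = 6 * K * (1 + a) / a + 6 * R * (1 + p) / p"
      have "((\<lambda>l::real. 2 / l) \<longlongrightarrow> 0) at_top" by real_asymp
      moreover have "((\<lambda>l::real. C * (2 / l)) \<longlongrightarrow> 0) at_top" by real_asymp
      ultimately have "\<forall>\<^sub>F l in at_top. 2 / l < min d 1 \<and> C * (2 / l) < e / 4"
        using d(1) e by (intro eventually_conj order_tendstoD(2)) auto
      then have "\<forall>\<^sub>F l in at_top. 0 < l \<longrightarrow> l\<^sup>2 * real_of_int x1 \<in> \<int> \<longrightarrow>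
          dist (?E l) (v 1) < e"
      proof (rule eventually_mono, intro impI)
        fix l :: real
        assume small: "2 / l < min d 1 \<and> C * (2 / l) < e / 4" and l: "0 < l" "l\<^sup>2 * real_of_int x1 \<in> \<int>"
        interpret RT: random_traffic M "?c l" "?m l" l "?L l" "?U l" \<xi> by (rule seg[OF l(1)])
        have mesh: "RT.mesh < d" "RT.mesh < 1" "C * RT.mesh < e / 4" using small by (auto simp: RT.mesh_def)
        have "RT.mesh\<^sup>2 \<le> 1" using mesh(2) RT.mesh_pos by (simp add: power_le_one)
        then have fine: "RT.mesh\<^sup>2 / 2 \<le> 1" by simp
        have "1 - r RT.start \<le> sqrt p * RT.start"
          using exp_ge_add_one_self[of "- sqrt p * RT.start"] r(2)[OF RT.start_bounds(2)] by simp
        also have "\<dots> \<le> sqrt p * 2"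
          using RT.start_bounds(1) mesh(2) p(1) by (intro mult_left_mono) auto
        finally have "1 - r RT.start \<le> e / 4" by (simp add: p(2))
        moreover have "\<bar>v RT.start - v 1\<bar> < e / 4" using RT.start_bounds(1) mesh(1) by (intro d(2)) simp
        moreover note RT.laplace_error[OF v(1) r(1) a b p(1) fine, folded C_def, unfolded col[OF l(2)]]
        ultimately show "dist (?E l) (v 1) < e"
          using mesh(3) unfolding dist_real_def by linarith
      qed
      then show "\<forall>\<^sub>F l in ?F. dist (?E l) (v 1) < e"
        by (rule ev)
    qed
    then show "((\<lambda>l. \<integral>\<omega>. exp (- (a * fst (?X l \<omega>) + b * snd (?X l \<omega>))) \<partial>M) \<longlongrightarrow>
        (\<integral>\<omega>. exp (- (a * fst (?Y \<omega>) +
          b * snd (?Y \<omega>))) \<partial>N)) ?F"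
      unfolding limit unfolding fst_conv snd_conv .
  qed
qed

end
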